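(* Suppose $\lambda$ is a compactly supported Borel probability measure on $\mathbb{R}^d$ and fix $0<r_0<R_0<\infty$. For exponents $p,q,s\in[1,\infty]$ or, more generally, $p,q,s\in(0,\infty]$, let $(\ast)_{p,q,s}$ denote the statement that there is a constant $K$ with $$\Big(\int_{\mathbb{R}^d}\Big(\int_{r_0}^{R_0}|Sf(x,r)|^{s}\,dr\Big)^{q/s}\,d\lambda(x)\Big)^{1/q}\le K\,\|f\|_{L^p(\mathbb{R}^d)}\qquad\text{for all Schwartz functions } f \text{ on }\mathbb{R}^d$$ (with the usual modification, an essential supremum with respect to $\lambda$, when $q=\infty$). (a) Suppose $d=2$ and $\alpha>1/2$, and suppose that $$\int_{\mathbb{R}^2}\int_{\mathbb{R}^2}\frac{1}{|x_1-x_2|^{\alpha}}\,d\lambda(x_2)\,d\lambda(x_1)\le C<\infty .$$ Then $(\ast)_{p,q,s}$ holds whenever $$\Big(\frac1p,\frac1q,\frac1s\Big)=t\Big(\frac12,\frac1{2\alpha},\frac14\Big)+(1-t)\big(1,0,1\big),\qquad 0\le t<1 .$$ (b) Suppose $d=2$ and $0<\alpha<\alpha'<1/2$, and suppose that $\lambda(B(x,\delta))\le C\delta^{\alpha'}$ for all $x\in\mathbb{R}^2$, $\delta>0$. Then $(\ast)_{p,q,s}$ holds whenever $$\Big(\frac1p,\frac1q,\frac1s\Big)=t\Big(\frac1{1+2\alpha},\frac1{1+2\alpha},\frac{1-\alpha}{1+2\alpha}\Big)+(1-t)\big(1,0,1\big),\qquad 0\le t<1 .$$ (c) Suppose $d>2$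 and $0<\alpha<\alpha'<1$, and suppose that $\lambda(B(x,\delta))\le C\delta^{\alpha'}$ for all $x\in\mathbb{R}^d$, $\delta>0$. Then $(\ast)_{p,q,s}$ holds whenever $$\Big(\frac1p,\frac1q,\frac1s\Big)=t\Big(\frac1{1+\alpha},\frac1{1+\alpha},\frac{1-\alpha}{1+\alpha}\Big)+(1-t)\big(1,0,1\big),\qquad 0\le t<1 .$$ In each case the constant $K$ depends only on $d$, $\alpha$ (and $\alpha'$ in (b), (c)), $r_0$, $R_0$, the size of the support of $\lambda$ (i.e. a number $M$ such that $\lambda$ is supported in $B(0,M)$), $C$, and $t$.
   Context: $S$ is the spherical averaging operator, defined for nice functions $f$ on $\mathbb{R}^d$, $x\in\mathbb{R}^d$ and $r>0$ by $Sf(x,r)=\int_{S^{d-1}}f(x-r\sigma)\,d\sigma$, where $d\sigma$ is Lebesgue (surface) measure on the unit sphere $S^{d-1}\subset\mathbb{R}^d$. $B(x,\delta)$ is the ball of radius $\delta$ centered at $x$. *)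

theory Defs
  imports
    "HOL-Analysis.Analysis"
    "HOL-Probability.Probability_Measure"
    "HOL-Probability.Essential_Supremum"
begin

section \<open>Schwartz functions\<close>

text \<open>\<open>iter_deriv [b1, \<dots>, bk] f\<close> is the iterated directional derivative
  \<open>\<partial>_{b1} \<dots> \<partial>_{bk} f\<close>; the junk value of \<^const>\<open>frechet_derivative\<close> at points of
  non-differentiability never matters below, because differentiability of every iterated
  partial derivative (i.e. smoothness) is part of \<open>schwartz\<close>.\<close>

primrec iter_deriv ::
  "'a::euclidean_space list \<Rightarrow> ('a \<Rightarrow> complex) \<Rightarrow> 'a \<Rightarrow> complex" where
  "iter_deriv [] f = f"
| "iter_deriv (b # bs) f = (\<lambda>x. frechet_derivative (iter_deriv bs f) (at x) b)"

definition schwartz :: "('a::euclidean_space \<Rightarrow> complex) \<Rightarrow> bool" where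
  "schwartz f \<longleftrightarrow>
    (\<forall>bs. set bs \<subseteq> Basis \<longrightarrow>
      (\<forall>x. iter_deriv bs f differentiable (at x)) \<and>
      (\<forall>k::nat. \<exists>B. \<forall>x. (1 + norm x) ^ k * norm (iter_deriv bs f x) \<le> B))"

section \<open>Surface measure and spherical averages\<close>

text \<open>The (unnormalised) surface measure on the unit sphere, given by the polar-coordinates
  formula \<open>\<sigma>(A) = d \<cdot> |{\<rho> \<omega> : \<omega> \<in> A, 0 < \<rho> < 1}|\<close>, where \<open>d\<close> is the dimension of the ambient
  space. Its total mass is \<open>d\<close> times the volume of the unit ball. Note \<open>sgn x = x /\<^sub>R norm x\<close>.\<close>

definition sphere_measure :: "'a::euclidean_space measure" where
  "sphere_measure =
    scale_measure (of_nat DIM('a))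
      (distr (restrict_space lborel (ball 0 1 - {0})) (restrict_space borel (sphere 0 1)) sgn)"

lemma emeasure_sphere_measure:
  assumes "A \<in> sets borel" "A \<subseteq> sphere (0::'a::euclidean_space) 1"
  shows "emeasure sphere_measure A =
    of_nat DIM('a) * emeasure lborel {\<rho> *\<^sub>R \<omega> | \<rho> \<omega>. \<omega> \<in> A \<and> 0 < \<rho> \<and> \<rho> < 1}"
proof -
  let ?D = "ball 0 1 - {0::'a}"
  have meas: "sgn \<in> restrict_space lborel ?D \<rightarrow>\<^sub>M restrict_space borel (sphere (0::'a) 1)"
  proof (rule measurable_restrict_space2)
    show "sgn \<in> space (restrict_space lborel ?D) \<rightarrow> sphere (0::'a) 1"
      by (auto simp: space_restrict_space norm_sgn)
    have "(\<lambda>x::'a. x /\<^sub>R norm x) \<in> borel_measurable lborel"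
      by measurable
    then have "(sgn :: 'a \<Rightarrow> 'a) \<in> borel_measurable lborel"
      by (simp add: sgn_div_norm[abs_def])
    then show "sgn \<in> borel_measurable (restrict_space lborel ?D)"
      by (rule measurable_restrict_space1)
  qed
  have A: "A \<in> sets (restrict_space borel (sphere (0::'a) 1))"
    using assms by (auto simp: sets_restrict_space_iff)
  have cone: "sgn -` A \<inter> ?D = {\<rho> *\<^sub>R \<omega> | \<rho> \<omega>. \<omega> \<in> A \<and> 0 < \<rho> \<and> \<rho> < 1}" (is "?L = ?R")
  proof
    show "?L \<subseteq> ?R"
    proof
      fix x assume "x \<in> ?L"
      then have "sgn x \<in> A" "0 < norm x" "norm x < 1" "x = norm x *\<^sub>R sgn x"
        by (auto simp: sgn_div_norm)
      then show "x \<in> ?R" by blast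
    qed
    show "?R \<subseteq> ?L"
    proof
      fix x assume "x \<in> ?R"
      then obtain \<rho> \<omega> where *: "x = \<rho> *\<^sub>R \<omega>" "\<omega> \<in> A" "0 < \<rho>" "\<rho> < 1" by blast
      then have "norm \<omega> = 1" using assms by auto
      with * show "x \<in> ?L" by (auto simp: sgn_div_norm)
    qed
  qed
  show ?thesis
    using meas A
    by (simp add: sphere_measure_def emeasure_distr space_restrict_space cone[symmetric])
       (subst emeasure_restrict_space, auto)
qed

definition spherical_avg :: "('a::euclidean_space \<Rightarrow> complex) \<Rightarrow> 'a \<Rightarrow> real \<Rightarrow> complex" where
  "spherical_avg f x r = (LINT \<sigma>|sphere_measure. f (x - r *\<^sub>R \<sigma>))"

section \<open>Mixed norms\<close>

text \<open>Only used with \<open>a > 0\<close>.\<close>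

definition epow :: "ennreal \<Rightarrow> real \<Rightarrow> ennreal" where
  "epow u a = (if u = \<infinity> then \<infinity> else ennreal (enn2real u powr a))"

text \<open>The \<open>L\<^sup>p\<close> (quasi-)norm of a nonnegative function, \<open>0 < p \<le> \<infinity>\<close>.\<close>

definition Lp_norm :: "'a measure \<Rightarrow> ennreal \<Rightarrow> ('a \<Rightarrow> ennreal) \<Rightarrow> ennreal" where
  "Lp_norm M p f =
    (if p = \<infinity> then esssup M f
     else epow (\<integral>\<^sup>+x. epow (f x) (enn2real p) \<partial>M) (1 / enn2real p))"

text \<open>The estimate \<open>(\<ast>)\<close> for the exponents \<open>p, q, s\<close>, with the constant \<open>K\<close>.\<close>

definition spherical_estimate ::
  "real \<Rightarrow> real \<Rightarrow> 'a::euclidean_space measure \<Rightarrow> ennreal \<Rightarrow> ennreal \<Rightarrow> ennreal \<Rightarrow> real \<Rightarrow> bool" where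
  "spherical_estimate r0 R0 \<mu> p q s K \<longleftrightarrow>
    (\<forall>f. schwartz f \<longrightarrow>
      Lp_norm \<mu> q (\<lambda>x. Lp_norm (restrict_space lborel {r0..R0}) s
                       (\<lambda>r. ennreal (norm (spherical_avg f x r))))
      \<le> ennreal K * Lp_norm lborel p (\<lambda>x. ennreal (norm (f x))))"

section \<open>Hypotheses on the measure\<close>

definition msupport :: "'a::metric_space measure \<Rightarrow> 'a set" where
  "msupport \<mu> = {x. \<forall>e>0. 0 < emeasure \<mu> (ball x e)}"

definition borel_prob_supported_in :: "'a::euclidean_space measure \<Rightarrow> real \<Rightarrow> bool" where
  "borel_prob_supported_in \<mu> M \<longleftrightarrow>
    prob_space \<mu> \<and> sets \<mu> = sets borel \<and> compact (msupport \<mu>) \<and> msupport \<mu> \<subseteq> ball 0 M"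

text \<open>The quotient is taken in \<^typ>\<open>ennreal\<close>, so that the kernel is \<open>\<infinity>\<close> on the diagonal
  (in \<^typ>\<open>real\<close> it would be \<open>0\<close>).\<close>

definition energy :: "real \<Rightarrow> 'a::euclidean_space measure \<Rightarrow> ennreal" where
  "energy \<alpha> \<mu> = (\<integral>\<^sup>+x1. (\<integral>\<^sup>+x2. 1 / ennreal (norm (x1 - x2) powr \<alpha>) \<partial>\<mu>) \<partial>\<mu>)"

definition ball_growth :: "real \<Rightarrow> real \<Rightarrow> 'a::euclidean_space measure \<Rightarrow> bool" where
  "ball_growth C \<beta> \<mu> \<longleftrightarrow> (\<forall>x. \<forall>\<delta>>0. measure \<mu> (ball x \<delta>) \<le> C * \<delta> powr \<beta>)"

end

theory Submission
  imports Defs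
begin

text \<open>
  Write \<open>A \<phi> (x, r)\<close> for the spherical average of a nonnegative function \<open>\<phi>\<close>, so that
  \<open>|S f| \<le> A |f|\<close>, and \<open>D\<close> for the distance of two points \<open>x1\<close>, \<open>x2\<close> of the support of \<open>\<lambda>\<close>.

  Interpolation costs nothing, because \<open>A\<close> is positive. On the segment between an endpoint
  \<open>(1/P, 1/Q, 1/S)\<close> and \<open>(1, 0, 1)\<close> one factors \<open>\<phi> = f1\<^sup>t f0\<^sup>1\<^sup>-\<^sup>t\<close>, where \<open>f1\<close> is the power \<open>p/P\<close> and
  \<open>f0\<close> the power \<open>p\<close> of \<open>\<phi>\<close>. Hoelder's inequality on the sphere gives
  \<open>A \<phi> \<le> (A f1)\<^sup>t (A f0)\<^sup>1\<^sup>-\<^sup>t\<close>, and two more applications of Hoelder's inequality deduce the estimate for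
  \<open>\<phi>\<close> from the endpoint estimate for \<open>f1\<close> and from \<open>\<integral> A f0 (x, r) dr \<le> K \<parallel>f0\<parallel>\<^sub>1\<close>, which is
  polar coordinates (\<open>mixed_bound_interpolation\<close>). Hence only \<open>t = 1\<close> needs work.

  At \<open>t = 1\<close> one dualises: the claim is a bound in \<open>L\<^sup>P\<^sup>'\<close> for
  \<open>N(y) = \<integral> g(x, |x - y|) d\<lambda>(x)\<close>, with \<open>g\<close> in \<open>L\<^sup>Q\<^sup>'(\<lambda>; L\<^sup>S\<^sup>'(dr))\<close>
  (\<open>mixed_bound_from_adjoint\<close>). The only geometric input is how two families of concentric spheres
  meet (\<open>annular_pair_bound\<close>):
  \<open>\<integral> G1(|x1 - y|) G2(|x2 - y|) dy\<close> is at most a constant times \<open>D\<close> to the power \<open>-\<kappa>\<close> times the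
  \<open>L\<^sup>m\<close> norms of \<open>G1\<close> and \<open>G2\<close>, with \<open>\<kappa> = 1\<close>, \<open>m = 1\<close> in dimension at least three and \<open>\<kappa> = 1/2\<close>,
  \<open>m = 4/3\<close> in the plane. In the coordinates \<open>(|x1 - y|, |x2 - y|)\<close> Lebesgue measure has a density
  of size \<open>1/D\<close> in the first case. In the plane the density is comparable to the reciprocal of the area of
  the triangle \<open>x1, x2, y\<close>, hence singular where the two circles are tangent, and the exponent \<open>4/3\<close> comes from
  fractional integration of order one half in the radii (\<open>fractional_integration\<close>).

  For a measure of finite energy \<open>P' = 2\<close>. Expanding the square of \<open>N\<close> and integrating in \<open>y\<close> leaves the
  kernel \<open>D\<close> to the power \<open>-1/2\<close>, which is a power of the energy kernel, so that Hoelder's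
  inequality on \<open>\<lambda> \<Otimes> \<lambda>\<close> finishes the proof (\<open>adjoint_bound_energy\<close>).

  For a measure with ball growth of exponent \<open>\<beta>\<close> slightly above \<open>\<alpha>\<close>, \<open>P' = 1 + \<kappa>/\<alpha>\<close> exceeds 2, and a square can no longer be
  expanded. Instead one proves, for every function \<open>u \<ge> 0\<close> and \<open>M \<ge> 2\<close>, that the power \<open>M\<close> of
  \<open>\<integral> u d\<lambda>\<close> is at most a constant times the double integral of
  \<open>D\<^sup>\<beta>\<^sup>(\<^sup>M\<^sup>-\<^sup>2\<^sup>) (u(x1) u(x2))\<^sup>M\<^sup>/\<^sup>2\<close> (\<open>power_of_mass_le\<close>): among the pairs that make up the square of
  \<open>\<integral> u d\<lambda>\<close>, those too close together for their height can be absorbed by the growth of \<open>\<lambda>\<close>, and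
  for all others the surplus power \<open>M - 2\<close> of \<open>\<integral> u d\<lambda>\<close> is controlled by \<open>D\<close> and the height. With
  \<open>u(x) = g(x, |x - y|)\<close> and \<open>M = P'\<close> the pair estimate applies to the power \<open>M/2\<close> of \<open>g\<close>, and the
  kernel that remains is \<open>D\<close> to a power above \<open>-\<beta>\<close>, precisely because \<open>\<alpha> < \<beta>\<close>. It is integrable
  against \<open>\<lambda>\<close>, and Schur's test concludes (\<open>adjoint_bound_ball_growth\<close>).
\<close>

section \<open>Powers and Hoelder's inequality for extended nonnegative functions\<close>

lemma epow_ennreal: "0 \<le> x \<Longrightarrow> epow (ennreal x) a = ennreal (x powr a)"
  by (simp add: epow_def)

lemma epow_top [simp]: "epow top a = top"
  by (simp add: epow_def)

lemma epow_0 [simp]: "epow 0 a = 0"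
  by (simp add: epow_def)

lemma epow_1 [simp]: "epow u 1 = u"
  by (cases u) (simp_all add: epow_def)

lemma epow_eq_0_iff [simp]: "epow u a = 0 \<longleftrightarrow> u = 0"
  by (cases u) (auto simp: epow_def)

lemma epow_eq_top_iff [simp]: "epow u a = top \<longleftrightarrow> u = top"
  by (simp add: epow_def)

lemma epow_mono: "0 \<le> a \<Longrightarrow> u \<le> v \<Longrightarrow> epow u a \<le> epow v a"
  by (cases u; cases v) (auto simp: epow_def top_unique intro!: ennreal_leI powr_mono2)

lemma epow_mult: "epow (u * v) a = epow u a * epow v a"
proof (cases "u = 0 \<or> v = 0")
  case False
  then show ?thesis
    by (cases u; cases v) (auto simp: epow_def ennreal_mult_top ennreal_top_mult powr_mult simp flip: ennreal_mult)
qed auto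

lemma epow_epow: "epow (epow u a) b = epow u (a * b)"
  by (cases u) (auto simp: epow_def powr_powr)

lemma epow_add: "epow u a * epow u b = epow u (a + b)"
  by (cases u) (auto simp: epow_def powr_add ennreal_mult'' ennreal_top_mult)

lemma measurable_epow [measurable]:
  "f \<in> borel_measurable M \<Longrightarrow> (\<lambda>x. epow (f x) a) \<in> borel_measurable M"
proof -
  assume f [measurable]: "f \<in> borel_measurable M"
  have "{x \<in> space M. f x = \<infinity>} = f -` {\<infinity>} \<inter> space M"
    by auto
  also have "\<dots> \<in> sets M"
    using f by (rule measurable_sets) simp
  finally have "{x \<in> space M. f x = \<infinity>} \<in> sets M" .
  then show ?thesis
    unfolding epow_def by (intro measurable_If) measurable
qed

lemma Young_ennreal:
  assumes "0 < a" "a < 1"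
  shows "epow u a * epow v (1 - a) \<le> ennreal a * u + ennreal (1 - a) * v"
proof (cases "u = 0 \<or> v = 0")
  case False
  show ?thesis
  proof (cases u)
    case (real x)
    show ?thesis
    proof (cases v)
      case (real y)
      have "0 < x" "0 < y"
        using False \<open>u = ennreal x\<close> \<open>0 \<le> x\<close> real by (auto simp: less_le)
      have "x powr a * y powr (1 - a) \<le> a * x + (1 - a) * y"
        using Youngs_inequality_0[of a "1 - a" x y] assms \<open>0 < x\<close> \<open>0 < y\<close> by simp
      then show ?thesis
        using \<open>0 < x\<close> \<open>0 < y\<close> assms
        by (simp add: real \<open>u = ennreal x\<close> epow_ennreal ennreal_leI flip: ennreal_mult ennreal_plus)
    qed (use assms in \<open>simp add: ennreal_mult_top\<close>)
  qed (use assms in \<open>simp add: ennreal_mult_top\<close>)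
qed auto

text \<open>
  Normalise both integrals to 1 and integrate Young's inequality; if an integral is 0 or infinite
  the claim is immediate. Writing the exponents as \<open>a\<close> and \<open>1 - a\<close> avoids dual exponents in the iterated uses below.
\<close>

lemma nn_integral_Holder:
  assumes [measurable]: "F \<in> borel_measurable M" "G \<in> borel_measurable M"
    and a: "0 < a" "a < 1"
  shows "(\<integral>\<^sup>+x. epow (F x) a * epow (G x) (1 - a) \<partial>M)
    \<le> epow (\<integral>\<^sup>+x. F x \<partial>M) a * epow (\<integral>\<^sup>+x. G x \<partial>M) (1 - a)"
proof -
  let ?X = "\<integral>\<^sup>+x. F x \<partial>M" and ?Y = "\<integral>\<^sup>+x. G x \<partial>M"
  consider "?X = 0 \<or> ?Y = 0" | "?X \<noteq> 0" "?Y \<noteq> 0" "?X = \<infinity> \<or> ?Y = \<infinity>"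
    | "?X \<noteq> 0" "?Y \<noteq> 0" "?X < \<infinity>" "?Y < \<infinity>"
    by (metis infinity_ennreal_def less_top)
  then show ?thesis
  proof cases
    case 1
    then have "(AE x in M. F x = 0) \<or> (AE x in M. G x = 0)"
      by (simp add: nn_integral_0_iff_AE)
    then have "AE x in M. epow (F x) a * epow (G x) (1 - a) = 0"
      by auto
    then have "(\<integral>\<^sup>+x. epow (F x) a * epow (G x) (1 - a) \<partial>M) = (\<integral>\<^sup>+x. 0 \<partial>M)"
      by (rule nn_integral_cong_AE)
    then show ?thesis by simp
  next
    case 2
    then have "epow ?X a * epow ?Y (1 - a) = \<infinity>"
      by (auto simp: ennreal_mult_top ennreal_top_mult)
    then show ?thesis by simp
  next
    case 3
    obtain X where X: "?X = ennreal X" "0 < X"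
      using 3 by (cases ?X) (auto simp: less_le)
    obtain Y where Y: "?Y = ennreal Y" "0 < Y"
      using 3 by (cases ?Y) (auto simp: less_le)
    define c where "c = ennreal (X powr a * Y powr (1 - a))"
    have *: "epow (F x) a * epow (G x) (1 - a)
        \<le> c * (ennreal (a / X) * F x + ennreal ((1 - a) / Y) * G x)" for x
    proof -
      have F: "F x = ennreal X * (ennreal (1 / X) * F x)"
        using X by (simp add: mult.assoc[symmetric] flip: ennreal_mult)
      have G: "G x = ennreal Y * (ennreal (1 / Y) * G x)"
        using Y by (simp add: mult.assoc[symmetric] flip: ennreal_mult)
      have "epow (F x) a * epow (G x) (1 - a)
          = c * (epow (ennreal (1 / X) * F x) a * epow (ennreal (1 / Y) * G x) (1 - a))"
        using X Y by (subst F, subst G)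
          (simp only: epow_mult c_def, simp add: epow_ennreal ennreal_mult'' mult_ac)
      also have "\<dots> \<le> c * (ennreal a * (ennreal (1 / X) * F x)
          + ennreal (1 - a) * (ennreal (1 / Y) * G x))"
        by (intro mult_left_mono Young_ennreal a) simp
      also have "\<dots> = c * (ennreal (a / X) * F x + ennreal ((1 - a) / Y) * G x)"
        using a X Y by (simp add: mult.assoc[symmetric] flip: ennreal_mult)
      finally show ?thesis .
    qed
    have "(\<integral>\<^sup>+x. epow (F x) a * epow (G x) (1 - a) \<partial>M)
        \<le> (\<integral>\<^sup>+x. c * (ennreal (a / X) * F x + ennreal ((1 - a) / Y) * G x) \<partial>M)"
      by (intro nn_integral_mono *)
    also have "\<dots> = c * (ennreal (a / X) * ?X + ennreal ((1 - a) / Y) * ?Y)"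
      by (simp add: nn_integral_cmult nn_integral_add)
    also have "ennreal (a / X) * ?X + ennreal ((1 - a) / Y) * ?Y = 1"
      using X Y a by (simp flip: ennreal_mult ennreal_plus)
    also have "c * 1 = epow ?X a * epow ?Y (1 - a)"
      using X Y by (simp add: c_def epow_ennreal ennreal_mult'')
    finally show ?thesis .
  qed
qed

section \<open>Polar coordinates for the surface measure\<close>

text \<open>
  The counterpart of \<open>LBINT\<close> for nonnegative functions on any Euclidean space.
\<close>

abbreviation nn_lborel :: "('a::euclidean_space \<Rightarrow> ennreal) \<Rightarrow> ennreal" (binder "LBN " 10) where
  "nn_lborel f \<equiv> integral\<^sup>N lborel f"

lemma space_sphere_measure [simp]: "space sphere_measure = sphere (0::'a::euclidean_space) 1"
  by (simp add: sphere_measure_def space_scale_measure space_restrict_space)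

lemma sets_sphere_measure [measurable_cong]:
  "sets (sphere_measure :: 'a::euclidean_space measure) = sets (restrict_space borel (sphere 0 1))"
  by (simp add: sphere_measure_def)

lemma measurable_sgn_ball:
  "sgn \<in> restrict_space lborel (ball 0 1 - {0}) \<rightarrow>\<^sub>M restrict_space borel (sphere (0::'a::euclidean_space) 1)"
proof (rule measurable_restrict_space2)
  show "sgn \<in> space (restrict_space lborel (ball 0 1 - {0})) \<rightarrow> sphere (0::'a) 1"
    by (auto simp: space_restrict_space norm_sgn)
  have "(\<lambda>x::'a. x /\<^sub>R norm x) \<in> borel_measurable lborel"
    by measurable
  then have "(sgn :: 'a \<Rightarrow> 'a) \<in> borel_measurable lborel"
    by (simp add: sgn_div_norm[abs_def])
  then show "sgn \<in> borel_measurable (restrict_space lborel (ball 0 1 - {0::'a}))"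
    by (rule measurable_restrict_space1)
qed

lemma borel_measurable_sphere_measureI [measurable (raw)]:
  "f \<in> borel_measurable borel \<Longrightarrow> f \<in> borel_measurable (sphere_measure :: 'a::euclidean_space measure)"
  by (simp add: measurable_cong_sets[OF sets_sphere_measure refl] measurable_restrict_space1)

lemma measurable_snd_sphere_measure:
  "(\<lambda>p. snd p) \<in> borel_measurable (M \<Otimes>\<^sub>M (sphere_measure :: 'a::euclidean_space measure))"
  by (rule measurable_compose[OF measurable_snd]) measurable

lemma nn_integral_sphere_measure:
  fixes f :: "'a::euclidean_space \<Rightarrow> ennreal"
  assumes [measurable]: "f \<in> borel_measurable borel"
  shows "(\<integral>\<^sup>+\<sigma>. f \<sigma> \<partial>sphere_measure)
    = of_nat DIM('a) * (\<integral>\<^sup>+z\<in>ball 0 1 - {0}. f (z /\<^sub>R norm z) \<partial>lborel)"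
  unfolding sphere_measure_def
  by (simp add: nn_integral_scale_measure nn_integral_distr[OF measurable_sgn_ball]
      measurable_restrict_space1 nn_integral_restrict_space sgn_div_norm)

lemma finite_sphere_measure: "finite_measure (sphere_measure :: 'a::euclidean_space measure)"
proof
  have "emeasure sphere_measure (sphere (0::'a) 1) = (\<integral>\<^sup>+\<sigma>. indicator (sphere (0::'a) 1) \<sigma> \<partial>sphere_measure)"
    by (subst nn_integral_indicator) (auto simp: sets_sphere_measure sets_restrict_space_iff)
  also have "\<dots> \<le> (\<integral>\<^sup>+\<sigma>. 1 \<partial>(sphere_measure :: 'a measure))"
    by (intro nn_integral_mono) (simp split: split_indicator)
  also have "\<dots> = of_nat DIM('a) * emeasure lborel (ball 0 1 - {0::'a})"
    by (subst nn_integral_sphere_measure) (simp_all add: nn_integral_indicator)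
  also have "\<dots> \<le> of_nat DIM('a) * emeasure lborel (ball (0::'a) 1)"
    by (intro mult_left_mono emeasure_mono) auto
  also have "\<dots> < \<infinity>"
    using emeasure_lborel_ball_finite[of "0::'a" 1] by (auto simp: ennreal_mult_less_top of_nat_less_top)
  finally show "emeasure sphere_measure (space (sphere_measure :: 'a measure)) \<noteq> \<infinity>" by simp
qed

text \<open>
  The Jacobian is written as a real power because it is combined with other real powers of \<open>c\<close> in the
  proof of the polar coordinate formula.
\<close>

lemma nn_integral_lborel_scale:
  fixes f :: "'a::euclidean_space \<Rightarrow> ennreal"
  assumes [measurable]: "f \<in> borel_measurable borel" and c: "0 < c"
  shows "(LBN z. f (c *\<^sub>R z)) = ennreal (c powr - real DIM('a)) * (LBN y. f y)"
proof -
  have "(LBN y. f y) = ennreal (c ^ DIM('a)) * (LBN z. f (c *\<^sub>R z))"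
    using c by (subst lborel_affine[of c 0])
      (simp_all add: nn_integral_density nn_integral_distr nn_integral_cmult)
  then show ?thesis
    using c by (simp add: powr_minus powr_realpow mult.assoc[symmetric] flip: ennreal_mult)
qed

lemma nn_integral_powr_atLeast:
  assumes "0 < a" "0 < d"
  shows "(\<integral>\<^sup>+l\<in>{a<..}. ennreal (l powr (- 1 - d)) \<partial>lborel) = ennreal (a powr - d / d)"
proof -
  have "(\<integral>\<^sup>+l\<in>{a<..}. ennreal (l powr (- 1 - d)) \<partial>lborel)
      = (LBN l. ennreal (l powr (- 1 - d)) * indicator {a..} l)"
  proof (rule nn_integral_cong_AE, rule AE_mp[OF AE_lborel_singleton[of a]], rule AE_I2, rule impI)
    fix l :: real assume "l \<noteq> a"
    then show "ennreal (l powr (- 1 - d)) * indicator {a<..} l = ennreal (l powr (- 1 - d)) * indicator {a..} l"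
      by (simp add: indicator_def)
  qed
  also have "\<dots> = ennreal (0 - (- (a powr - d) / d))"
  proof (rule nn_integral_FTC_atLeast)
    show "DERIV (\<lambda>x. - (x powr - d) / d) x :> x powr (- 1 - d)" if "a \<le> x" for x
    proof -
      have "((\<lambda>x. x powr - d) has_real_derivative - d * x powr (- 1 - d)) (at x)"
        using has_real_derivative_powr[of x "- d"] that assms by (simp add: minus_diff_commute)
      from DERIV_cdivide[OF DERIV_minus[OF this], of d] show ?thesis
        using assms by (simp add: algebra_simps minus_diff_commute)
    qed
    have "((\<lambda>x::real. x powr - d) \<longlongrightarrow> 0) at_top"
      using assms by (intro tendsto_neg_powr filterlim_ident) auto
    from tendsto_divide[OF tendsto_minus[OF this] tendsto_const[of d]]
    show "((\<lambda>x. - (x powr - d) / d) \<longlongrightarrow> 0) at_top"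
      using assms by simp
  qed auto
  finally show ?thesis by simp
qed

text \<open>
  The surface measure is the image of Lebesgue measure on the unit ball under \<open>z \<mapsto> z / |z|\<close>. Substituting
  \<open>r = l |z|\<close> on every ray and then \<open>y = l z\<close> in space, Fubini's theorem leaves for each \<open>y\<close> the integral
  of \<open>l\<^sup>-\<^sup>1\<^sup>-\<^sup>d\<close> over \<open>l > |y|\<close>, which is \<open>|y|\<^sup>-\<^sup>d / d\<close>. No parametrisation of the sphere is needed.
\<close>

lemma nn_integral_polar:
  fixes f :: "'a::euclidean_space \<Rightarrow> ennreal"
  assumes [measurable]: "f \<in> borel_measurable borel"
  shows "(\<integral>\<^sup>+r\<in>{0<..}. (\<integral>\<^sup>+\<sigma>. f (r *\<^sub>R \<sigma>) \<partial>sphere_measure) \<partial>lborel)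
    = (LBN y. f y * ennreal (norm y powr (1 - real DIM('a))))"
proof -
  let ?d = "real DIM('a)" and ?B = "ball 0 1 - {0::'a}"
  have d: "0 < ?d" by simp
  have [measurable]: "?B \<in> sets borel" by simp
  have "(\<integral>\<^sup>+r\<in>{0<..}. (\<integral>\<^sup>+\<sigma>. f (r *\<^sub>R \<sigma>) \<partial>sphere_measure) \<partial>lborel)
      = (LBN r z. of_nat DIM('a) * f ((r / norm z) *\<^sub>R z) * indicator ?B z * indicator {0<..} r)"
  proof (rule nn_integral_cong)
    fix r :: real
    have "(LBN z. (of_nat DIM('a) * (f ((r / norm z) *\<^sub>R z) * indicator ?B z)) * indicator {0<..} r)
        = (LBN z. of_nat DIM('a) * (f ((r / norm z) *\<^sub>R z) * indicator ?B z)) * indicator {0<..} r"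
      by (rule nn_integral_multc) measurable
    also have "(LBN z. of_nat DIM('a) * (f ((r / norm z) *\<^sub>R z) * indicator ?B z))
        = of_nat DIM('a) * (\<integral>\<^sup>+z\<in>?B. f ((r / norm z) *\<^sub>R z) \<partial>lborel)"
      by (rule nn_integral_cmult) measurable
    also have "\<dots> = (\<integral>\<^sup>+\<sigma>. f (r *\<^sub>R \<sigma>) \<partial>sphere_measure)"
      by (subst nn_integral_sphere_measure) (simp_all add: divide_inverse)
    finally show "(\<integral>\<^sup>+\<sigma>. f (r *\<^sub>R \<sigma>) \<partial>sphere_measure) * indicator {0<..} r
      = (LBN z. of_nat DIM('a) * f ((r / norm z) *\<^sub>R z) * indicator ?B z * indicator {0<..} r)"
      by (simp add: mult_ac)
  qed
  also have "\<dots> = (LBN z r. of_nat DIM('a) * f ((r / norm z) *\<^sub>R z) * indicator ?B z * indicator {0<..} r)"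
    by (rule lborel_pair.Fubini') measurable
  also have "\<dots> = (LBN z l. of_nat DIM('a) * ennreal (norm z) * f (l *\<^sub>R z) * indicator ?B z * indicator {0<..} l)"
  proof (rule nn_integral_cong)
    fix z :: 'a
    show "(LBN r. of_nat DIM('a) * f ((r / norm z) *\<^sub>R z) * indicator ?B z * indicator {0<..} r)
        = (LBN l. of_nat DIM('a) * ennreal (norm z) * f (l *\<^sub>R z) * indicator ?B z * indicator {0<..} l)"
    proof (cases "z = 0")
      case False
      define k where "k r = of_nat DIM('a) * f ((r / norm z) *\<^sub>R z) * indicator ?B z * indicator {0<..} r" for r
      have [measurable]: "k \<in> borel_measurable borel" unfolding k_def by measurable
      have "(LBN r. k r) = ennreal (norm z) * (LBN l. k (norm z * l))"
        using False by (subst nn_integral_real_affine[where c = "norm z" and t = 0]) simp_all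
      also have "\<dots> = (LBN l. ennreal (norm z) * k (norm z * l))"
        by (rule nn_integral_cmult[symmetric]) measurable
      also have "\<dots> = (LBN l. of_nat DIM('a) * ennreal (norm z) * f (l *\<^sub>R z) * indicator ?B z * indicator {0<..} l)"
      proof (rule nn_integral_cong)
        fix l
        have "indicator {0<..} (norm z * l) = (indicator {0<..} l :: ennreal)"
          using False by (simp add: indicator_def zero_less_mult_iff)
        then show "ennreal (norm z) * k (norm z * l)
            = of_nat DIM('a) * ennreal (norm z) * f (l *\<^sub>R z) * indicator ?B z * indicator {0<..} l"
          using False by (simp add: k_def mult_ac)
      qed
      finally show ?thesis by (simp only: k_def)
    qed simp
  qed
  also have "\<dots> = (LBN l z. of_nat DIM('a) * ennreal (norm z) * f (l *\<^sub>R z) * indicator ?B z * indicator {0<..} l)"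
    by (rule lborel_pair.Fubini') measurable
  also have "\<dots> = (LBN l y. of_nat DIM('a) * ennreal (norm y) * f y * ennreal (l powr (- 1 - ?d))
      * indicator {y. 0 < norm y \<and> norm y < l} y)"
  proof (rule nn_integral_cong)
    fix l :: real
    show "(LBN z. of_nat DIM('a) * ennreal (norm z) * f (l *\<^sub>R z) * indicator ?B z * indicator {0<..} l)
      = (LBN y. of_nat DIM('a) * ennreal (norm y) * f y * ennreal (l powr (- 1 - ?d))
      * indicator {y. 0 < norm y \<and> norm y < l} y)"
    proof (cases "0 < l")
      case True
      define h where "h y = of_nat DIM('a) * ennreal (norm y / l) * f y * indicator {y. 0 < norm y \<and> norm y < l} y" for y :: 'a
      have [measurable]: "h \<in> borel_measurable borel" unfolding h_def by measurable
      have "(LBN z. of_nat DIM('a) * ennreal (norm z) * f (l *\<^sub>R z) * indicator ?B z * indicator {0<..} l)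
          = (LBN z. h (l *\<^sub>R z))"
        using True by (intro nn_integral_cong) (auto simp: h_def split: split_indicator)
      also have "\<dots> = ennreal (l powr - ?d) * (LBN y. h y)"
        using True by (simp add: nn_integral_lborel_scale)
      also have "\<dots> = (LBN y. ennreal (l powr - ?d) * h y)"
        by (simp add: nn_integral_cmult)
      also have "\<dots> = (LBN y. of_nat DIM('a) * ennreal (norm y) * f y * ennreal (l powr (- 1 - ?d))
      * indicator {y. 0 < norm y \<and> norm y < l} y)"
      proof (rule nn_integral_cong)
        fix y :: 'a
        have eq: "ennreal (l powr - ?d) * ennreal (norm y / l) = ennreal (norm y) * ennreal (l powr (- 1 - ?d))"
        proof -
          have "l powr - ?d = l * l powr (- 1 - ?d)"
            using True powr_mult_base[of l "- 1 - ?d"] by simp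
          then have "l powr - ?d * (norm y / l) = norm y * l powr (- 1 - ?d)"
            using True by simp
          then have "ennreal (l powr - ?d * (norm y / l)) = ennreal (norm y * l powr (- 1 - ?d))"
            by (rule arg_cong)
          with True show ?thesis
            by (simp only: ennreal_mult powr_ge_zero norm_ge_zero divide_nonneg_pos)
        qed
        have "ennreal (l powr - ?d) * h y = (of_nat DIM('a) * f y
            * indicator {y. 0 < norm y \<and> norm y < l} y) * (ennreal (l powr - ?d) * ennreal (norm y / l))"
          unfolding h_def by (simp only: mult_ac)
        then show "ennreal (l powr - ?d) * h y = of_nat DIM('a) * ennreal (norm y) * f y * ennreal (l powr (- 1 - ?d))
      * indicator {y. 0 < norm y \<and> norm y < l} y"
          unfolding eq by (simp only: mult_ac)
      qed
      finally show ?thesis .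
    next
      case False
      then have "\<not> (0 < norm y \<and> norm y < l)" for y :: 'a
        using norm_ge_zero[of y] by linarith
      with False show ?thesis by simp
    qed
  qed
  also have "\<dots> = (LBN y l. of_nat DIM('a) * ennreal (norm y) * f y * ennreal (l powr (- 1 - ?d))
      * indicator {y. 0 < norm y \<and> norm y < l} y)"
    by (rule lborel_pair.Fubini') measurable
  also have "\<dots> = (LBN y. f y * ennreal (norm y powr (1 - ?d)))"
  proof (rule nn_integral_cong_AE, rule AE_mp[OF AE_lborel_singleton[of 0]], rule AE_I2, rule impI)
    fix y :: 'a assume y: "y \<noteq> 0"
    have "(LBN l. of_nat DIM('a) * ennreal (norm y) * f y * ennreal (l powr (- 1 - ?d))
        * indicator {y. 0 < norm y \<and> norm y < l} y)
      = (LBN l. (of_nat DIM('a) * ennreal (norm y) * f y) * (ennreal (l powr (- 1 - ?d)) * indicator {norm y<..} l))"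
      using y by (intro nn_integral_cong) (auto split: split_indicator)
    also have "\<dots> = (of_nat DIM('a) * ennreal (norm y) * f y) * ennreal (norm y powr - ?d / ?d)"
      using y d by (subst nn_integral_cmult) (simp_all add: nn_integral_powr_atLeast)
    also have "\<dots> = f y * (ennreal ?d * ennreal (norm y) * ennreal (norm y powr - ?d / ?d))"
      by (simp add: mult_ac flip: ennreal_of_nat_eq_real_of_nat)
    also have "ennreal ?d * ennreal (norm y) * ennreal (norm y powr - ?d / ?d) = ennreal (norm y powr (1 - ?d))"
    proof -
      have "norm y powr (1 - ?d) = ?d * norm y * (norm y powr - ?d / ?d)"
        using powr_mult_base[of "norm y" "- ?d"] by simp
      then have "ennreal (norm y powr (1 - ?d)) = ennreal (?d * norm y * (norm y powr - ?d / ?d))"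
        by (rule arg_cong)
      also have "\<dots> = ennreal (?d * norm y) * ennreal (norm y powr - ?d / ?d)"
        by (rule ennreal_mult) auto
      also have "ennreal (?d * norm y) = ennreal ?d * ennreal (norm y)"
        by (rule ennreal_mult) auto
      finally show ?thesis by simp
    qed
    finally show "(LBN l. of_nat DIM('a) * ennreal (norm y) * f y * ennreal (l powr (- 1 - ?d))
        * indicator {y. 0 < norm y \<and> norm y < l} y) = f y * ennreal (norm y powr (1 - ?d))" .
  qed
  finally show ?thesis .
qed

section \<open>Spherical averages, squared radii and orthogonal maps\<close>

text \<open>
  For nonnegative functions the average makes sense without integrability, and applied to \<open>|f|\<close> it dominates the
  absolute value of \<open>spherical_avg f\<close>.
\<close>

definition sph_avg :: "('a::euclidean_space \<Rightarrow> ennreal) \<Rightarrow> 'a \<Rightarrow> real \<Rightarrow> ennreal" where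
  "sph_avg \<phi> x r = (\<integral>\<^sup>+\<sigma>. \<phi> (x - r *\<^sub>R \<sigma>) \<partial>sphere_measure)"

lemma measurable_sph_avg [measurable]:
  fixes \<phi> :: "'a::euclidean_space \<Rightarrow> ennreal"
  assumes [measurable]: "\<phi> \<in> borel_measurable borel"
  shows "case_prod (sph_avg \<phi>) \<in> borel_measurable (borel \<Otimes>\<^sub>M borel)"
proof -
  interpret sphere: finite_measure "sphere_measure :: 'a measure"
    by (rule finite_sphere_measure)
  note [measurable] = measurable_snd_sphere_measure
  have "(\<lambda>p :: 'a \<times> real. \<integral>\<^sup>+\<sigma>. \<phi> (fst p - snd p *\<^sub>R \<sigma>) \<partial>sphere_measure) \<in> borel_measurable (borel \<Otimes>\<^sub>M borel)"
    by (rule sphere.borel_measurable_nn_integral) (simp add: split_beta')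
  then show ?thesis
    by (simp add: sph_avg_def split_beta')
qed

lemma nn_integral_lborel_reflect:
  fixes f :: "'a::euclidean_space \<Rightarrow> ennreal"
  assumes [measurable]: "f \<in> borel_measurable borel"
  shows "(LBN y. f (x - y)) = (LBN y. f y)"
  by (subst (2) lborel_affine[of "-1" x])
     (simp_all add: nn_integral_density nn_integral_distr one_ennreal_def[symmetric])

text \<open>
  Polar coordinates around \<open>x\<close>. For \<open>g = 1\<close> this is the endpoint estimate with exponents \<open>(1, \<infinity>, 1)\<close>; with a
  general \<open>g\<close> it transposes the averaging operator.
\<close>

lemma nn_integral_sph_avg_le:
  fixes \<phi> :: "'a::euclidean_space \<Rightarrow> ennreal"
  assumes [measurable]: "\<phi> \<in> borel_measurable borel" "g \<in> borel_measurable borel"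
    and r0: "0 < r0"
  shows "(\<integral>\<^sup>+r\<in>{r0..R0}. sph_avg \<phi> x r * g r \<partial>lborel)
    \<le> ennreal (r0 powr (1 - real DIM('a))) *
       (LBN y. \<phi> y * (g (dist x y) * indicator {r0..R0} (dist x y)))"
proof -
  let ?d = "real DIM('a)"
  define f where "f y = \<phi> (x - y) * (g (norm y) * indicator {r0..R0} (norm y))" for y
  have [measurable]: "f \<in> borel_measurable borel" unfolding f_def by measurable
  have "(\<integral>\<^sup>+r\<in>{r0..R0}. sph_avg \<phi> x r * g r \<partial>lborel)
      = (\<integral>\<^sup>+r\<in>{0<..}. (\<integral>\<^sup>+\<sigma>. f (r *\<^sub>R \<sigma>) \<partial>sphere_measure) \<partial>lborel)"
  proof (rule nn_integral_cong)
    fix r :: real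
    show "sph_avg \<phi> x r * g r * indicator {r0..R0} r
      = (\<integral>\<^sup>+\<sigma>. f (r *\<^sub>R \<sigma>) \<partial>sphere_measure) * indicator {0<..} r"
    proof (cases "0 < r")
      case True
      have "(\<integral>\<^sup>+\<sigma>. f (r *\<^sub>R \<sigma>) \<partial>sphere_measure)
          = (\<integral>\<^sup>+\<sigma>. \<phi> (x - r *\<^sub>R \<sigma>) * (g r * indicator {r0..R0} r) \<partial>sphere_measure)"
        using True by (intro nn_integral_cong) (simp add: f_def)
      also have "\<dots> = sph_avg \<phi> x r * (g r * indicator {r0..R0} r)"
        unfolding sph_avg_def by (rule nn_integral_multc) measurable
      finally show ?thesis using True by (simp add: mult.assoc)
    next
      case False
      then show ?thesis using r0 by simp
    qed
  qed
  also have "\<dots> = (LBN y. f y * ennreal (norm y powr (1 - ?d)))"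
    by (rule nn_integral_polar) measurable
  also have "\<dots> \<le> (LBN y. ennreal (r0 powr (1 - ?d)) * f y)"
  proof (rule nn_integral_mono)
    fix y :: 'a
    have "norm y powr (1 - ?d) \<le> r0 powr (1 - ?d)" if "r0 \<le> norm y"
      using that r0 by (intro powr_mono2') auto
    then show "f y * ennreal (norm y powr (1 - ?d)) \<le> ennreal (r0 powr (1 - ?d)) * f y"
      by (cases "r0 \<le> norm y") (auto simp: f_def mult.commute intro!: mult_right_mono ennreal_leI)
  qed
  also have "\<dots> = ennreal (r0 powr (1 - ?d)) * (LBN y. f y)"
    by (rule nn_integral_cmult) measurable
  also have "(LBN y. f y) = (LBN y. f (x - y))"
    by (rule nn_integral_lborel_reflect[symmetric]) measurable
  finally show ?thesis
    by (simp add: f_def dist_norm)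
qed

lemma nn_integral_radial:
  fixes h :: "real \<Rightarrow> ennreal"
  assumes [measurable]: "h \<in> borel_measurable borel"
  shows "(LBN y. h (norm (y::'a::euclidean_space)))
    = emeasure sphere_measure (sphere (0::'a) 1) * (\<integral>\<^sup>+r\<in>{0<..}. h r * ennreal (r powr (real DIM('a) - 1)) \<partial>lborel)"
proof -
  let ?d = "real DIM('a)" and ?s = "emeasure sphere_measure (sphere (0::'a) 1)"
  define f where "f y = h (norm y) * ennreal (norm y powr (?d - 1))" for y :: 'a
  have [measurable]: "f \<in> borel_measurable borel" unfolding f_def by measurable
  have "(LBN y. h (norm (y::'a))) = (LBN y. f y * ennreal (norm y powr (1 - ?d)))"
  proof (rule nn_integral_cong_AE, rule AE_mp[OF AE_lborel_singleton[of 0]], rule AE_I2, rule impI)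
    fix y :: 'a assume "y \<noteq> 0"
    then have "norm y powr (?d - 1) * norm y powr (1 - ?d) = 1"
      by (simp flip: powr_add)
    then have "ennreal (norm y powr (?d - 1)) * ennreal (norm y powr (1 - ?d)) = 1"
      by (metis ennreal_1 ennreal_mult powr_ge_zero)
    then show "h (norm y) = f y * ennreal (norm y powr (1 - ?d))"
      by (simp add: f_def mult.assoc)
  qed
  also have "\<dots> = (\<integral>\<^sup>+r\<in>{0<..}. (\<integral>\<^sup>+\<sigma>. f (r *\<^sub>R \<sigma>) \<partial>sphere_measure) \<partial>lborel)"
    by (rule nn_integral_polar[symmetric]) measurable
  also have "\<dots> = (LBN r. ?s * (h r * ennreal (r powr (?d - 1)) * indicator {0<..} r))"
  proof (rule nn_integral_cong)
    fix r :: real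
    have "(\<integral>\<^sup>+\<sigma>. f (r *\<^sub>R \<sigma>) \<partial>sphere_measure) = ?s * (h r * ennreal (r powr (?d - 1)))" if "0 < r"
    proof -
      have "(\<integral>\<^sup>+\<sigma>. f (r *\<^sub>R \<sigma>) \<partial>sphere_measure) = (\<integral>\<^sup>+\<sigma>. h r * ennreal (r powr (?d - 1)) \<partial>(sphere_measure :: 'a measure))"
        using that by (intro nn_integral_cong) (simp add: f_def)
      also have "\<dots> = ?s * (h r * ennreal (r powr (?d - 1)))"
        by (simp add: mult.commute)
      finally show ?thesis .
    qed
    then show "(\<integral>\<^sup>+\<sigma>. f (r *\<^sub>R \<sigma>) \<partial>sphere_measure) * indicator {0<..} r
        = ?s * (h r * ennreal (r powr (?d - 1)) * indicator {0<..} r)"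
      by (simp split: split_indicator)
  qed
  also have "\<dots> = ?s * (\<integral>\<^sup>+r\<in>{0<..}. h r * ennreal (r powr (?d - 1)) \<partial>lborel)"
    by (rule nn_integral_cmult) measurable
  finally show ?thesis .
qed

text \<open>
  Squared distances to two points differ by an affine function, so in the variables \<open>r\<^sup>2\<close> all further
  changes of variables are affine.
\<close>

lemma nn_integral_square_substitution:
  fixes H :: "real \<Rightarrow> ennreal"
  assumes [measurable]: "H \<in> borel_measurable borel"
  shows "(\<integral>\<^sup>+a\<in>{0..}. H a \<partial>lborel) = (\<integral>\<^sup>+r\<in>{0..}. H (r\<^sup>2) * ennreal (2 * r) \<partial>lborel)"
proof -
  have lim: "(\<integral>\<^sup>+x\<in>{0..}. h x \<partial>lborel) = (SUP n. \<integral>\<^sup>+x. h x * indicator {0..b n} x \<partial>lborel)"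
    if [measurable]: "h \<in> borel_measurable borel" and b: "mono b" "\<And>x. \<exists>n. x \<le> b n" for h :: "real \<Rightarrow> ennreal" and b :: "nat \<Rightarrow> real"
  proof -
    have "(SUP n. h x * indicator {0..b n} x) = h x * indicator {0..} x" for x
    proof (rule antisym)
      show "(SUP n. h x * indicator {0..b n} x) \<le> h x * indicator {0..} x"
        by (rule SUP_least) (auto split: split_indicator)
      obtain n where "x \<le> b n" using b by blast
      then show "h x * indicator {0..} x \<le> (SUP n. h x * indicator {0..b n} x)"
        by (intro SUP_upper2[of n]) (auto split: split_indicator)
    qed
    moreover have "incseq (\<lambda>n x. h x * indicator {0..b n} x)"
      using b(1) unfolding mono_def le_fun_def by (auto split: split_indicator intro: order_trans)
    ultimately show ?thesis
      by (subst nn_integral_monotone_convergence_SUP[symmetric]) auto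
  qed
  have unb: "\<exists>n. x \<le> real n + 1" "\<exists>n. x \<le> (real n + 1)\<^sup>2" for x
  proof -
    obtain n where n: "x \<le> real n" using real_arch_simple by blast
    moreover have "real n \<le> (real n + 1)\<^sup>2" by (simp add: power2_eq_square algebra_simps)
    ultimately show "\<exists>n. x \<le> real n + 1" "\<exists>n. x \<le> (real n + 1)\<^sup>2"
      by (force intro: exI[of _ n])+
  qed
  have "(\<integral>\<^sup>+a\<in>{0..}. H a \<partial>lborel) = (SUP n. \<integral>\<^sup>+x. H x * indicator {0..(real n + 1)\<^sup>2} x \<partial>lborel)"
    by (rule lim) (auto simp: mono_def unb intro: power_mono)
  also have "\<dots> = (SUP n. \<integral>\<^sup>+x. H (x\<^sup>2) * ennreal (2 * x) * indicator {0..real n + 1} x \<partial>lborel)"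
  proof (rule SUP_cong[OF refl])
    fix n :: nat
    have "(LBN x. H x * indicator {0\<^sup>2..(real n + 1)\<^sup>2} x) = (LBN x. H (x\<^sup>2) * ennreal (2 * x) * indicator {0..real n + 1} x)"
      by (rule nn_integral_substitution_aux[where g = "\<lambda>x. x\<^sup>2" and g' = "\<lambda>x. 2 * x"])
         (auto intro!: derivative_eq_intros continuous_intros)
    then show "(LBN x. H x * indicator {0..(real n + 1)\<^sup>2} x) = (LBN x. H (x\<^sup>2) * ennreal (2 * x) * indicator {0..real n + 1} x)"
      by simp
  qed
  also have "\<dots> = (\<integral>\<^sup>+r\<in>{0..}. H (r\<^sup>2) * ennreal (2 * r) \<partial>lborel)"
    by (rule lim[symmetric]) (auto simp: mono_def unb)
  finally show ?thesis .
qed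

lemma powr_neg_half_square:
  assumes "0 < (x::real)" shows "(x\<^sup>2) powr (-1/2) = 1 / x"
proof -
  have "(x\<^sup>2) powr (-1/2) = inverse ((x\<^sup>2) powr (1/2))"
    by (metis minus_divide_left powr_minus)
  also have "(x\<^sup>2) powr (1/2) = x" using assms by (simp add: powr_half_sqrt)
  finally show ?thesis by (simp only: inverse_eq_divide)
qed

text \<open>
  In dimension one the distribution of the squared norm has the density \<open>a\<^sup>-\<^sup>1\<^sup>/\<^sup>2\<close>; its singularity at 0 is what
  makes the planar case harder.
\<close>

lemma nn_integral_line_squares:
  obtains K :: ennreal where "K < \<infinity>"
    "\<And>H :: real \<Rightarrow> ennreal. H \<in> borel_measurable borel \<Longrightarrow>
      (LBN v. H (v\<^sup>2)) \<le> K * (\<integral>\<^sup>+a\<in>{0<..}. H a * ennreal (a powr (-1/2)) \<partial>lborel)"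
proof
  let ?K = "emeasure sphere_measure (sphere (0::real) 1)"
  show "?K < \<infinity>"
    using finite_measure.emeasure_finite[OF finite_sphere_measure, of "sphere (0::real) 1"]
    by (simp add: less_top)
  fix H :: "real \<Rightarrow> ennreal" assume [measurable]: "H \<in> borel_measurable borel"
  have "(LBN v. H (v\<^sup>2)) = (LBN v. H ((norm (v::real))\<^sup>2))"
    by simp
  also have "\<dots> = ?K * (\<integral>\<^sup>+r\<in>{0<..}. H (r\<^sup>2) * ennreal (r powr (real DIM(real) - 1)) \<partial>lborel)"
    by (rule nn_integral_radial) measurable
  also have "\<dots> \<le> ?K * (\<integral>\<^sup>+r\<in>{0..}. (H (r\<^sup>2) * ennreal ((r\<^sup>2) powr (-1/2)) * indicator {0<..} (r\<^sup>2)) * ennreal (2 * r) \<partial>lborel)"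
  proof (intro mult_left_mono nn_integral_mono)
    fix r :: real
    show "H (r\<^sup>2) * ennreal (r powr (real DIM(real) - 1)) * indicator {0<..} r
        \<le> (H (r\<^sup>2) * ennreal ((r\<^sup>2) powr (-1/2)) * indicator {0<..} (r\<^sup>2)) * ennreal (2 * r) * indicator {0..} r"
    proof (cases "0 < r")
      case True
      have "(r\<^sup>2) powr (-1/2) * (2 * r) = 2"
        using True by (simp only: powr_neg_half_square) simp
      moreover have "ennreal ((r\<^sup>2) powr (-1/2)) * ennreal (2 * r) = ennreal ((r\<^sup>2) powr (-1/2) * (2 * r))"
        using True by (intro ennreal_mult[symmetric]) auto
      ultimately have "1 \<le> ennreal ((r\<^sup>2) powr (-1/2)) * ennreal (2 * r)"
        by simp
      then have "H (r\<^sup>2) * 1 \<le> H (r\<^sup>2) * (ennreal ((r\<^sup>2) powr (-1/2)) * ennreal (2 * r))"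
        by (rule mult_left_mono) simp
      then show ?thesis using True by (simp add: mult.assoc)
    qed simp
  qed simp
  also have "(\<integral>\<^sup>+r\<in>{0..}. (H (r\<^sup>2) * ennreal ((r\<^sup>2) powr (-1/2)) * indicator {0<..} (r\<^sup>2)) * ennreal (2 * r) \<partial>lborel)
      = (\<integral>\<^sup>+a\<in>{0..}. H a * ennreal (a powr (-1/2)) * indicator {0<..} a \<partial>lborel)"
    by (rule nn_integral_square_substitution[symmetric]) measurable
  also have "\<dots> = (\<integral>\<^sup>+a\<in>{0<..}. H a * ennreal (a powr (-1/2)) \<partial>lborel)"
    by (intro nn_integral_cong) (simp split: split_indicator)
  finally show "(LBN v. H (v\<^sup>2)) \<le> ?K * (\<integral>\<^sup>+a\<in>{0<..}. H a * ennreal (a powr (-1/2)) \<partial>lborel)" .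
qed

text \<open>
  In dimension two the squared norm is distributed with constant density. This is why three dimensions
  suffice for a bounded density in bipolar coordinates: two coordinates orthogonal to the axis are available.
\<close>

lemma nn_integral_plane_squares:
  obtains K :: ennreal where "K < \<infinity>"
    "\<And>H :: real \<Rightarrow> ennreal. H \<in> borel_measurable borel \<Longrightarrow>
      (LBN v w. H (v\<^sup>2 + w\<^sup>2)) \<le> K * (\<integral>\<^sup>+a\<in>{0..}. H a \<partial>lborel)"
proof
  let ?K = "emeasure sphere_measure (sphere (0::real \<times> real) 1)"
  show "?K < \<infinity>"
    using finite_measure.emeasure_finite[OF finite_sphere_measure, of "sphere (0::real \<times> real) 1"]
    by (simp add: less_top)
  fix H :: "real \<Rightarrow> ennreal" assume [measurable]: "H \<in> borel_measurable borel"
  have "(LBN v w. H (v\<^sup>2 + w\<^sup>2)) = (\<integral>\<^sup>+p. H ((fst p)\<^sup>2 + (snd p)\<^sup>2) \<partial>(lborel \<Otimes>\<^sub>M lborel))"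
    by (subst lborel.nn_integral_fst[symmetric]) simp_all
  also have "\<dots> = (LBN p. H ((norm (p :: real \<times> real))\<^sup>2))"
    by (simp add: lborel_prod norm_prod_def)
  also have "\<dots> = ?K * (\<integral>\<^sup>+r\<in>{0<..}. H (r\<^sup>2) * ennreal (r powr (real DIM(real \<times> real) - 1)) \<partial>lborel)"
    by (rule nn_integral_radial) measurable
  also have "\<dots> \<le> ?K * (\<integral>\<^sup>+r\<in>{0..}. H (r\<^sup>2) * ennreal (2 * r) \<partial>lborel)"
    by (intro mult_left_mono nn_integral_mono) (auto split: split_indicator intro!: mult_left_mono ennreal_leI)
  also have "(\<integral>\<^sup>+r\<in>{0..}. H (r\<^sup>2) * ennreal (2 * r) \<partial>lborel) = (\<integral>\<^sup>+a\<in>{0..}. H a \<partial>lborel)"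
    by (rule nn_integral_square_substitution[symmetric]) measurable
  finally show "(LBN v w. H (v\<^sup>2 + w\<^sup>2)) \<le> ?K * (\<integral>\<^sup>+a\<in>{0..}. H a \<partial>lborel)" .
qed

text \<open>
  Uniqueness of translation invariant measures, in the form of an exchange of integrals: the product of
  \<open>\<integral> F(T z) dz\<close> with the volume of the unit ball is transformed by translations, which \<open>T\<close> permutes because it is linear and onto,
  into the product of \<open>\<integral> F(y) dy\<close> with the volume of the preimage of the ball, which is the ball itself.
\<close>

lemma nn_integral_orthogonal_transformation:
  fixes T :: "'a::euclidean_space \<Rightarrow> 'a" and F :: "'a \<Rightarrow> ennreal"
  assumes T: "orthogonal_transformation T" and [measurable]: "F \<in> borel_measurable borel"
  shows "(LBN z. F (T z)) = (LBN y. F y)"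
proof -
  have lin: "linear T" using T by (rule orthogonal_transformation_linear)
  have [measurable]: "T \<in> borel_measurable borel"
    using lin by (intro borel_measurable_continuous_onI linear_continuous_on) (simp add: linear_conv_bounded_linear)
  let ?B = "ball (0::'a) 1"
  have [measurable]: "?B \<in> sets borel" by simp
  have transl: "(LBN y. h (c + y)) = (LBN y. h y)"
    if [measurable]: "h \<in> borel_measurable borel" for h :: "'a \<Rightarrow> ennreal" and c
    by (subst (2) lborel_distr_plus[of c, symmetric]) (simp add: nn_integral_distr)
  have ball: "(LBN y. indicator ?B (T y)) = emeasure lborel ?B"
    using T by (simp add: indicator_def orthogonal_transformation_norm
        flip: nn_integral_indicator)
  have "(LBN z. F (T z)) * emeasure lborel ?B
      = (LBN z y. F (T z) * indicator ?B y)"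
    by (simp add: nn_integral_cmult_indicator nn_integral_multc)
  also have "\<dots> = (LBN y z. F (T z) * indicator ?B y)"
    by (rule lborel_pair.Fubini') measurable
  also have "\<dots> = (LBN y z. F (y + T z) * indicator ?B y)"
  proof (rule nn_integral_cong)
    fix y
    obtain c where c: "y = T c"
      using orthogonal_transformation_surj[OF T] by (metis surjD)
    show "(LBN z. F (T z) * indicator ?B y) = (LBN z. F (y + T z) * indicator ?B y)"
      using transl[of "\<lambda>z. F (T z) * indicator ?B y" c] by (simp add: c linear_add[OF lin])
  qed
  also have "\<dots> = (LBN z y. F (y + T z) * indicator ?B y)"
    by (rule lborel_pair.Fubini') measurable
  also have "\<dots> = (LBN z y. F y * indicator ?B (T z - y))"
  proof (rule nn_integral_cong)
    fix z
    have "norm (y - T z) = norm (T z - y)" for y by (rule norm_minus_commute)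
    then show "(LBN y. F (y + T z) * indicator ?B y) = (LBN y. F y * indicator ?B (T z - y))"
      using transl[of "\<lambda>y. F y * indicator ?B (T z - y)" "T z"]
      by (simp add: indicator_def add.commute)
  qed
  also have "\<dots> = (LBN y z. F y * indicator ?B (T z - y))"
    by (rule lborel_pair.Fubini') measurable
  also have "\<dots> = (LBN y. F y * emeasure lborel ?B)"
  proof (rule nn_integral_cong)
    fix y
    obtain c where c: "y = T c"
      using orthogonal_transformation_surj[OF T] by (metis surjD)
    have "(LBN z. F y * indicator ?B (T z - y)) = (LBN z. F y * indicator ?B (T z))"
      using transl[of "\<lambda>z. F y * indicator ?B (T z - y)" c] by (simp add: c linear_add[OF lin])
    then show "(LBN z. F y * indicator ?B (T z - y)) = F y * emeasure lborel ?B"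
      by (simp add: nn_integral_cmult ball)
  qed
  also have "\<dots> = (LBN y. F y) * emeasure lborel ?B"
    by (rule nn_integral_multc) measurable
  finally have eq: "(LBN z. F (T z)) * emeasure lborel ?B = (LBN y. F y) * emeasure lborel ?B" .
  moreover have "emeasure lborel ?B \<noteq> 0"
    using emeasure_lborel_ball_finite[of "0::'a" 1] content_ball_pos[of 1 "0::'a"]
    by (auto simp: measure_def)
  moreover have "emeasure lborel ?B \<noteq> top"
    using emeasure_lborel_ball_finite[of "0::'a" 1] by auto
  ultimately show ?thesis
    by (metis ennreal_mult_cancel_left mult.commute)
qed

section \<open>Pairs of annuli in dimension at least three\<close>

lemma nn_integral_lborel_coordinates:
  fixes H :: "real \<Rightarrow> real \<Rightarrow> ennreal" and e :: "'a::euclidean_space"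
  assumes [measurable]: "case_prod H \<in> borel_measurable (borel \<Otimes>\<^sub>M borel)" and e: "e \<in> Basis"
  shows "(LBN y. H ((norm y)\<^sup>2) (y \<bullet> e))
    = (\<integral>\<^sup>+x. H (\<Sum>b\<in>Basis. (x b)\<^sup>2) (x e) \<partial>(\<Pi>\<^sub>M b\<in>(Basis :: 'a set). lborel))"
proof -
  have norm: "(norm y)\<^sup>2 = (\<Sum>b\<in>Basis. (y \<bullet> b)\<^sup>2)" for y :: 'a
    unfolding power2_norm_eq_inner by (subst euclidean_inner) (simp add: power2_eq_square)
  show ?thesis
    by (subst lborel_eq[where 'a = 'a]) (simp add: nn_integral_distr norm e)
qed

text \<open>
  Translate \<open>x1\<close> to the origin and rotate \<open>x2 - x1\<close> onto the coordinate axis \<open>e\<close>. The integrand then depends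
  on \<open>z\<close> only through \<open>|z|\<^sup>2\<close> and one coordinate.
\<close>

lemma annular_reduction:
  fixes x1 x2 e :: "real^'n" and g1 g2 :: "real \<Rightarrow> ennreal"
  assumes [measurable]: "g1 \<in> borel_measurable borel" "g2 \<in> borel_measurable borel"
    and e: "e \<in> Basis"
  defines "D \<equiv> dist x1 x2"
  shows "(LBN y. g1 (dist x1 y) * g2 (dist x2 y))
    = (LBN z. g1 (sqrt ((norm z)\<^sup>2)) * g2 (sqrt ((norm z)\<^sup>2 + D\<^sup>2 - 2 * D * (z \<bullet> e))))"
proof -
  have "norm (D *\<^sub>R e) = norm (x2 - x1)"
    using e by (simp add: D_def dist_norm norm_minus_commute)
  then obtain T where T: "orthogonal_transformation T" and Te: "T (D *\<^sub>R e) = x2 - x1"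
    using orthogonal_transformation_exists by metis
  have lin: "linear T" using T by (rule orthogonal_transformation_linear)
  have [measurable]: "T \<in> borel_measurable borel"
    using lin by (intro borel_measurable_continuous_onI linear_continuous_on) (simp add: linear_conv_bounded_linear)
  have "(LBN y. g1 (dist x1 y) * g2 (dist x2 y))
      = (LBN y. g1 (dist x1 (x1 + y)) * g2 (dist x2 (x1 + y)))"
    by (subst lborel_distr_plus[of x1, symmetric]) (simp add: nn_integral_distr)
  also have "\<dots> = (LBN y. g1 (norm y) * g2 (norm (x2 - x1 - y)))"
    by (simp add: dist_norm algebra_simps)
  also have "\<dots> = (LBN z. g1 (norm (T z)) * g2 (norm (x2 - x1 - T z)))"
    by (rule nn_integral_orthogonal_transformation[OF T, symmetric]) measurable
  also have "\<dots> = (LBN z. g1 (sqrt ((norm z)\<^sup>2)) * g2 (sqrt ((norm z)\<^sup>2 + D\<^sup>2 - 2 * D * (z \<bullet> e))))"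
  proof (rule nn_integral_cong)
    fix z
    have "norm (x2 - x1 - T z) = norm (D *\<^sub>R e - z)"
      using orthogonal_transformation_norm[OF T, of "D *\<^sub>R e - z"] by (simp add: linear_diff[OF lin] Te)
    also have "\<dots> = sqrt ((norm (D *\<^sub>R e - z))\<^sup>2)" by simp
    also have "(norm (D *\<^sub>R e - z))\<^sup>2 = (norm z)\<^sup>2 + D\<^sup>2 - 2 * D * (z \<bullet> e)"
      unfolding power2_norm_eq_inner using e
      by (simp add: inner_diff inner_commute power2_eq_square algebra_simps)
    finally show "g1 (norm (T z)) * g2 (norm (x2 - x1 - T z))
        = g1 (sqrt ((norm z)\<^sup>2)) * g2 (sqrt ((norm z)\<^sup>2 + D\<^sup>2 - 2 * D * (z \<bullet> e)))"
      using orthogonal_transformation_norm[OF T, of z] by simp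
  qed
  finally show ?thesis .
qed

lemma nn_integral_sqrt_le:
  fixes g \<Psi> :: "real \<Rightarrow> ennreal"
  assumes [measurable]: "g \<in> borel_measurable borel" "\<Psi> \<in> borel_measurable borel"
    and r0: "0 < r0" and supp: "\<And>r. r \<notin> {r0..R0} \<Longrightarrow> g r = 0"
  shows "(LBN a. g (sqrt a) * \<Psi> a) \<le> ennreal (2 * R0) * (LBN r. g r * \<Psi> (r\<^sup>2))"
proof -
  have "(LBN a. g (sqrt a) * \<Psi> a) = (\<integral>\<^sup>+a\<in>{0..}. g (sqrt a) * \<Psi> a \<partial>lborel)"
  proof (rule nn_integral_cong)
    fix a :: real
    show "g (sqrt a) * \<Psi> a = g (sqrt a) * \<Psi> a * indicator {0..} a"
    proof (cases "0 \<le> a")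
      case False
      then have "sqrt a < 0" by simp
      then have "sqrt a \<notin> {r0..R0}" using r0 by (simp only: atLeastAtMost_iff) linarith
      then show ?thesis by (simp add: supp)
    qed simp
  qed
  also have "\<dots> = (\<integral>\<^sup>+r\<in>{0..}. g (sqrt (r\<^sup>2)) * \<Psi> (r\<^sup>2) * ennreal (2 * r) \<partial>lborel)"
    by (rule nn_integral_square_substitution) measurable
  also have "\<dots> \<le> (LBN r. ennreal (2 * R0) * (g r * \<Psi> (r\<^sup>2)))"
  proof (rule nn_integral_mono)
    fix r :: real
    show "g (sqrt (r\<^sup>2)) * \<Psi> (r\<^sup>2) * ennreal (2 * r) * indicator {0..} r \<le> ennreal (2 * R0) * (g r * \<Psi> (r\<^sup>2))"
    proof (cases "r \<in> {r0..R0}")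
      case True
      then have "g r * \<Psi> (r\<^sup>2) * ennreal (2 * r) \<le> g r * \<Psi> (r\<^sup>2) * ennreal (2 * R0)"
        by (intro mult_left_mono ennreal_leI) auto
      then show ?thesis using r0 True by (simp add: mult.commute)
    next
      case False
      then show ?thesis by (cases "0 \<le> r") (simp_all add: supp)
    qed
  qed
  also have "\<dots> = ennreal (2 * R0) * (LBN r. g r * \<Psi> (r\<^sup>2))"
    by (rule nn_integral_cmult) measurable
  finally show ?thesis .
qed

text \<open>
  For fixed \<open>a = |z|\<^sup>2\<close> the squared distance \<open>c = a + D\<^sup>2 - 2 D u\<close> to the second centre is affine in the
  coordinate \<open>u\<close> of \<open>z\<close> along the axis; this is the law of cosines.
\<close>

lemma nn_integral_cosine_substitution:
  fixes \<Phi> :: "real \<Rightarrow> ennreal"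
  assumes [measurable]: "\<Phi> \<in> borel_measurable borel" and D: "0 < D"
  shows "(LBN u. \<Phi> u) = ennreal (1 / (2 * D)) * (LBN c. \<Phi> ((a + D\<^sup>2 - c) / (2 * D)))"
  using D by (subst nn_integral_real_affine[where c = "- (1 / (2 * D))" and t = "(a + D\<^sup>2) / (2 * D)"])
    (simp_all add: diff_divide_distrib add_divide_distrib)

lemma nn_integral_shift:
  fixes h :: "real \<Rightarrow> ennreal"
  assumes [measurable]: "h \<in> borel_measurable borel"
  shows "(LBN a. h (t + a)) = (LBN a. h a)"
  by (subst (2) nn_integral_real_affine[where c = 1 and t = t]) simp_all

text \<open>
  Integrate first over two coordinates orthogonal to the axis, which produces the variable \<open>a = |z|\<^sup>2\<close> with
  constant density, and then over the coordinate along the axis, which produces the other squared distance with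
  density \<open>1 / (2 D)\<close>. The remaining coordinates are bounded by \<open>R0\<close> on the support of the integrand and contribute a constant.
\<close>

lemma annular_pair_space:
  assumes dim: "3 \<le> CARD('n)" and r0: "0 < r0"
  obtains K :: real where "0 \<le> K"
    "\<And>(x1 :: real^'n) x2 g1 g2. x1 \<noteq> x2 \<Longrightarrow> g1 \<in> borel_measurable borel \<Longrightarrow> g2 \<in> borel_measurable borel \<Longrightarrow>
      (\<And>r. r \<notin> {r0..R0} \<Longrightarrow> g1 r = 0) \<Longrightarrow> (\<And>r. r \<notin> {r0..R0} \<Longrightarrow> g2 r = 0) \<Longrightarrow>
      (LBN y. g1 (dist x1 y) * g2 (dist x2 y))
        \<le> ennreal (K * dist x1 x2 powr -1) * ((LBN r. g1 r) * (LBN r. g2 r))"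
proof -
  have "3 \<le> card (Basis :: (real^'n) set)" using dim by simp
  then obtain B where B: "B \<subseteq> (Basis :: (real^'n) set)" "card B = 3"
    by (metis obtain_subset_with_card_n)
  then obtain e e' e'' where e: "B = {e, e', e''}" "e \<noteq> e'" "e \<noteq> e''" "e' \<noteq> e''"
    by (auto simp: card_3_iff)
  define R where "R = Basis - B"
  have R: "finite R" "e \<notin> R" "e' \<notin> R" "e'' \<notin> R" and Basis: "Basis = insert e'' (insert e' (insert e R))"
    using B e by (auto simp: R_def)
  obtain K1 :: ennreal where K1: "K1 < \<infinity>" and plane: "\<And>H :: real \<Rightarrow> ennreal. H \<in> borel_measurable borel \<Longrightarrow>
      (LBN v w. H (v\<^sup>2 + w\<^sup>2)) \<le> K1 * (\<integral>\<^sup>+a\<in>{0..}. H a \<partial>lborel)"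
    using nn_integral_plane_squares by blast
  interpret product_sigma_finite "\<lambda>b :: real^'n. lborel :: real measure"
    by standard
  define K2 where "K2 = K1 * ennreal ((2 * \<bar>R0\<bar>) ^ card R)"
  have K2: "K2 < \<infinity>" using K1 by (simp add: K2_def ennreal_mult_less_top)
  have "(LBN y. g1 (dist x1 y) * g2 (dist x2 y))
        \<le> ennreal (2 * (enn2real K2 * R0\<^sup>2) * dist x1 x2 powr -1) * ((LBN r. g1 r) * (LBN r. g2 r))"
    if x: "x1 \<noteq> x2" and g [measurable]: "g1 \<in> borel_measurable borel" "g2 \<in> borel_measurable borel"
      and supp: "\<And>r. r \<notin> {r0..R0} \<Longrightarrow> g1 r = 0" "\<And>r. r \<notin> {r0..R0} \<Longrightarrow> g2 r = 0"
    for x1 x2 :: "real^'n" and g1 g2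
  proof -
    define D where "D = dist x1 x2"
    have D: "0 < D" using x by (simp add: D_def)
    define H where "H a u = g1 (sqrt a) * g2 (sqrt (a + D\<^sup>2 - 2 * D * u))" for a u
    have [measurable]: "case_prod H \<in> borel_measurable (borel \<Otimes>\<^sub>M borel)"
      unfolding H_def by measurable
    define box where "box x = (\<Prod>b\<in>R. indicator {-\<bar>R0\<bar>..\<bar>R0\<bar>} (x b) :: ennreal)" for x :: "real^'n \<Rightarrow> real"
    let ?S = "\<lambda>x :: real^'n \<Rightarrow> real. \<Sum>b\<in>R. (x b)\<^sup>2"
    let ?I1 = "\<integral>\<^sup>+r. g1 r \<partial>lborel" and ?I2 = "\<integral>\<^sup>+r. g2 r \<partial>lborel"
    \<comment> \<open>On the support of the integrand every coordinate is at most \<open>R0\<close> in absolute value.\<close>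
    have H_le: "H a u \<le> H a u * box x" if "?S x \<le> a" for x a u
    proof (cases "\<bar>R0\<bar> < sqrt a")
      case True
      then have "g1 (sqrt a) = 0" by (intro supp) auto
      then show ?thesis by (simp add: H_def)
    next
      case False
      have "x b \<in> {-\<bar>R0\<bar>..\<bar>R0\<bar>}" if "b \<in> R" for b
      proof -
        have "(x b)\<^sup>2 \<le> ?S x" using R that by (intro member_le_sum) auto
        then have "sqrt ((x b)\<^sup>2) \<le> sqrt a" using \<open>?S x \<le> a\<close> by (intro real_sqrt_le_mono) simp
        then show ?thesis using False by auto
      qed
      then have "box x = 1" unfolding box_def by (intro prod.neutral) auto
      then show ?thesis by simp
    qed
    let ?b = "ennreal (1 / (2 * D)) * (ennreal (2 * R0) * ?I1 * (ennreal (2 * R0) * ?I2))"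
    have uv: "(LBN u v w. H (s + u\<^sup>2 + v\<^sup>2 + w\<^sup>2) u)
        \<le> K1 * ?b" for s
    proof -
      have "(LBN u v w. H (s + u\<^sup>2 + v\<^sup>2 + w\<^sup>2) u)
          \<le> (LBN u. K1 * (LBN a. H a u))"
      proof (rule nn_integral_mono)
        fix u :: real
        have "(LBN v w. H (s + u\<^sup>2 + v\<^sup>2 + w\<^sup>2) u)
            = (LBN v w. H (s + u\<^sup>2 + (v\<^sup>2 + w\<^sup>2)) u)"
          by (simp add: add.assoc)
        also have "\<dots> \<le> K1 * (\<integral>\<^sup>+a\<in>{0..}. H (s + u\<^sup>2 + a) u \<partial>lborel)"
          by (rule plane) measurable
        also have "\<dots> \<le> K1 * (LBN a. H (s + u\<^sup>2 + a) u)"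
          by (intro mult_left_mono nn_integral_mono) (auto split: split_indicator)
        also have "(LBN a. H (s + u\<^sup>2 + a) u) = (LBN a. H a u)"
          by (rule nn_integral_shift) measurable
        finally show "(LBN v w. H (s + u\<^sup>2 + v\<^sup>2 + w\<^sup>2) u) \<le> K1 * (LBN a. H a u)" .
      qed
      also have "\<dots> = K1 * (LBN u a. H a u)"
        by (rule nn_integral_cmult) measurable
      also have "(LBN u a. H a u) = (LBN a u. H a u)"
        by (rule lborel_pair.Fubini') measurable
      also have "\<dots> = (LBN a. ennreal (1 / (2 * D)) * (g1 (sqrt a) * (LBN c. g2 (sqrt c))))"
      proof (rule nn_integral_cong)
        fix a :: real
        have "(LBN u. H a u) = ennreal (1 / (2 * D)) * (LBN c. H a ((a + D\<^sup>2 - c) / (2 * D)))"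
          using D by (intro nn_integral_cosine_substitution) measurable
        also have "(LBN c. H a ((a + D\<^sup>2 - c) / (2 * D))) = (LBN c. g1 (sqrt a) * g2 (sqrt c))"
          using D by (simp add: H_def)
        also have "\<dots> = g1 (sqrt a) * (LBN c. g2 (sqrt c))"
          by (rule nn_integral_cmult) measurable
        finally show "(LBN u. H a u) = ennreal (1 / (2 * D)) * (g1 (sqrt a) * (LBN c. g2 (sqrt c)))" .
      qed
      also have "\<dots> = ennreal (1 / (2 * D)) * ((LBN a. g1 (sqrt a)) * (LBN c. g2 (sqrt c)))"
        by (simp add: nn_integral_cmult nn_integral_multc)
      also have "\<dots> \<le> ennreal (1 / (2 * D)) * (ennreal (2 * R0) * ?I1 * (ennreal (2 * R0) * ?I2))"
        using nn_integral_sqrt_le[of g1 "\<lambda>_. 1" r0 R0] nn_integral_sqrt_le[of g2 "\<lambda>_. 1" r0 R0] r0 supp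
        by (intro mult_left_mono mult_mono) simp_all
      finally show ?thesis by (simp add: mult_left_mono)
    qed
    have "(LBN y. g1 (dist x1 y) * g2 (dist x2 y)) = (LBN z. H ((norm z)\<^sup>2) (z \<bullet> e))"
      unfolding H_def D_def by (rule annular_reduction) (use Basis in auto)
    also have "\<dots> = (\<integral>\<^sup>+x. H (\<Sum>b\<in>Basis. (x b)\<^sup>2) (x e) \<partial>(\<Pi>\<^sub>M b\<in>(Basis :: (real^'n) set). lborel))"
      by (rule nn_integral_lborel_coordinates) (use Basis in auto)
    also have "\<dots> = (\<integral>\<^sup>+x. H (?S x + (x e)\<^sup>2 + (x e')\<^sup>2 + (x e'')\<^sup>2) (x e) \<partial>(\<Pi>\<^sub>M b\<in>insert e'' (insert e' (insert e R)). lborel))"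
      unfolding Basis using R e by (simp add: add_ac)
    also have "\<dots> \<le> (\<integral>\<^sup>+x. H (?S x + (x e)\<^sup>2 + (x e')\<^sup>2 + (x e'')\<^sup>2) (x e) * box x \<partial>(\<Pi>\<^sub>M b\<in>insert e'' (insert e' (insert e R)). lborel))"
      by (intro nn_integral_mono H_le) simp
    also have "\<dots> = (\<integral>\<^sup>+x. (LBN w. H (?S x + (x e)\<^sup>2 + (x e')\<^sup>2 + w\<^sup>2) (x e) * box x) \<partial>(\<Pi>\<^sub>M b\<in>insert e' (insert e R). lborel))"
    proof (subst product_nn_integral_insert)
      show "(\<lambda>x. H (?S x + (x e)\<^sup>2 + (x e')\<^sup>2 + (x e'')\<^sup>2) (x e) * box x) \<in> borel_measurable (Pi\<^sub>M (insert e'' (insert e' (insert e R))) (\<lambda>b. lborel))"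
        unfolding box_def by measurable
    qed (use R e in \<open>auto simp: box_def intro!: nn_integral_cong arg_cong2[where f = "(*)"] arg_cong2[where f = H] sum.cong prod.cong\<close>)
    also have "\<dots> = (\<integral>\<^sup>+x. (LBN v w. H (?S x + (x e)\<^sup>2 + v\<^sup>2 + w\<^sup>2) (x e) * box x) \<partial>(\<Pi>\<^sub>M b\<in>insert e R. lborel))"
    proof (subst product_nn_integral_insert)
      show "(\<lambda>x. \<integral>\<^sup>+w. H (?S x + (x e)\<^sup>2 + (x e')\<^sup>2 + w\<^sup>2) (x e) * box x \<partial>lborel) \<in> borel_measurable (Pi\<^sub>M (insert e' (insert e R)) (\<lambda>b. lborel))"
        unfolding box_def by measurable
    qed (use R e in \<open>auto simp: box_def intro!: nn_integral_cong arg_cong2[where f = "(*)"] arg_cong2[where f = H] sum.cong prod.cong\<close>)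
    also have "\<dots> = (\<integral>\<^sup>+x. (LBN u v w. H (?S x + u\<^sup>2 + v\<^sup>2 + w\<^sup>2) u * box x) \<partial>(\<Pi>\<^sub>M b\<in>R. lborel))"
    proof (subst product_nn_integral_insert)
      show "(\<lambda>x. \<integral>\<^sup>+v. (LBN w. H (?S x + (x e)\<^sup>2 + v\<^sup>2 + w\<^sup>2) (x e) * box x) \<partial>lborel) \<in> borel_measurable (Pi\<^sub>M (insert e R) (\<lambda>b. lborel))"
        unfolding box_def by measurable
    qed (use R e in \<open>auto simp: box_def intro!: nn_integral_cong arg_cong2[where f = "(*)"] arg_cong2[where f = H] sum.cong prod.cong\<close>)
    also have "\<dots> = (\<integral>\<^sup>+x. (LBN u v w. H (?S x + u\<^sup>2 + v\<^sup>2 + w\<^sup>2) u) * box x \<partial>(\<Pi>\<^sub>M b\<in>R. lborel))"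
      by (simp add: nn_integral_multc)
    also have "\<dots> \<le> (\<integral>\<^sup>+x. K1 * ?b * box x \<partial>(\<Pi>\<^sub>M b\<in>R. lborel))"
      by (intro nn_integral_mono mult_right_mono uv) simp
    also have "\<dots> = K1 * ?b * (\<integral>\<^sup>+x. box x \<partial>(\<Pi>\<^sub>M b\<in>R. lborel))"
      by (rule nn_integral_cmult) (unfold box_def, measurable)
    also have "(\<integral>\<^sup>+x. box x \<partial>(\<Pi>\<^sub>M b\<in>R. lborel)) = ennreal ((2 * \<bar>R0\<bar>) ^ card R)"
      unfolding box_def by (subst product_nn_integral_prod) (use R in \<open>simp_all add: ennreal_power\<close>)
    also have "K1 * ?b * ennreal ((2 * \<bar>R0\<bar>) ^ card R)
        \<le> K2 * ennreal (1 / (2 * D)) * ennreal (2 * \<bar>R0\<bar>) * ennreal (2 * \<bar>R0\<bar>) * (?I1 * ?I2)"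
    proof -
      have "ennreal (2 * R0) \<le> ennreal (2 * \<bar>R0\<bar>)" by (intro ennreal_leI) simp
      then show ?thesis
        unfolding K2_def by (simp only: mult_ac) (intro mult_left_mono mult_mono order_refl; simp)
    qed
    also have "K2 * ennreal (1 / (2 * D)) * ennreal (2 * \<bar>R0\<bar>) * ennreal (2 * \<bar>R0\<bar>) = ennreal (2 * (enn2real K2 * R0\<^sup>2) * D powr -1)"
    proof -
      have four: "ennreal (a * b * c * d) = ennreal a * ennreal b * ennreal c * ennreal d"
        if "0 \<le> a" "0 \<le> b" "0 \<le> c" "0 \<le> d" for a b c d
        using that by (simp add: ennreal_mult)
      have "K2 = ennreal (enn2real K2)" using K2 by simp
      then have "K2 * ennreal (1 / (2 * D)) * ennreal (2 * \<bar>R0\<bar>) * ennreal (2 * \<bar>R0\<bar>)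
          = ennreal (enn2real K2 * (1 / (2 * D)) * (2 * \<bar>R0\<bar>) * (2 * \<bar>R0\<bar>))"
        using D four[of "enn2real K2" "1 / (2 * D)" "2 * \<bar>R0\<bar>" "2 * \<bar>R0\<bar>"] by simp
      also have "enn2real K2 * (1 / (2 * D)) * (2 * \<bar>R0\<bar>) * (2 * \<bar>R0\<bar>) = 2 * (enn2real K2 * R0\<^sup>2) * D powr -1"
        using D by (simp add: powr_minus_divide power2_eq_square field_simps)
      finally show ?thesis .
    qed
    finally show ?thesis by (simp add: D_def)
  qed
  then show thesis
    by (intro that[of "2 * (enn2real K2 * R0\<^sup>2)"]) simp_all
qed

section \<open>Pairs of annuli in the plane\<close>

text \<open>
  With \<open>a = r + r' - D\<close>, \<open>b = r - r' + D\<close>, \<open>c = D - r + r'\<close>, Heron's formula states that the left-hand side is the power \<open>-1/2\<close>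
  of \<open>(r + r' + D) a b c\<close>, that is, of 16 times the squared area of the triangle with sides \<open>r\<close>, \<open>r'\<close>, \<open>D\<close>. The sums
  \<open>a + b\<close> and \<open>a + c\<close> are at least \<open>2 r0\<close>, and \<open>b + c = 2 D\<close>. Hence if \<open>a \<le> r0\<close> then \<open>b\<close> and \<open>c\<close> are at least \<open>r0\<close>, and if
  \<open>a > r0\<close> then the larger of \<open>b\<close> and \<open>c\<close> is at least \<open>D\<close>. Either way the product is at least \<open>r0\<^sup>2 D\<close> times one of \<open>a\<close>, \<open>b\<close>, \<open>c\<close>.
\<close>

lemma triangle_kernel_bound:
  fixes r r' D r0 :: real
  assumes r0: "0 < r0" "r0 \<le> r" "r0 \<le> r'" and D: "0 < D"
    and P: "0 < r\<^sup>2 - ((r\<^sup>2 + D\<^sup>2 - r'\<^sup>2) / (2 * D))\<^sup>2"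
  shows "1 / (2 * D) * (r\<^sup>2 - ((r\<^sup>2 + D\<^sup>2 - r'\<^sup>2) / (2 * D))\<^sup>2) powr (-1/2)
    \<le> 1 / r0 * D powr (-1/2) *
       (\<bar>r + r' - D\<bar> powr (-1/2) + \<bar>r - r' + D\<bar> powr (-1/2) + \<bar>r - r' - D\<bar> powr (-1/2))"
proof -
  define a where "a = r + r' - D"
  define b where "b = r - r' + D"
  define c where "c = D - r + r'"
  define Q where "Q = r\<^sup>2 - ((r\<^sup>2 + D\<^sup>2 - r'\<^sup>2) / (2 * D))\<^sup>2"
  have Q: "(r + r' + D) * a * b * c = (2 * D)\<^sup>2 * Q"
    using D by (simp add: Q_def a_def b_def c_def power_divide right_diff_distrib)
      (simp add: power2_eq_square algebra_simps)
  have sums: "a + b = 2 * r" "a + c = 2 * r'" "b + c = 2 * D"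
    by (simp_all add: a_def b_def c_def)
  have "0 < (r + r' + D) * (a * b * c)"
    using Q P D by (simp add: Q_def mult.assoc)
  then have abc: "0 < a * b * c"
    using r0 D by (simp add: zero_less_mult_iff)
  have pos: "0 < a" "0 < b" "0 < c"
  proof -
    have "\<not> a \<le> 0"
    proof
      assume "a \<le> 0"
      then have "0 < b" "0 < c" using sums r0 by linarith+
      then have "a * b * c \<le> 0" using \<open>a \<le> 0\<close> by (simp add: mult_nonpos_nonneg)
      with abc show False by simp
    qed
    moreover have "\<not> b \<le> 0"
    proof
      assume "b \<le> 0"
      then have "0 < a" "0 < c" using sums r0 D by linarith+
      then have "a * b * c \<le> 0" using \<open>b \<le> 0\<close> by (simp add: mult_nonneg_nonpos mult_nonpos_nonneg)
      with abc show False by simp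
    qed
    ultimately show "0 < a" "0 < b" by auto
    then show "0 < c"
      using abc zero_less_mult_pos[of "a * b" c] by simp
  qed
  have prod4: "x' * y' * z' * w' \<le> x * y * z * w"
    if "x' \<le> x" "y' \<le> y" "z' \<le> z" "w' \<le> w" "0 \<le> x'" "0 \<le> y'" "0 \<le> z'" "0 \<le> w'" for x y z w x' y' z' w' :: real
    using that by (intro mult_mono) (auto intro: mult_nonneg_nonneg)
  have "\<exists>m\<in>{a, b, c}. r0\<^sup>2 * D * m \<le> (2 * D)\<^sup>2 * Q"
  proof (cases "a \<le> r0")
    case True
    then have "r0 \<le> b" "r0 \<le> c" using sums r0 by linarith+
    then have "D * a * r0 * r0 \<le> (r + r' + D) * a * b * c"
      using pos r0 D by (intro prod4) auto
    then show ?thesis using Q by (simp add: power2_eq_square mult_ac)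
  next
    case False
    show ?thesis
    proof (cases "b \<le> c")
      case True
      then have "D \<le> c" using sums by linarith
      then have "r0 * r0 * b * D \<le> (r + r' + D) * a * b * c"
        using pos r0 D False by (intro prod4) auto
      then show ?thesis using Q by (simp add: power2_eq_square mult_ac)
    next
      case False
      then have "D \<le> b" using sums by linarith
      then have "r0 * r0 * D * c \<le> (r + r' + D) * a * b * c"
        using pos r0 D \<open>\<not> a \<le> r0\<close> by (intro prod4) auto
      then show ?thesis using Q by (simp add: power2_eq_square mult_ac)
    qed
  qed
  then obtain m where m: "m \<in> {a, b, c}" "r0\<^sup>2 * D * m \<le> (2 * D)\<^sup>2 * Q" by blast
  then have "0 < m" using pos by auto
  have "((2 * D)\<^sup>2 * Q) powr (-1/2) = 1 / (2 * D) * Q powr (-1/2)"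
    using D powr_neg_half_square[of "2 * D"] by (simp only: powr_mult)
  moreover have "((2 * D)\<^sup>2 * Q) powr (-1/2) \<le> (r0\<^sup>2 * D * m) powr (-1/2)"
    using m(2) r0 D \<open>0 < m\<close> by (intro powr_mono2') auto
  moreover have "(r0\<^sup>2 * D * m) powr (-1/2) = 1 / r0 * D powr (-1/2) * m powr (-1/2)"
    using r0 D \<open>0 < m\<close> powr_neg_half_square[of r0] by (simp only: powr_mult)
  moreover have "m powr (-1/2) \<le> \<bar>a\<bar> powr (-1/2) + \<bar>b\<bar> powr (-1/2) + \<bar>c\<bar> powr (-1/2)"
    using m(1) \<open>0 < m\<close> by auto
  then have "1 / r0 * D powr (-1/2) * m powr (-1/2)
      \<le> 1 / r0 * D powr (-1/2) * (\<bar>a\<bar> powr (-1/2) + \<bar>b\<bar> powr (-1/2) + \<bar>c\<bar> powr (-1/2))"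
    using r0 by (intro mult_left_mono) auto
  moreover have "\<bar>c\<bar> = \<bar>r - r' - D\<bar>" by (simp add: c_def)
  ultimately show ?thesis by (simp only: Q_def[symmetric] a_def b_def)
qed

text \<open>
  As in higher dimensions, except that a single coordinate is orthogonal to the axis. It produces the factor
  \<open>(a - u\<^sup>2)\<^sup>-\<^sup>1\<^sup>/\<^sup>2\<close>, which after division by \<open>2 D\<close> is bounded by the triangle estimate.
\<close>

lemma annular_pair_plane_kernel:
  assumes r0: "0 < r0"
  obtains K :: real where "0 \<le> K"
    "\<And>(x1 :: real^2) x2 g1 g2. x1 \<noteq> x2 \<Longrightarrow> g1 \<in> borel_measurable borel \<Longrightarrow> g2 \<in> borel_measurable borel \<Longrightarrow>
      (\<And>r. r \<notin> {r0..R0} \<Longrightarrow> g1 r = 0) \<Longrightarrow> (\<And>r. r \<notin> {r0..R0} \<Longrightarrow> g2 r = 0) \<Longrightarrow>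
      (LBN y. g1 (dist x1 y) * g2 (dist x2 y))
        \<le> ennreal K * (LBN r r'. g1 r * g2 r' * ennreal (dist x1 x2 powr (-1/2) *
            (\<bar>r + r' - dist x1 x2\<bar> powr (-1/2) + \<bar>r - r' + dist x1 x2\<bar> powr (-1/2)
              + \<bar>r - r' - dist x1 x2\<bar> powr (-1/2))))"
proof -
  have "card (Basis :: (real^2) set) = 2" by simp
  then obtain e e' where e: "(Basis :: (real^2) set) = {e, e'}" "e \<noteq> e'"
    by (metis card_2_iff)
  obtain K1 :: ennreal where K1: "K1 < \<infinity>" and line: "\<And>H :: real \<Rightarrow> ennreal. H \<in> borel_measurable borel \<Longrightarrow>
      (LBN v. H (v\<^sup>2)) \<le> K1 * (\<integral>\<^sup>+a\<in>{0<..}. H a * ennreal (a powr (-1/2)) \<partial>lborel)"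
    using nn_integral_line_squares by blast
  interpret product_sigma_finite "\<lambda>b :: real^2. lborel :: real measure"
    by standard
  have K1': "K1 = ennreal (enn2real K1)" using K1 by simp
  have "(LBN y. g1 (dist x1 y) * g2 (dist x2 y))
        \<le> ennreal (enn2real K1 * (2 * \<bar>R0\<bar>) * (2 * \<bar>R0\<bar>) * (1 / r0)) * (LBN r r'. g1 r * g2 r' * ennreal (dist x1 x2 powr (-1/2) *
            (\<bar>r + r' - dist x1 x2\<bar> powr (-1/2) + \<bar>r - r' + dist x1 x2\<bar> powr (-1/2)
              + \<bar>r - r' - dist x1 x2\<bar> powr (-1/2))))"
    if x: "x1 \<noteq> x2" and g [measurable]: "g1 \<in> borel_measurable borel" "g2 \<in> borel_measurable borel"
      and supp: "\<And>r. r \<notin> {r0..R0} \<Longrightarrow> g1 r = 0" "\<And>r. r \<notin> {r0..R0} \<Longrightarrow> g2 r = 0"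
    for x1 x2 :: "real^2" and g1 g2
  proof -
    define D where "D = dist x1 x2"
    have D: "0 < D" using x by (simp add: D_def)
    define H where "H a u = g1 (sqrt a) * g2 (sqrt (a + D\<^sup>2 - 2 * D * u))" for a u
    have [measurable]: "case_prod H \<in> borel_measurable (borel \<Otimes>\<^sub>M borel)"
      unfolding H_def by measurable
    define w where "w a u = ennreal ((a - u\<^sup>2) powr (-1/2)) * indicator {0<..} (a - u\<^sup>2)" for a u :: real
    have [measurable]: "case_prod w \<in> borel_measurable (borel \<Otimes>\<^sub>M borel)"
      unfolding w_def by measurable
    define k where "k a c = w a ((a + D\<^sup>2 - c) / (2 * D))" for a c
    have [measurable]: "case_prod k \<in> borel_measurable (borel \<Otimes>\<^sub>M borel)"
      unfolding k_def by measurable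
    let ?q = "\<lambda>r r'. D powr (-1/2) * (\<bar>r + r' - D\<bar> powr (-1/2) + \<bar>r - r' + D\<bar> powr (-1/2)
              + \<bar>r - r' - D\<bar> powr (-1/2))"
    have "(LBN y. g1 (dist x1 y) * g2 (dist x2 y)) = (LBN z. H ((norm z)\<^sup>2) (z \<bullet> e))"
      unfolding H_def D_def by (rule annular_reduction) (use e in auto)
    also have "\<dots> = (\<integral>\<^sup>+x. H (\<Sum>b\<in>Basis. (x b)\<^sup>2) (x e) \<partial>(\<Pi>\<^sub>M b\<in>(Basis :: (real^2) set). lborel))"
      by (rule nn_integral_lborel_coordinates) (use e in auto)
    also have "\<dots> = (\<integral>\<^sup>+x. H ((x e)\<^sup>2 + (x e')\<^sup>2) (x e) \<partial>(\<Pi>\<^sub>M b\<in>insert e' {e}. lborel))"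
      unfolding e(1) using e(2) by (simp add: insert_commute add.commute)
    also have "\<dots> = (\<integral>\<^sup>+x. (LBN v. H ((x e)\<^sup>2 + v\<^sup>2) (x e)) \<partial>(\<Pi>\<^sub>M b\<in>{e}. lborel))"
      using e by (subst product_nn_integral_insert) auto
    also have "\<dots> = (LBN u v. H (u\<^sup>2 + v\<^sup>2) u)"
      by (rule product_nn_integral_singleton) measurable
    also have "\<dots> \<le> (LBN u. K1 * (LBN a. H a u * w a u))"
    proof (rule nn_integral_mono)
      fix u :: real
      have "(LBN v. H (u\<^sup>2 + v\<^sup>2) u)
          \<le> K1 * (\<integral>\<^sup>+a\<in>{0<..}. H (u\<^sup>2 + a) u * ennreal (a powr (-1/2)) \<partial>lborel)"
        by (rule line) measurable
      also have "(\<integral>\<^sup>+a\<in>{0<..}. H (u\<^sup>2 + a) u * ennreal (a powr (-1/2)) \<partial>lborel)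
          = (LBN a. H (u\<^sup>2 + a) u * w (u\<^sup>2 + a) u)"
        by (simp add: w_def mult.assoc)
      also have "\<dots> = (LBN a. H a u * w a u)"
        by (rule nn_integral_shift) measurable
      finally show "(LBN v. H (u\<^sup>2 + v\<^sup>2) u) \<le> K1 * (LBN a. H a u * w a u)" .
    qed
    also have "\<dots> = K1 * (LBN u a. H a u * w a u)"
      by (rule nn_integral_cmult) measurable
    also have "(LBN u a. H a u * w a u) = (LBN a u. H a u * w a u)"
      by (rule lborel_pair.Fubini') measurable
    also have "\<dots> = (LBN a. ennreal (1 / (2 * D)) * (g1 (sqrt a) * (LBN c. g2 (sqrt c) * k a c)))"
    proof (rule nn_integral_cong)
      fix a :: real
      have "(LBN u. H a u * w a u) = ennreal (1 / (2 * D)) * (LBN c. H a ((a + D\<^sup>2 - c) / (2 * D)) * k a c)"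
        unfolding k_def using D by (intro nn_integral_cosine_substitution) measurable
      also have "(LBN c. H a ((a + D\<^sup>2 - c) / (2 * D)) * k a c) = (LBN c. g1 (sqrt a) * (g2 (sqrt c) * k a c))"
        using D by (simp add: H_def mult.assoc)
      also have "\<dots> = g1 (sqrt a) * (LBN c. g2 (sqrt c) * k a c)"
        by (rule nn_integral_cmult) measurable
      finally show "(LBN u. H a u * w a u) = ennreal (1 / (2 * D)) * (g1 (sqrt a) * (LBN c. g2 (sqrt c) * k a c))" .
    qed
    also have "\<dots> = ennreal (1 / (2 * D)) * (LBN a. g1 (sqrt a) * (LBN c. g2 (sqrt c) * k a c))"
      by (rule nn_integral_cmult) measurable
    also have "(LBN a. g1 (sqrt a) * (LBN c. g2 (sqrt c) * k a c))
        \<le> ennreal (2 * R0) * (LBN r. g1 r * (LBN c. g2 (sqrt c) * k (r\<^sup>2) c))"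
      using r0 supp(1) by (intro nn_integral_sqrt_le) measurable
    also have "\<dots> \<le> ennreal (2 * R0) * (LBN r. g1 r * (ennreal (2 * R0) * (LBN r'. g2 r' * k (r\<^sup>2) (r'\<^sup>2))))"
      using r0 supp(2) by (intro mult_left_mono nn_integral_mono nn_integral_sqrt_le) measurable
    also have "\<dots> \<le> ennreal (2 * \<bar>R0\<bar>) * (LBN r. g1 r * (ennreal (2 * \<bar>R0\<bar>) * (LBN r'. g2 r' * k (r\<^sup>2) (r'\<^sup>2))))"
      by (intro mult_mono nn_integral_mono mult_left_mono mult_right_mono ennreal_leI) auto
    also have "\<dots> = ennreal (2 * \<bar>R0\<bar>) * (ennreal (2 * \<bar>R0\<bar>) * (LBN r r'. g1 r * g2 r' * k (r\<^sup>2) (r'\<^sup>2)))"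
      by (simp add: nn_integral_cmult[symmetric] mult_ac)
    finally have "(LBN y. g1 (dist x1 y) * g2 (dist x2 y))
        \<le> K1 * (ennreal (1 / (2 * D)) * (ennreal (2 * \<bar>R0\<bar>) * (ennreal (2 * \<bar>R0\<bar>) * (LBN r r'. g1 r * g2 r' * k (r\<^sup>2) (r'\<^sup>2)))))"
      by (simp add: mult_left_mono)
    also have "\<dots> = K1 * ennreal (2 * \<bar>R0\<bar>) * ennreal (2 * \<bar>R0\<bar>) * (LBN r r'. ennreal (1 / (2 * D)) * (g1 r * g2 r' * k (r\<^sup>2) (r'\<^sup>2)))"
    proof -
      have "(LBN r r'. ennreal (1 / (2 * D)) * (g1 r * g2 r' * k (r\<^sup>2) (r'\<^sup>2)))
        = ennreal (1 / (2 * D)) * (LBN r r'. g1 r * g2 r' * k (r\<^sup>2) (r'\<^sup>2))"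
        by (simp add: nn_integral_cmult)
      then show ?thesis by (simp only: mult_ac)
    qed
    also have "(LBN r r'. ennreal (1 / (2 * D)) * (g1 r * g2 r' * k (r\<^sup>2) (r'\<^sup>2)))
        \<le> (LBN r r'. ennreal (1 / r0) * (g1 r * g2 r' * ennreal (?q r r')))"
    proof (intro nn_integral_mono)
      fix r r' :: real
      show "ennreal (1 / (2 * D)) * (g1 r * g2 r' * k (r\<^sup>2) (r'\<^sup>2)) \<le> ennreal (1 / r0) * (g1 r * g2 r' * ennreal (?q r r'))"
      proof (cases "r \<in> {r0..R0} \<and> r' \<in> {r0..R0}")
        case True
        have "ennreal (1 / (2 * D)) * k (r\<^sup>2) (r'\<^sup>2) \<le> ennreal (1 / r0) * ennreal (?q r r')"
        proof (cases "0 < r\<^sup>2 - ((r\<^sup>2 + D\<^sup>2 - r'\<^sup>2) / (2 * D))\<^sup>2")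
          case P: True
          have "1 / (2 * D) * (r\<^sup>2 - ((r\<^sup>2 + D\<^sup>2 - r'\<^sup>2) / (2 * D))\<^sup>2) powr (-1/2) \<le> 1 / r0 * ?q r r'"
            using triangle_kernel_bound[OF r0 _ _ D P] True by (simp add: mult.assoc)
          then have "ennreal (1 / (2 * D) * (r\<^sup>2 - ((r\<^sup>2 + D\<^sup>2 - r'\<^sup>2) / (2 * D))\<^sup>2) powr (-1/2)) \<le> ennreal (1 / r0 * ?q r r')"
            by (rule ennreal_leI)
          moreover have "ennreal (1 / r0 * ?q r r') = ennreal (1 / r0) * ennreal (?q r r')"
            using r0 by (intro ennreal_mult) auto
          moreover have "ennreal (1 / (2 * D) * (r\<^sup>2 - ((r\<^sup>2 + D\<^sup>2 - r'\<^sup>2) / (2 * D))\<^sup>2) powr (-1/2))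
              = ennreal (1 / (2 * D)) * k (r\<^sup>2) (r'\<^sup>2)"
            unfolding k_def w_def using D P by (subst ennreal_mult) auto
          ultimately show ?thesis by simp
        next
          case False
          then show ?thesis by (simp add: k_def w_def)
        qed
        from mult_left_mono[OF this, of "g1 r * g2 r'"] show ?thesis by (simp add: mult_ac)
      qed (auto simp: supp)
    qed
    also have "\<dots> = ennreal (1 / r0) * (LBN r r'. g1 r * g2 r' * ennreal (?q r r'))"
      by (simp add: nn_integral_cmult)
    finally have "(LBN y. g1 (dist x1 y) * g2 (dist x2 y))
        \<le> ennreal (enn2real K1) * ennreal (2 * \<bar>R0\<bar>) * ennreal (2 * \<bar>R0\<bar>) * ennreal (1 / r0) *
          (LBN r r'. g1 r * g2 r' * ennreal (?q r r'))"
      by (simp add: mult_left_mono mult.assoc flip: K1')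
    moreover have "ennreal (a * b * c * d) = ennreal a * ennreal b * ennreal c * ennreal d"
      if "0 \<le> a" "0 \<le> b" "0 \<le> c" "0 \<le> d" for a b c d
      using that by (simp add: ennreal_mult)
    from this[of "enn2real K1" "2 * \<bar>R0\<bar>" "2 * \<bar>R0\<bar>" "1 / r0"]
    have "ennreal (enn2real K1 * (2 * \<bar>R0\<bar>) * (2 * \<bar>R0\<bar>) * (1 / r0))
        = ennreal (enn2real K1) * ennreal (2 * \<bar>R0\<bar>) * ennreal (2 * \<bar>R0\<bar>) * ennreal (1 / r0)"
      using r0 by simp
    ultimately show ?thesis by (simp only: D_def)
  qed
  then show thesis
    using r0 by (intro that[of "enn2real K1 * (2 * \<bar>R0\<bar>) * (2 * \<bar>R0\<bar>) * (1 / r0)"]) simp_all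
qed

section \<open>Fractional integration of order one half on the line\<close>

lemma nn_integral_abs_le:
  fixes h :: "real \<Rightarrow> ennreal"
  assumes [measurable]: "h \<in> borel_measurable borel"
  shows "(LBN u. h \<bar>u\<bar>) \<le> 2 * (\<integral>\<^sup>+u\<in>{0..}. h u \<partial>lborel)"
proof -
  have "(LBN u. h \<bar>u\<bar>) \<le> (LBN u. h u * indicator {0..} u + h (- u) * indicator {0..} (- u))"
    by (intro nn_integral_mono) (auto split: split_indicator simp: abs_if)
  also have "\<dots> = (\<integral>\<^sup>+u\<in>{0..}. h u \<partial>lborel) + (LBN u. h (- u) * indicator {0..} (- u))"
    by (rule nn_integral_add) measurable
  also have "(LBN u. h (- u) * indicator {0..} (- u)) = (\<integral>\<^sup>+u\<in>{0..}. h u \<partial>lborel)"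
    using nn_integral_lborel_reflect[of "\<lambda>u. h u * indicator {0..} u" 0] by simp
  finally show ?thesis by (simp add: mult_2)
qed

lemma nn_integral_inv_sqrt_le:
  fixes \<delta> :: real
  assumes "0 < \<delta>"
  shows "(\<integral>\<^sup>+v\<in>{0..}. ennreal (v powr (-1/2)) * indicator {..<\<delta>} v \<partial>lborel) \<le> ennreal (2 * sqrt \<delta>)"
proof -
  have "(\<integral>\<^sup>+v\<in>{0..}. ennreal (v powr (-1/2)) * indicator {..<\<delta>} v \<partial>lborel)
      = (\<integral>\<^sup>+r\<in>{0..}. (ennreal ((r\<^sup>2) powr (-1/2)) * indicator {..<\<delta>} (r\<^sup>2)) * ennreal (2 * r) \<partial>lborel)"
    by (rule nn_integral_square_substitution) measurable
  also have "\<dots> \<le> (LBN r. 2 * indicator {0..sqrt \<delta>} r)"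
  proof (rule nn_integral_mono)
    fix r :: real
    show "(ennreal ((r\<^sup>2) powr (-1/2)) * indicator {..<\<delta>} (r\<^sup>2)) * ennreal (2 * r) * indicator {0..} r
        \<le> 2 * indicator {0..sqrt \<delta>} r"
    proof (cases "0 < r \<and> r\<^sup>2 < \<delta>")
      case True
      have "(r\<^sup>2) powr (-1/2) * (2 * r) = 2"
        using True by (simp only: powr_neg_half_square) simp
      then have "ennreal ((r\<^sup>2) powr (-1/2)) * ennreal (2 * r) = 2"
        using True by (metis ennreal_mult ennreal_numeral mult_nonneg_nonneg order_less_imp_le powr_ge_zero zero_le_numeral)
      moreover have "r \<le> sqrt \<delta>" using True by (simp add: real_le_rsqrt)
      ultimately show ?thesis using True by simp
    next
      case False
      then have z: "(ennreal ((r\<^sup>2) powr (-1/2)) * indicator {..<\<delta>} (r\<^sup>2)) * ennreal (2 * r) * indicator {0..} r = 0"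
        by (cases "r = 0") (auto split: split_indicator)
      show ?thesis unfolding z by simp
    qed
  qed
  also have "\<dots> = ennreal (2 * sqrt \<delta>)"
    using assms by (simp add: nn_integral_cmult_indicator ennreal_mult)
  finally show ?thesis .
qed

text \<open>
  The inner integral of fractional integration, restricted to the values of \<open>G\<close> below a level \<open>T\<close>. At distance less than
  \<open>\<delta> = T\<^sup>-\<^sup>4\<^sup>/\<^sup>3\<close> from \<open>c\<close> the bound \<open>G \<le> T\<close> is used; further away the elementary inequality
  \<open>G k \<le> T\<^sup>1\<^sup>/\<^sup>3 G\<^sup>4\<^sup>/\<^sup>3 + k\<^sup>4 / T\<close>, valid for the kernel \<open>k = |r - c|\<^sup>-\<^sup>1\<^sup>/\<^sup>2\<close>, replaces Hoelder's inequality.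
\<close>

lemma fractional_kernel_truncated:
  fixes G :: "real \<Rightarrow> real"
  assumes [measurable]: "G \<in> borel_measurable borel" and G0: "\<And>r. 0 \<le> G r"
    and norm: "(LBN r. ennreal (G r powr (4/3))) \<le> 1" and T: "0 \<le> T"
  shows "(LBN r. ennreal (if G r \<le> T then G r * \<bar>r - c\<bar> powr (-1/2) else 0)) \<le> ennreal (7 * T powr (1/3))"
proof (cases "T = 0")
  case True
  have z: "(if G r \<le> T then G r * \<bar>r - c\<bar> powr (-1/2) else 0) = 0" for r
    using G0[of r] True by auto
  show ?thesis unfolding z by simp
next
  case False
  with T have T: "0 < T" by simp
  define \<delta> where "\<delta> = T powr (-4/3)"
  have \<delta>: "0 < \<delta>" using T by (simp add: \<delta>_def)
  define near where "near u = ennreal T * (ennreal (u powr (-1/2)) * indicator {..<\<delta>} u)" for u :: real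
  define far where "far u = ennreal (1 / T) * (ennreal (u powr (-1 - 1)) * indicator {\<delta>..} u)" for u :: real
  have [measurable]: "near \<in> borel_measurable borel" "far \<in> borel_measurable borel"
    unfolding near_def far_def by measurable
  have "(LBN r. ennreal (if G r \<le> T then G r * \<bar>r - c\<bar> powr (-1/2) else 0))
      \<le> (LBN r. near \<bar>r - c\<bar> + ennreal (T powr (1/3)) * ennreal (G r powr (4/3)) + far \<bar>r - c\<bar>)"
  proof (rule nn_integral_mono)
    fix r
    let ?k = "\<bar>r - c\<bar> powr (-1/2)"
    show "ennreal (if G r \<le> T then G r * ?k else 0)
        \<le> near \<bar>r - c\<bar> + ennreal (T powr (1/3)) * ennreal (G r powr (4/3)) + far \<bar>r - c\<bar>"
    proof (cases "G r \<le> T \<and> 0 < G r")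
      case True
      show ?thesis
      proof (cases "\<bar>r - c\<bar> < \<delta>")
        case near: True
        have "ennreal (G r * ?k) \<le> ennreal (T * ?k)"
          using True by (intro ennreal_leI mult_right_mono) auto
        also have "\<dots> = near \<bar>r - c\<bar>"
          using near T by (simp add: near_def ennreal_mult)
        finally have "ennreal (G r * ?k) \<le> near \<bar>r - c\<bar>" .
        then show ?thesis using True by (simp add: add_increasing2 add.assoc)
      next
        case far: False
        then have u: "0 < \<bar>r - c\<bar>" using \<delta> by linarith
        then have k: "0 < ?k" by simp
        have far_eq: "far \<bar>r - c\<bar> = ennreal (1 / T * ?k ^ 4)"
        proof -
          have "?k ^ 4 = ?k powr 4" using k by (simp flip: powr_numeral)
          also have "\<dots> = \<bar>r - c\<bar> powr (-1 - 1)" by (simp add: powr_powr)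
          finally have "far \<bar>r - c\<bar> = ennreal (1 / T) * ennreal (?k ^ 4)"
            using far by (simp add: far_def)
          also have "\<dots> = ennreal (1 / T * ?k ^ 4)"
            using T by (intro ennreal_mult[symmetric]) auto
          finally show ?thesis .
        qed
        \<comment> \<open>Far from \<open>c\<close>, either term of the elementary inequality can dominate.\<close>
        show ?thesis
        proof (cases "?k \<le> T powr (1/3) * G r powr (1/3)")
          case le: True
          have "G r * ?k \<le> G r * (T powr (1/3) * G r powr (1/3))"
            using True le by (intro mult_left_mono) auto
          also have "\<dots> = T powr (1/3) * G r powr (4/3)"
            using powr_mult_base[of "G r" "1/3"] True by simp
          finally have "ennreal (G r * ?k) \<le> ennreal (T powr (1/3) * G r powr (4/3))"
            by (rule ennreal_leI)
          then have "ennreal (G r * ?k) \<le> ennreal (T powr (1/3)) * ennreal (G r powr (4/3))"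
            by (simp add: ennreal_mult)
          then show ?thesis using True by (simp add: add_increasing add_increasing2)
        next
          case gt: False
          have "(T powr (1/3) * G r powr (1/3)) ^ 3 \<le> ?k ^ 3"
            using gt by (intro power_mono) auto
          moreover have "(T powr (1/3) * G r powr (1/3)) ^ 3 = T * G r"
            using T True by (simp add: power_mult_distrib powr_power)
          ultimately have "G r \<le> 1 / T * ?k ^ 3" using T by (simp add: field_simps)
          then have "G r * ?k \<le> 1 / T * ?k ^ 3 * ?k"
            by (rule mult_right_mono) simp
          also have "\<dots> = 1 / T * ?k ^ 4" by (simp add: eval_nat_numeral)
          finally have "ennreal (G r * ?k) \<le> far \<bar>r - c\<bar>"
            unfolding far_eq by (rule ennreal_leI)
          then show ?thesis using True by (simp add: add_increasing)
        qed
      qed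
    next
      case False
      then have "(if G r \<le> T then G r * ?k else 0) = 0" using G0[of r] by auto
      then show ?thesis by simp
    qed
  qed
  also have "\<dots> = (LBN r. near \<bar>r - c\<bar>) + ennreal (T powr (1/3)) * (LBN r. ennreal (G r powr (4/3)))
      + (LBN r. far \<bar>r - c\<bar>)"
    by (simp add: nn_integral_add nn_integral_cmult)
  also have "\<dots> \<le> ennreal (4 * T powr (1/3)) + ennreal (T powr (1/3)) + ennreal (2 * T powr (1/3))"
  proof (intro add_mono)
    have shift: "(LBN r. h \<bar>r - c\<bar>) \<le> 2 * (\<integral>\<^sup>+u\<in>{0..}. h u \<partial>lborel)"
      if [measurable]: "h \<in> borel_measurable borel" for h :: "real \<Rightarrow> ennreal"
    proof -
      have "(LBN r. h \<bar>r - c\<bar>) = (LBN u. h \<bar>u\<bar>)"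
        using nn_integral_shift[of "\<lambda>u. h \<bar>u\<bar>" "- c"] by simp
      also have "\<dots> \<le> 2 * (\<integral>\<^sup>+u\<in>{0..}. h u \<partial>lborel)"
        by (rule nn_integral_abs_le) measurable
      finally show ?thesis .
    qed
    have "(LBN r. near \<bar>r - c\<bar>) \<le> 2 * (\<integral>\<^sup>+u\<in>{0..}. near u \<partial>lborel)"
      by (rule shift) measurable
    also have "(\<integral>\<^sup>+u\<in>{0..}. near u \<partial>lborel) = ennreal T * (\<integral>\<^sup>+u\<in>{0..}. ennreal (u powr (-1/2)) * indicator {..<\<delta>} u \<partial>lborel)"
      unfolding near_def by (subst nn_integral_cmult[symmetric]) (auto simp: mult.assoc)
    also have "\<dots> \<le> ennreal T * ennreal (2 * sqrt \<delta>)"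
      by (intro mult_left_mono nn_integral_inv_sqrt_le \<delta>) simp
    also have "2 * (ennreal T * ennreal (2 * sqrt \<delta>)) = ennreal (4 * (T * sqrt \<delta>))"
    proof -
      have "ennreal (4 * (T * sqrt \<delta>)) = ennreal (2 * (T * (2 * sqrt \<delta>)))" by (simp add: mult_ac)
      also have "\<dots> = ennreal 2 * ennreal (T * (2 * sqrt \<delta>))" using T \<delta> by (intro ennreal_mult) auto
      also have "ennreal (T * (2 * sqrt \<delta>)) = ennreal T * ennreal (2 * sqrt \<delta>)" using T \<delta> by (intro ennreal_mult) auto
      finally show ?thesis by simp
    qed
    also have "T * sqrt \<delta> = T powr (1/3)"
    proof -
      have "sqrt \<delta> = T powr (-2/3)"
        unfolding \<delta>_def by (simp add: powr_half_sqrt[symmetric] powr_powr)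
      then show ?thesis using powr_mult_base[of T "-2/3"] T by simp
    qed
    finally show "(LBN r. near \<bar>r - c\<bar>) \<le> ennreal (4 * T powr (1/3))"
      by (simp add: mult_left_mono)
    have "(LBN r. far \<bar>r - c\<bar>) \<le> 2 * (\<integral>\<^sup>+u\<in>{0..}. far u \<partial>lborel)"
      by (rule shift) measurable
    also have "(\<integral>\<^sup>+u\<in>{0..}. far u \<partial>lborel) = ennreal (1 / T) * (\<integral>\<^sup>+u\<in>{0..}. ennreal (u powr (-1 - 1)) * indicator {\<delta>..} u \<partial>lborel)"
      unfolding far_def by (subst nn_integral_cmult[symmetric]) (auto simp: mult.assoc)
    also have "(\<integral>\<^sup>+u\<in>{0..}. ennreal (u powr (-1 - 1)) * indicator {\<delta>..} u \<partial>lborel)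
        = (\<integral>\<^sup>+u\<in>{\<delta><..}. ennreal (u powr (-1 - 1)) \<partial>lborel)"
    proof (rule nn_integral_cong_AE, rule AE_mp[OF AE_lborel_singleton[of \<delta>]], rule AE_I2, rule impI)
      fix u :: real assume "u \<noteq> \<delta>"
      then show "ennreal (u powr (-1 - 1)) * indicator {\<delta>..} u * indicator {0..} u = ennreal (u powr (-1 - 1)) * indicator {\<delta><..} u"
        using \<delta> by (auto split: split_indicator)
    qed
    also have "\<dots> = ennreal (\<delta> powr -1 / 1)"
      by (rule nn_integral_powr_atLeast) (use \<delta> in auto)
    also have "2 * (ennreal (1 / T) * ennreal (\<delta> powr -1 / 1)) = ennreal (2 * (1 / T * \<delta> powr -1))"
    proof -
      have "ennreal (2 * (1 / T * \<delta> powr -1)) = ennreal 2 * ennreal (1 / T * \<delta> powr -1)"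
        using T by (intro ennreal_mult) auto
      also have "ennreal (1 / T * \<delta> powr -1) = ennreal (1 / T) * ennreal (\<delta> powr -1)"
        using T by (intro ennreal_mult) auto
      finally show ?thesis by simp
    qed
    also have "1 / T * \<delta> powr -1 = T powr (1/3)"
    proof -
      have "\<delta> powr -1 = T powr (-4/3 * -1)" unfolding \<delta>_def by (rule powr_powr)
      then have "\<delta> powr -1 = T powr (4/3)" by simp
      then show ?thesis using powr_mult_base[of T "1/3"] T by (simp add: nonzero_divide_eq_eq mult.commute)
    qed
    finally show "(LBN r. far \<bar>r - c\<bar>) \<le> ennreal (2 * T powr (1/3))"
      by (simp add: mult_left_mono)
    show "ennreal (T powr (1/3)) * (LBN r. ennreal (G r powr (4/3))) \<le> ennreal (T powr (1/3))"
      using mult_left_mono[OF norm, of "ennreal (T powr (1/3))"] by simp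
  qed
  also have "\<dots> = ennreal (7 * T powr (1/3))"
    by (simp flip: ennreal_plus)
  finally show ?thesis .
qed

text \<open>
  Split the pairs \<open>(r, r')\<close> according to which of \<open>G1 r\<close> and \<open>G2 r'\<close> is larger, and apply the truncated
  estimate at that level: it returns the power \<open>1/3\<close> of the larger value, which completes it to the power \<open>4/3\<close>.
\<close>

lemma fractional_integration_normalised:
  fixes G1 G2 :: "real \<Rightarrow> real"
  assumes [measurable]: "G1 \<in> borel_measurable borel" "G2 \<in> borel_measurable borel"
    and pos: "\<And>r. 0 \<le> G1 r" "\<And>r. 0 \<le> G2 r"
    and norm: "(LBN r. ennreal (G1 r powr (4/3))) \<le> 1" "(LBN r. ennreal (G2 r powr (4/3))) \<le> 1"
  shows "(LBN r r'. ennreal (G1 r * G2 r' * \<bar>r - r' - c\<bar> powr (-1/2))) \<le> 14"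
proof -
  have half: "(LBN r r'. ennreal (if G r' \<le> F r then F r * G r' * \<bar>r' - (r - b)\<bar> powr (-1/2) else 0)) \<le> 7"
    if [measurable]: "F \<in> borel_measurable borel" "G \<in> borel_measurable borel"
      and pos: "\<And>r. 0 \<le> F r" "\<And>r. 0 \<le> G r"
      and norm: "(LBN r. ennreal (F r powr (4/3))) \<le> 1" "(LBN r. ennreal (G r powr (4/3))) \<le> 1"
    for F G :: "real \<Rightarrow> real" and b
  proof -
    have "(LBN r r'. ennreal (if G r' \<le> F r then F r * G r' * \<bar>r' - (r - b)\<bar> powr (-1/2) else 0))
        \<le> (LBN r. 7 * ennreal (F r powr (4/3)))"
    proof (rule nn_integral_mono)
      fix r
      have "(LBN r'. ennreal (if G r' \<le> F r then F r * G r' * \<bar>r' - (r - b)\<bar> powr (-1/2) else 0))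
          = (LBN r'. ennreal (F r) * ennreal (if G r' \<le> F r then G r' * \<bar>r' - (r - b)\<bar> powr (-1/2) else 0))"
        using pos by (intro nn_integral_cong) (simp add: mult.assoc flip: ennreal_mult)
      also have "\<dots> = ennreal (F r) * (LBN r'. ennreal (if G r' \<le> F r then G r' * \<bar>r' - (r - b)\<bar> powr (-1/2) else 0))"
        by (rule nn_integral_cmult) measurable
      also have "\<dots> \<le> ennreal (F r) * ennreal (7 * F r powr (1/3))"
        by (intro mult_left_mono fractional_kernel_truncated pos norm) simp_all
      also have "\<dots> = ennreal (7 * (F r * F r powr (1/3)))"
        using pos(1)[of r] by (simp add: mult_ac flip: ennreal_mult)
      also have "F r * F r powr (1/3) = F r powr (4/3)"
        using powr_mult_base[of "F r" "1/3"] pos(1)[of r] by simp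
      finally show "(LBN r'. ennreal (if G r' \<le> F r then F r * G r' * \<bar>r' - (r - b)\<bar> powr (-1/2) else 0))
          \<le> 7 * ennreal (F r powr (4/3))"
        by (simp add: ennreal_mult)
    qed
    also have "\<dots> = 7 * (LBN r. ennreal (F r powr (4/3)))"
      by (rule nn_integral_cmult) measurable
    also have "\<dots> \<le> 7 * 1"
      by (intro mult_left_mono norm) simp
    finally show ?thesis by simp
  qed
  let ?below = "\<lambda>r r'. ennreal (if G2 r' \<le> G1 r then G1 r * G2 r' * \<bar>r' - (r - c)\<bar> powr (-1/2) else 0)"
  let ?above = "\<lambda>r r'. ennreal (if G1 r \<le> G2 r' then G2 r' * G1 r * \<bar>r - (r' - - c)\<bar> powr (-1/2) else 0)"
  have "(LBN r r'. ennreal (G1 r * G2 r' * \<bar>r - r' - c\<bar> powr (-1/2)))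
      \<le> (LBN r r'. ?below r r'
          + ?above r r')"
  proof (intro nn_integral_mono)
    fix r r'
    have "\<bar>r - r' - c\<bar> = \<bar>r' - (r - c)\<bar>" "\<bar>r - r' - c\<bar> = \<bar>r - (r' - - c)\<bar>" by linarith+
    then show "ennreal (G1 r * G2 r' * \<bar>r - r' - c\<bar> powr (-1/2))
        \<le> ?below r r'
          + ?above r r'"
      by (cases "G2 r' \<le> G1 r") (simp_all add: mult.commute)
  qed
  also have "\<dots> = (LBN r r'. ?below r r')
      + (LBN r r'. ?above r r')"
    by (simp add: nn_integral_add)
  also have "(LBN r r'. ?above r r')
      = (LBN r' r. ?above r r')"
    by (rule lborel_pair.Fubini') measurable
  also have "(LBN r r'. ?below r r') + \<dots> \<le> 7 + 7"
    by (intro add_mono half pos norm) measurable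
  finally show ?thesis by simp
qed

text \<open>
  The Hardy-Littlewood-Sobolev inequality on the line for the kernel of order one half, in its diagonal case. It follows
  from the normalised case by homogeneity.
\<close>

lemma fractional_integration:
  fixes G1 G2 :: "real \<Rightarrow> real"
  assumes [measurable]: "G1 \<in> borel_measurable borel" "G2 \<in> borel_measurable borel"
    and pos: "\<And>r. 0 \<le> G1 r" "\<And>r. 0 \<le> G2 r"
  shows "(LBN r r'. ennreal (G1 r * G2 r' * \<bar>r - r' - c\<bar> powr (-1/2)))
    \<le> 14 * (epow (LBN r. ennreal (G1 r powr (4/3))) (3/4) * epow (LBN r. ennreal (G2 r powr (4/3))) (3/4))"
proof -
  let ?X = "\<integral>\<^sup>+r. ennreal (G1 r powr (4/3)) \<partial>lborel" and ?Y = "\<integral>\<^sup>+r. ennreal (G2 r powr (4/3)) \<partial>lborel"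
  let ?L = "\<integral>\<^sup>+r. (LBN r'. ennreal (G1 r * G2 r' * \<bar>r - r' - c\<bar> powr (-1/2))) \<partial>lborel"
  consider "?X = 0" | "?Y = 0" | "?X \<noteq> 0" "?Y \<noteq> 0" "?X = top \<or> ?Y = top"
    | "?X \<noteq> 0" "?Y \<noteq> 0" "?X \<noteq> top" "?Y \<noteq> top"
    by blast
  then show ?thesis
  proof cases
    case 1
    then have "AE r in lborel. G1 r = 0"
      by (simp add: nn_integral_0_iff_AE pos ennreal_eq_0_iff)
    then have "AE r in lborel. (LBN r'. ennreal (G1 r * G2 r' * \<bar>r - r' - c\<bar> powr (-1/2))) = 0"
      by eventually_elim simp
    then have "?L = (LBN (r::real). 0)" by (rule nn_integral_cong_AE)
    then show ?thesis by simp
  next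
    case 2
    then have ae: "AE r' in lborel. G2 r' = 0"
      by (simp add: nn_integral_0_iff_AE pos ennreal_eq_0_iff)
    have "(LBN r'. ennreal (G1 r * G2 r' * \<bar>r - r' - c\<bar> powr (-1/2))) = (LBN (r'::real). 0)" for r
    proof (rule nn_integral_cong_AE)
      show "AE r' in lborel. ennreal (G1 r * G2 r' * \<bar>r - r' - c\<bar> powr (-1/2)) = 0"
        using ae by eventually_elim simp
    qed
    then show ?thesis by simp
  next
    case 3
    then have "14 * (epow ?X (3/4) * epow ?Y (3/4)) = top"
      by (auto simp: ennreal_mult_top ennreal_top_mult)
    then show ?thesis by simp
  next
    case 4
    obtain X where X: "?X = ennreal X" "0 < X" using 4 by (cases ?X) (auto simp: less_le)
    obtain Y where Y: "?Y = ennreal Y" "0 < Y" using 4 by (cases ?Y) (auto simp: less_le)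
    define a where "a = X powr (3/4)"
    define b where "b = Y powr (3/4)"
    have ab: "0 < a" "0 < b" using X Y by (simp_all add: a_def b_def)
    have nrm: "(LBN r. ennreal ((G r / z powr (3/4)) powr (4/3))) \<le> 1"
      if [measurable]: "G \<in> borel_measurable borel" and "\<And>r. 0 \<le> G r"
        and Z: "(LBN r. ennreal (G r powr (4/3))) = ennreal z" "0 < z"
      for G :: "real \<Rightarrow> real" and z
    proof -
      have "(LBN r. ennreal ((G r / z powr (3/4)) powr (4/3))) = (LBN r. ennreal (1 / z) * ennreal (G r powr (4/3)))"
        using Z(2) that(2) by (intro nn_integral_cong) (simp add: powr_divide powr_powr flip: ennreal_mult)
      also have "\<dots> = ennreal (1 / z) * ennreal z"
        by (subst nn_integral_cmult) (simp_all add: Z)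
      also have "\<dots> = 1" using Z by (simp flip: ennreal_mult)
      finally show ?thesis by simp
    qed
    have "?L = (LBN r r'. ennreal (a * b) * ennreal (G1 r / a * (G2 r' / b) * \<bar>r - r' - c\<bar> powr (-1/2)))"
      using ab by (intro nn_integral_cong) (simp add: pos flip: ennreal_mult)
    also have "\<dots> = ennreal (a * b) * (LBN r r'. ennreal (G1 r / a * (G2 r' / b) * \<bar>r - r' - c\<bar> powr (-1/2)))"
      by (simp add: nn_integral_cmult)
    also have "\<dots> \<le> ennreal (a * b) * 14"
      using X Y ab pos unfolding a_def b_def
      by (intro mult_left_mono fractional_integration_normalised nrm) auto
    also have "ennreal (a * b) = epow ?X (3/4) * epow ?Y (3/4)"
      using X Y by (simp add: epow_ennreal a_def b_def ennreal_mult)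
    finally show ?thesis by (simp add: mult.commute)
  qed
qed

section \<open>The two pair estimates in a common form\<close>

text \<open>
  The single geometric property of the dimension that the later arguments use; \<open>\<kappa>\<close> measures the decay in the distance of the
  centres and \<open>m\<close> the integrability required in the radii. The first argument only fixes the ambient space.
\<close>

definition annular_pair_bound ::
  "'a::euclidean_space itself \<Rightarrow> real \<Rightarrow> real \<Rightarrow> real \<Rightarrow> real \<Rightarrow> real \<Rightarrow> bool" where
  "annular_pair_bound _ r0 R0 \<kappa> m K \<longleftrightarrow>
    (\<forall>(x1::'a) x2 (G1::real \<Rightarrow> real) (G2::real \<Rightarrow> real).
      x1 \<noteq> x2 \<longrightarrow> G1 \<in> borel_measurable borel \<longrightarrow> G2 \<in> borel_measurable borel \<longrightarrow>
      (\<forall>r. 0 \<le> G1 r) \<longrightarrow> (\<forall>r. 0 \<le> G2 r) \<longrightarrow>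
      (\<forall>r. r \<notin> {r0..R0} \<longrightarrow> G1 r = 0) \<longrightarrow> (\<forall>r. r \<notin> {r0..R0} \<longrightarrow> G2 r = 0) \<longrightarrow>
      (LBN y. ennreal (G1 (dist x1 y) * G2 (dist x2 y)))
        \<le> ennreal (K * dist x1 x2 powr - \<kappa>) *
          (epow (LBN r. ennreal (G1 r powr m)) (1 / m) *
           epow (LBN r. ennreal (G2 r powr m)) (1 / m)))"

lemma annular_pair_bound_space:
  assumes "3 \<le> CARD('n)" "0 < r0"
  obtains K where "0 \<le> K" "annular_pair_bound TYPE(real^'n) r0 R0 1 1 K"
proof -
  obtain K :: real where K: "0 \<le> K"
    "\<And>(x1 :: real^'n) x2 g1 g2. x1 \<noteq> x2 \<Longrightarrow> g1 \<in> borel_measurable borel \<Longrightarrow> g2 \<in> borel_measurable borel \<Longrightarrow>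
      (\<And>r. r \<notin> {r0..R0} \<Longrightarrow> g1 r = 0) \<Longrightarrow> (\<And>r. r \<notin> {r0..R0} \<Longrightarrow> g2 r = 0) \<Longrightarrow>
      (LBN y. g1 (dist x1 y) * g2 (dist x2 y))
        \<le> ennreal (K * dist x1 x2 powr -1) * ((LBN r. g1 r) * (LBN r. g2 r))"
    using annular_pair_space[OF assms, of R0] by blast
  have "annular_pair_bound TYPE(real^'n) r0 R0 1 1 K"
    unfolding annular_pair_bound_def
  proof (intro allI impI)
    fix x1 x2 :: "real^'n" and G1 G2 :: "real \<Rightarrow> real"
    assume x: "x1 \<noteq> x2" and [measurable]: "G1 \<in> borel_measurable borel" "G2 \<in> borel_measurable borel"
      and pos: "\<forall>r. 0 \<le> G1 r" "\<forall>r. 0 \<le> G2 r"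
      and supp: "\<forall>r. r \<notin> {r0..R0} \<longrightarrow> G1 r = 0" "\<forall>r. r \<notin> {r0..R0} \<longrightarrow> G2 r = 0"
    have "(LBN y. ennreal (G1 (dist x1 y)) * ennreal (G2 (dist x2 y)))
        \<le> ennreal (K * dist x1 x2 powr -1) * ((LBN r. ennreal (G1 r)) * (LBN r. ennreal (G2 r)))"
      using x supp by (intro K(2)) auto
    then show "(LBN y. ennreal (G1 (dist x1 y) * G2 (dist x2 y)))
        \<le> ennreal (K * dist x1 x2 powr - 1) *
          (epow (LBN r. ennreal (G1 r powr 1)) (1 / 1) *
           epow (LBN r. ennreal (G2 r powr 1)) (1 / 1))"
      using pos by (simp add: ennreal_mult)
  qed
  with K(1) show thesis by (rule that)
qed

text \<open>
  Each of the three singular terms of the planar kernel is a translate of \<open>|r - r'|\<^sup>-\<^sup>1\<^sup>/\<^sup>2\<close>, after reflecting one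
  variable in the case of \<open>|r + r' - D|\<close>.
\<close>

lemma annular_pair_bound_plane:
  assumes "0 < r0"
  obtains K where "0 \<le> K" "annular_pair_bound TYPE(real^2) r0 R0 (1/2) (4/3) K"
proof -
  obtain K :: real where K: "0 \<le> K"
    "\<And>(x1 :: real^2) x2 g1 g2. x1 \<noteq> x2 \<Longrightarrow> g1 \<in> borel_measurable borel \<Longrightarrow> g2 \<in> borel_measurable borel \<Longrightarrow>
      (\<And>r. r \<notin> {r0..R0} \<Longrightarrow> g1 r = 0) \<Longrightarrow> (\<And>r. r \<notin> {r0..R0} \<Longrightarrow> g2 r = 0) \<Longrightarrow>
      (LBN y. g1 (dist x1 y) * g2 (dist x2 y))
        \<le> ennreal K * (LBN r r'. g1 r * g2 r' * ennreal (dist x1 x2 powr (-1/2) *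
            (\<bar>r + r' - dist x1 x2\<bar> powr (-1/2) + \<bar>r - r' + dist x1 x2\<bar> powr (-1/2)
              + \<bar>r - r' - dist x1 x2\<bar> powr (-1/2))))"
    using annular_pair_plane_kernel[OF assms, of R0] by blast
  have "annular_pair_bound TYPE(real^2) r0 R0 (1/2) (4/3) (42 * K)"
    unfolding annular_pair_bound_def
  proof (intro allI impI)
    fix x1 x2 :: "real^2" and G1 G2 :: "real \<Rightarrow> real"
    assume x: "x1 \<noteq> x2" and [measurable]: "G1 \<in> borel_measurable borel" "G2 \<in> borel_measurable borel"
      and pos: "\<forall>r. 0 \<le> G1 r" "\<forall>r. 0 \<le> G2 r"
      and supp: "\<forall>r. r \<notin> {r0..R0} \<longrightarrow> G1 r = 0" "\<forall>r. r \<notin> {r0..R0} \<longrightarrow> G2 r = 0"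
    let ?D = "dist x1 x2"
    let ?E = "epow (LBN r. ennreal (G1 r powr (4/3))) (3/4) * epow (LBN r. ennreal (G2 r powr (4/3))) (3/4)"
    let ?k = "\<lambda>r r'. ?D powr (-1/2) * (\<bar>r + r' - ?D\<bar> powr (-1/2) + \<bar>r - r' + ?D\<bar> powr (-1/2) + \<bar>r - r' - ?D\<bar> powr (-1/2))"
    let ?k1 = "\<lambda>r r'. ennreal (G1 r * G2 r' * \<bar>r + r' - ?D\<bar> powr (-1/2))"
    let ?k2 = "\<lambda>r r'. ennreal (G1 r * G2 r' * \<bar>r - r' - - ?D\<bar> powr (-1/2))"
    let ?k3 = "\<lambda>r r'. ennreal (G1 r * G2 r' * \<bar>r - r' - ?D\<bar> powr (-1/2))"
    let ?k4 = "\<lambda>r r'. ennreal (G1 r * G2 (- r') * \<bar>r - r' - ?D\<bar> powr (-1/2))"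
    have "(LBN y. ennreal (G1 (dist x1 y) * G2 (dist x2 y)))
        = (LBN y. ennreal (G1 (dist x1 y)) * ennreal (G2 (dist x2 y)))"
      using pos by (simp add: ennreal_mult)
    also have "\<dots> \<le> ennreal K * (LBN r r'. ennreal (G1 r) * ennreal (G2 r') * ennreal (?k r r'))"
      using x supp by (intro K(2)) auto
    also have "(LBN r r'. ennreal (G1 r) * ennreal (G2 r') * ennreal (?k r r'))
        = (LBN r r'. ennreal (?D powr (-1/2)) * (?k1 r r'
            + ?k2 r r' + ?k3 r r'))"
    proof (intro nn_integral_cong)
      fix r r'
      have split: "ennreal a * ennreal b * ennreal (d * (s + t + u))
          = ennreal d * (ennreal (a * b * s) + ennreal (a * b * t) + ennreal (a * b * u))"
        if "0 \<le> a" "0 \<le> b" "0 \<le> d" "0 \<le> s" "0 \<le> t" "0 \<le> u" for a b d s t u :: real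
        using that by (simp add: ennreal_mult distrib_left mult_ac)
      show "ennreal (G1 r) * ennreal (G2 r') * ennreal (?k r r')
        = ennreal (?D powr (-1/2)) * (?k1 r r'
            + ?k2 r r' + ?k3 r r')"
        using pos by (simp only: diff_minus_eq_add) (intro split; simp)
    qed
    also have "\<dots> = ennreal (?D powr (-1/2)) *
          ((LBN r r'. ?k1 r r')
            + (LBN r r'. ?k2 r r')
            + (LBN r r'. ?k3 r r'))"
      by (simp add: nn_integral_cmult nn_integral_add)
    also have "(LBN r r'. ?k1 r r')
        = (LBN r r'. ?k4 r r')"
    proof (rule nn_integral_cong)
      fix r
      show "(LBN r'. ?k1 r r')
          = (LBN r'. ?k4 r r')"
        using nn_integral_lborel_reflect[of "\<lambda>r'. ?k1 r r'" 0]
        by simp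
    qed
    also have "ennreal K * (ennreal (?D powr (-1/2)) *
          ((LBN r r'. ?k4 r r')
            + (LBN r r'. ?k2 r r')
            + (LBN r r'. ?k3 r r')))
        \<le> ennreal K * (ennreal (?D powr (-1/2)) * (14 * ?E + 14 * ?E + 14 * ?E))"
    proof (intro mult_left_mono add_mono)
      have "(LBN r. ennreal (G2 (- r) powr (4/3))) = (LBN r. ennreal (G2 r powr (4/3)))"
        using nn_integral_lborel_reflect[of "\<lambda>r. ennreal (G2 r powr (4/3))" 0] by simp
      then show "(LBN r r'. ?k4 r r') \<le> 14 * ?E"
        using fractional_integration[of G1 "\<lambda>r. G2 (- r)" ?D] pos by simp
      show "(LBN r r'. ?k2 r r') \<le> 14 * ?E"
        by (rule fractional_integration) (use pos in auto)
      show "(LBN r r'. ?k3 r r') \<le> 14 * ?E"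
        by (rule fractional_integration) (use pos in auto)
    qed simp_all
    also have "\<dots> = ennreal K * (ennreal (?D powr (-1/2)) * (42 * ?E))"
      by (simp flip: distrib_right)
    also have "\<dots> = (42 * ennreal K) * ennreal (?D powr (-1/2)) * ?E"
      by (simp only: mult_ac)
    also have "(42 * ennreal K) * ennreal (?D powr (-1/2)) = ennreal (42 * K * ?D powr - (1/2))"
      using K(1) by (simp add: ennreal_mult)
    finally show "(LBN y. ennreal (G1 (dist x1 y) * G2 (dist x2 y)))
        \<le> ennreal (42 * K * dist x1 x2 powr - (1/2)) *
          (epow (LBN r. ennreal (G1 r powr (4/3))) (1 / (4/3)) *
           epow (LBN r. ennreal (G2 r powr (4/3))) (1 / (4/3)))"
      by simp
  qed
  with K(1) show thesis by (intro that[of "42 * K"]) simp_all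
qed

section \<open>Powers of the mass of a function on a measure with ball growth\<close>

text \<open>
  The mass of \<open>u\<close> on points that are close to \<open>x\<close> relative to their height. Integrate over levels: at a point counted at level
  \<open>v\<close> one has \<open>D\<^sup>2\<^sup>\<beta> a v < A\<^sup>2\<close>, that is, the point lies in a ball of measure at most \<open>C A (a v)\<^sup>-\<^sup>1\<^sup>/\<^sup>2\<close>, and this is integrable in \<open>v\<close>
  up to the level \<open>a\<close>.
\<close>

lemma low_level_mass_le:
  fixes \<mu> :: "'a::euclidean_space measure" and u :: "'a \<Rightarrow> real"
  assumes \<mu>: "finite_measure \<mu>" and [measurable_cong]: "sets \<mu> = sets borel"
    and growth: "\<And>x \<delta>. 0 < \<delta> \<Longrightarrow> measure \<mu> (ball x \<delta>) \<le> C * \<delta> powr \<beta>"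
    and C: "0 < C" and \<beta>: "0 < \<beta>" and A: "0 < A" and a: "0 < a"
    and [measurable]: "u \<in> borel_measurable borel" and u: "\<And>x. 0 \<le> u x"
  shows "(\<integral>\<^sup>+z. ennreal (if u z \<le> a \<and> dist x z powr (2 * \<beta>) * (a * u z) < A\<^sup>2 then u z else 0) \<partial>\<mu>)
    \<le> ennreal (2 * C * A)"
proof -
  interpret finite_measure \<mu> by fact
  interpret pair: pair_sigma_finite \<mu> "lborel :: real measure" by standard
  let ?i = "\<lambda>z v. indicator {0..<a} v * (if dist x z powr (2 * \<beta>) * (a * v) < A\<^sup>2 then 1 else 0 :: ennreal)"
  have "(\<integral>\<^sup>+z. ennreal (if u z \<le> a \<and> dist x z powr (2 * \<beta>) * (a * u z) < A\<^sup>2 then u z else 0) \<partial>\<mu>)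
      \<le> (\<integral>\<^sup>+z. (LBN v. ?i z v) \<partial>\<mu>)"
  proof (rule nn_integral_mono)
    fix z
    show "ennreal (if u z \<le> a \<and> dist x z powr (2 * \<beta>) * (a * u z) < A\<^sup>2 then u z else 0) \<le> (LBN v. ?i z v)"
    proof (cases "u z \<le> a \<and> dist x z powr (2 * \<beta>) * (a * u z) < A\<^sup>2")
      case True
      have "ennreal (u z) = (LBN v. indicator {0..<u z} v)"
        using u[of z] by simp
      also have "\<dots> \<le> (LBN v. ?i z v)"
      proof (rule nn_integral_mono)
        fix v
        show "indicator {0..<u z} v \<le> ?i z v"
        proof (cases "v \<in> {0..<u z}")
          case v: True
          then have "dist x z powr (2 * \<beta>) * (a * v) \<le> dist x z powr (2 * \<beta>) * (a * u z)"
            using a by (intro mult_left_mono) auto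
          then show ?thesis using True v by simp
        qed simp
      qed
      finally show ?thesis using True by simp
    next
      case False
      then show ?thesis by (simp only: if_False ennreal_0 zero_le)
    qed
  qed
  also have "\<dots> = (LBN v. (\<integral>\<^sup>+z. ?i z v \<partial>\<mu>))"
    by (rule pair.Fubini'[symmetric]) measurable
  also have "\<dots> \<le> (LBN v. ennreal (C * A * a powr (-1/2)) * (ennreal (v powr (-1/2)) * indicator {..<a} v * indicator {0..} v))"
  proof (rule nn_integral_mono_AE, rule AE_mp[OF AE_lborel_singleton[of 0]], rule AE_I2, rule impI)
    fix v :: real assume v0: "v \<noteq> 0"
    show "(\<integral>\<^sup>+z. ?i z v \<partial>\<mu>) \<le> ennreal (C * A * a powr (-1/2)) * (ennreal (v powr (-1/2)) * indicator {..<a} v * indicator {0..} v)"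
    proof (cases "0 < v \<and> v < a")
      case True
      define \<rho> where "\<rho> = (A\<^sup>2 / (a * v)) powr (1 / (2 * \<beta>))"
      have \<rho>: "0 < \<rho>" using A a True by (simp add: \<rho>_def)
      have "(\<integral>\<^sup>+z. ?i z v \<partial>\<mu>) \<le> (\<integral>\<^sup>+z. indicator (ball x \<rho>) z \<partial>\<mu>)"
      proof (rule nn_integral_mono)
        fix z
        have "dist x z < \<rho>" if "dist x z powr (2 * \<beta>) * (a * v) < A\<^sup>2"
        proof -
          have "dist x z powr (2 * \<beta>) < A\<^sup>2 / (a * v)"
            using that a True by (simp add: pos_less_divide_eq)
          then have "(dist x z powr (2 * \<beta>)) powr (1 / (2 * \<beta>)) < \<rho>"
            unfolding \<rho>_def using \<beta> by (intro powr_less_mono2) auto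
          then show ?thesis using \<beta> by (simp add: powr_powr)
        qed
        then show "?i z v \<le> indicator (ball x \<rho>) z"
          using True by simp
      qed
      also have "\<dots> = ennreal (measure \<mu> (ball x \<rho>))"
        by (subst nn_integral_indicator) (simp_all add: emeasure_eq_measure)
      also have "\<dots> \<le> ennreal (C * \<rho> powr \<beta>)"
        by (intro ennreal_leI growth \<rho>)
      also have "C * \<rho> powr \<beta> = C * A * a powr (-1/2) * v powr (-1/2)"
      proof -
        have "\<rho> powr \<beta> = (A\<^sup>2 / (a * v)) powr (1/2)"
          unfolding \<rho>_def using \<beta> by (simp add: powr_powr)
        also have "\<dots> = (A\<^sup>2) powr (1/2) * inverse ((a * v) powr (1/2))"
          by (simp add: powr_divide inverse_eq_divide)
        also have "(A\<^sup>2) powr (1/2) = A" using A by (simp add: powr_half_sqrt)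
        also have "inverse ((a * v) powr (1/2)) = (a * v) powr (-1/2)"
          by (metis minus_divide_left powr_minus)
        finally show ?thesis by (simp add: powr_mult)
      qed
      also have "ennreal (C * A * a powr (-1/2) * v powr (-1/2))
          = ennreal (C * A * a powr (-1/2)) * (ennreal (v powr (-1/2)) * indicator {..<a} v * indicator {0..} v)"
        using True A C by (subst ennreal_mult) auto
      finally show ?thesis .
    next
      case False
      then have z: "?i z v = 0" for z using v0 by auto
      show ?thesis unfolding z by simp
    qed
  qed
  also have "\<dots> = ennreal (C * A * a powr (-1/2)) * (\<integral>\<^sup>+v\<in>{0..}. ennreal (v powr (-1/2)) * indicator {..<a} v \<partial>lborel)"
    by (rule nn_integral_cmult) measurable
  also have "\<dots> \<le> ennreal (C * A * a powr (-1/2)) * ennreal (2 * sqrt a)"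
    by (intro mult_left_mono nn_integral_inv_sqrt_le a) simp
  also have "\<dots> = ennreal (C * A * a powr (-1/2) * (2 * sqrt a))"
    using A C a by (intro ennreal_mult[symmetric]) auto
  also have "C * A * a powr (-1/2) * (2 * sqrt a) = 2 * C * A"
  proof -
    have "a powr (-1/2) * a powr (1/2) = 1" using a by (simp flip: powr_add)
    then show ?thesis using a by (simp add: powr_half_sqrt mult_ac)
  qed
  finally show ?thesis .
qed

text \<open>
  Let \<open>n\<close> be the mass and \<open>A = n / (8 C)\<close>. In the square of the mass, pairs with \<open>D\<^sup>2\<^sup>\<beta> u(x) u(z) < A\<^sup>2\<close> contribute at most half, because
  for each \<open>x\<close> the points \<open>z\<close> with \<open>u(z) \<le> u(x)\<close> among them carry a mass of \<open>u\<close> of at most \<open>2 C A\<close>. For every other pair the power \<open>m - 2\<close> of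
  \<open>A\<close>, hence that of \<open>n\<close>, is bounded by \<open>D\<^sup>\<beta>\<^sup>(\<^sup>m\<^sup>-\<^sup>2\<^sup>) (u(x) u(z))\<^sup>(\<^sup>m\<^sup>-\<^sup>2\<^sup>)\<^sup>/\<^sup>2\<close>. The geometric mean of the two heights in
  the threshold is what makes the outcome symmetric.
\<close>

lemma power_of_mass_le_finite:
  fixes \<mu> :: "'a::euclidean_space measure" and u :: "'a \<Rightarrow> real"
  assumes \<mu>: "finite_measure \<mu>" and sets [measurable_cong]: "sets \<mu> = sets borel"
    and growth: "\<And>x \<delta>. 0 < \<delta> \<Longrightarrow> measure \<mu> (ball x \<delta>) \<le> C * \<delta> powr \<beta>"
    and C: "0 < C" and \<beta>: "0 < \<beta>" and m: "2 \<le> m"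
    and um [measurable]: "u \<in> borel_measurable borel" and u: "\<And>x. 0 \<le> u x"
    and fin: "(\<integral>\<^sup>+x. ennreal (u x) \<partial>\<mu>) < \<infinity>"
  shows "epow (\<integral>\<^sup>+x. ennreal (u x) \<partial>\<mu>) m \<le> ennreal (4 * (8 * C) powr (m - 2)) *
    (\<integral>\<^sup>+x. (\<integral>\<^sup>+z. ennreal (dist x z powr (\<beta> * (m - 2)) * (u x * u z) powr (m / 2)) \<partial>\<mu>) \<partial>\<mu>)"
proof (cases "(\<integral>\<^sup>+x. ennreal (u x) \<partial>\<mu>) = 0")
  case False
  interpret finite_measure \<mu> by fact
  interpret pair: pair_sigma_finite \<mu> \<mu> by standard
  let ?R = "\<lambda>x z. dist x z powr (\<beta> * (m - 2)) * (u x * u z) powr (m / 2)"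
  let ?I = "\<integral>\<^sup>+x. (\<integral>\<^sup>+z. ennreal (?R x z) \<partial>\<mu>) \<partial>\<mu>"
  obtain n where n: "(\<integral>\<^sup>+x. ennreal (u x) \<partial>\<mu>) = ennreal n" "0 < n"
    using fin False by (cases "\<integral>\<^sup>+x. ennreal (u x) \<partial>\<mu>") (auto simp: less_le)
  \<comment> \<open>The factor 8 makes \<open>2 C A n\<close> equal to a quarter of the square of \<open>n\<close>; the two orderings of a pair then absorb one half.\<close>
  let ?n = "\<integral>\<^sup>+x. ennreal (u x) \<partial>\<mu>"
  define A where "A = n / (8 * C)"
  have A: "0 < A" using n C by (simp add: A_def)
  let ?L = "\<lambda>x z. ennreal (if u z \<le> u x then u x * u z else 0)"
  let ?LL = "\<integral>\<^sup>+x. (\<integral>\<^sup>+z. ?L x z \<partial>\<mu>) \<partial>\<mu>"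
  let ?near = "\<lambda>x z. ennreal (if u z \<le> u x \<and> dist x z powr (2 * \<beta>) * (u x * u z) < A\<^sup>2 then u z else 0)"
  have L: "?LL \<le> ennreal (n\<^sup>2 / 4) + ennreal (A powr (2 - m)) * ?I"
  proof -
    have "?LL
        \<le> (\<integral>\<^sup>+x. (\<integral>\<^sup>+z. ennreal (u x) * ?near x z + ennreal (A powr (2 - m)) * ennreal (?R x z) \<partial>\<mu>) \<partial>\<mu>)"
    proof (intro nn_integral_mono)
      fix x z
      consider "\<not> u z \<le> u x \<or> u z = 0" | "u z \<le> u x" "dist x z powr (2 * \<beta>) * (u x * u z) < A\<^sup>2"
        | "u z \<le> u x" "0 < u z" "A\<^sup>2 \<le> dist x z powr (2 * \<beta>) * (u x * u z)"
        using u[of z] by fastforce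
      then show "?L x z \<le> ennreal (u x) * ?near x z + ennreal (A powr (2 - m)) * ennreal (?R x z)"
      proof cases
        case 1
        then have "?L x z = 0" by auto
        then show ?thesis by simp
      next
        case 2
        then have "?L x z = ennreal (u x) * ?near x z" using u by (simp add: ennreal_mult)
        then show ?thesis by simp
      next
        case 3
        have ux: "0 < u x" using 3 by linarith
        have "(A\<^sup>2) powr ((m - 2) / 2) \<le> (dist x z powr (2 * \<beta>) * (u x * u z)) powr ((m - 2) / 2)"
          using 3 m by (intro powr_mono2) auto
        moreover have "(A\<^sup>2) powr ((m - 2) / 2) = A powr (m - 2)"
        proof -
          have "(A\<^sup>2) powr ((m - 2) / 2) = (A powr 2) powr ((m - 2) / 2)" using A by simp
          also have "\<dots> = A powr (2 * ((m - 2) / 2))" by (rule powr_powr)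
          also have "2 * ((m - 2) / 2) = m - 2" by (simp add: field_simps)
          finally show ?thesis .
        qed
        moreover have "(dist x z powr (2 * \<beta>) * (u x * u z)) powr ((m - 2) / 2)
            = dist x z powr (\<beta> * (m - 2)) * (u x * u z) powr ((m - 2) / 2)"
          by (simp add: powr_mult[of "dist x z powr (2 * \<beta>)"] powr_powr)
        ultimately have "A powr (m - 2) \<le> dist x z powr (\<beta> * (m - 2)) * (u x * u z) powr ((m - 2) / 2)"
          by simp
        then have "A powr (m - 2) * (u x * u z) \<le> dist x z powr (\<beta> * (m - 2)) * (u x * u z) powr ((m - 2) / 2) * (u x * u z)"
          by (rule mult_right_mono) (simp add: u)
        also have "\<dots> = ?R x z"
        proof -
          have "(u x * u z) powr ((m - 2) / 2) * (u x * u z) = (u x * u z) powr (1 + (m - 2) / 2)"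
            using powr_mult_base[of "u x * u z" "(m - 2) / 2"] u by (simp add: mult.commute)
          also have "1 + (m - 2) / 2 = m / 2" by (simp add: field_simps)
          finally show ?thesis by (simp only: mult.assoc)
        qed
        finally have "A powr (2 - m) * (A powr (m - 2) * (u x * u z)) \<le> A powr (2 - m) * ?R x z"
          by (rule mult_left_mono) simp
        moreover have "A powr (2 - m) * A powr (m - 2) = 1"
          using A by (simp flip: powr_add)
        ultimately have "u x * u z \<le> A powr (2 - m) * ?R x z"
          by (metis mult.assoc mult_1)
        then have "ennreal (u x * u z) \<le> ennreal (A powr (2 - m) * ?R x z)"
          by (rule ennreal_leI)
        then have "?L x z \<le> ennreal (A powr (2 - m)) * ennreal (?R x z)"
          using 3 by (simp add: ennreal_mult u)
        then show ?thesis by (simp add: add_increasing)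
      qed
    qed
    also have "\<dots> = (\<integral>\<^sup>+x. ennreal (u x) * (\<integral>\<^sup>+z. ?near x z \<partial>\<mu>) \<partial>\<mu>) + ennreal (A powr (2 - m)) * ?I"
      by (simp add: nn_integral_add nn_integral_cmult)
    also have "(\<integral>\<^sup>+x. ennreal (u x) * (\<integral>\<^sup>+z. ?near x z \<partial>\<mu>) \<partial>\<mu>) \<le> (\<integral>\<^sup>+x. ennreal (u x) * ennreal (2 * C * A) \<partial>\<mu>)"
    proof (rule nn_integral_mono)
      fix x
      show "ennreal (u x) * (\<integral>\<^sup>+z. ?near x z \<partial>\<mu>) \<le> ennreal (u x) * ennreal (2 * C * A)"
      proof (cases "u x = 0")
        case False
        then have "0 < u x" using u[of x] by simp
        then show ?thesis
          by (intro mult_left_mono low_level_mass_le[OF \<mu> sets growth C \<beta> A _ um u]) auto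
      qed simp
    qed
    also have "\<dots> = ennreal n * ennreal (2 * C * A)"
      by (simp add: nn_integral_multc n)
    also have "\<dots> = ennreal (n\<^sup>2 / 4)"
      using n C by (simp add: A_def power2_eq_square flip: ennreal_mult)
    finally show ?thesis by (simp add: add_mono)
  qed
  have "ennreal (n\<^sup>2) = ?n * ?n"
    using n by (simp add: power2_eq_square ennreal_mult)
  also have "\<dots> = (\<integral>\<^sup>+x. (\<integral>\<^sup>+z. ennreal (u x) * ennreal (u z) \<partial>\<mu>) \<partial>\<mu>)"
    by (simp add: nn_integral_cmult nn_integral_multc)
  also have "\<dots> \<le> (\<integral>\<^sup>+x. (\<integral>\<^sup>+z. ?L x z + ?L z x \<partial>\<mu>) \<partial>\<mu>)"
    by (intro nn_integral_mono) (auto simp: u mult.commute simp flip: ennreal_mult)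
  also have "\<dots> = ?LL + (\<integral>\<^sup>+x. (\<integral>\<^sup>+z. ?L z x \<partial>\<mu>) \<partial>\<mu>)"
    by (simp add: nn_integral_add)
  also have "(\<integral>\<^sup>+x. (\<integral>\<^sup>+z. ?L z x \<partial>\<mu>) \<partial>\<mu>) = ?LL"
    by (rule pair.Fubini') measurable
  also have "?LL + ?LL
      \<le> (ennreal (n\<^sup>2 / 4) + ennreal (A powr (2 - m)) * ?I) + (ennreal (n\<^sup>2 / 4) + ennreal (A powr (2 - m)) * ?I)"
    by (intro add_mono L)
  finally have main: "ennreal (n\<^sup>2) \<le> 2 * (ennreal (n\<^sup>2 / 4) + ennreal (A powr (2 - m)) * ?I)"
    by (simp only: mult_2)
  show ?thesis
  proof (cases "?I")
    case (real i)
    have "2 * (ennreal (n\<^sup>2 / 4) + ennreal (A powr (2 - m)) * ?I) = ennreal (2 * (n\<^sup>2 / 4 + A powr (2 - m) * i))"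
    proof -
      have "2 * (ennreal a + ennreal b * ennreal i) = ennreal (2 * (a + b * i))"
        if "0 \<le> a" "0 \<le> b" for a b
        using that real(1) by (simp add: ennreal_mult)
      then show ?thesis unfolding real(2) by simp
    qed
    with main have "ennreal (n\<^sup>2) \<le> ennreal (2 * (n\<^sup>2 / 4 + A powr (2 - m) * i))"
      by (simp only:)
    then have "n\<^sup>2 \<le> 2 * (n\<^sup>2 / 4 + A powr (2 - m) * i)"
      by (rule ennreal_le_iff[THEN iffD1, rotated]) (use real(1) in auto)
    then have "n\<^sup>2 \<le> 4 * (A powr (2 - m) * i)" by simp
    then have "n powr (m - 2) * n\<^sup>2 \<le> n powr (m - 2) * (4 * (A powr (2 - m) * i))"
      by (rule mult_left_mono) simp
    moreover have "n powr (m - 2) * n\<^sup>2 = n powr m"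
      using n by (simp flip: powr_numeral powr_add)
    moreover have "n powr (m - 2) * A powr (2 - m) = (8 * C) powr (m - 2)"
    proof -
      have "A powr (2 - m) = inverse (A powr (m - 2))"
        by (metis minus_diff_eq powr_minus)
      moreover have "n = 8 * C * A" using C by (simp add: A_def)
      ultimately show ?thesis using A C by (simp add: powr_mult[of "8 * C" A])
    qed
    ultimately have "n powr m \<le> 4 * (8 * C) powr (m - 2) * i"
      by (simp add: mult_ac)
    then have "ennreal (n powr m) \<le> ennreal (4 * (8 * C) powr (m - 2) * i)"
      by (rule ennreal_leI)
    then show ?thesis
      unfolding n(1) real(2) using n(2) real(1) by (simp add: epow_ennreal ennreal_mult)
  next
    case top
    have "ennreal (4 * (8 * C) powr (m - 2)) \<noteq> 0" using C by simp
    then show ?thesis unfolding top by (simp add: ennreal_mult_top)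
  qed
qed simp

text \<open>
  The absorption argument needs a finite mass; truncation and monotone convergence remove that restriction.
\<close>

lemma power_of_mass_le:
  fixes \<mu> :: "'a::euclidean_space measure" and u :: "'a \<Rightarrow> real"
  assumes \<mu>: "finite_measure \<mu>" and sets [measurable_cong]: "sets \<mu> = sets borel"
    and growth: "\<And>x \<delta>. 0 < \<delta> \<Longrightarrow> measure \<mu> (ball x \<delta>) \<le> C * \<delta> powr \<beta>"
    and C: "0 < C" and \<beta>: "0 < \<beta>" and m: "2 \<le> m"
    and um [measurable]: "u \<in> borel_measurable borel" and u: "\<And>x. 0 \<le> u x"
  shows "epow (\<integral>\<^sup>+x. ennreal (u x) \<partial>\<mu>) m \<le> ennreal (4 * (8 * C) powr (m - 2)) *
    (\<integral>\<^sup>+x. (\<integral>\<^sup>+z. ennreal (dist x z powr (\<beta> * (m - 2)) * (u x * u z) powr (m / 2)) \<partial>\<mu>) \<partial>\<mu>)"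
    (is "_ \<le> ?KI")
proof -
  interpret finite_measure \<mu> by fact
  have trunc: "(\<integral>\<^sup>+x. ennreal (min (u x) (real n)) \<partial>\<mu>) \<le> epow ?KI (1 / m)" for n :: nat
  proof -
    let ?N = "\<integral>\<^sup>+x. ennreal (min (u x) (real n)) \<partial>\<mu>"
    have "?N \<le> (\<integral>\<^sup>+x. ennreal (real n) \<partial>\<mu>)"
      by (intro nn_integral_mono ennreal_leI) simp
    also have "\<dots> < \<infinity>" by (simp add: ennreal_mult_less_top emeasure_eq_measure)
    finally have "epow ?N m \<le> ennreal (4 * (8 * C) powr (m - 2)) *
      (\<integral>\<^sup>+x. (\<integral>\<^sup>+z. ennreal (dist x z powr (\<beta> * (m - 2)) * (min (u x) (real n) * min (u z) (real n)) powr (m / 2)) \<partial>\<mu>) \<partial>\<mu>)"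
      by (intro power_of_mass_le_finite[OF \<mu> sets growth C \<beta> m]) (auto simp: u)
    also have "\<dots> \<le> ?KI"
      using m by (intro mult_left_mono nn_integral_mono ennreal_leI powr_mono2 mult_mono) (auto simp: u)
    finally have "epow (epow ?N m) (1 / m) \<le> epow ?KI (1 / m)"
      using m by (intro epow_mono) auto
    then show ?thesis using m by (simp add: epow_epow)
  qed
  have "ennreal (u x) = (SUP n. ennreal (min (u x) (real n)))" for x
  proof (rule antisym)
    obtain n where "u x \<le> real n" using real_arch_simple by blast
    then show "ennreal (u x) \<le> (SUP n. ennreal (min (u x) (real n)))"
      by (intro SUP_upper2[of n]) (auto simp: min_def)
  qed (auto intro!: SUP_least ennreal_leI)
  then have "(\<integral>\<^sup>+x. ennreal (u x) \<partial>\<mu>) = (\<integral>\<^sup>+x. (SUP n. ennreal (min (u x) (real n))) \<partial>\<mu>)"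
    by simp
  also have "\<dots> = (SUP n. \<integral>\<^sup>+x. ennreal (min (u x) (real n)) \<partial>\<mu>)"
    by (rule nn_integral_monotone_convergence_SUP)
       (auto simp: incseq_def le_fun_def intro!: ennreal_leI)
  also have "\<dots> \<le> epow ?KI (1 / m)"
    by (intro SUP_least trunc)
  finally have "epow (\<integral>\<^sup>+x. ennreal (u x) \<partial>\<mu>) m \<le> epow (epow ?KI (1 / m)) m"
    using m by (intro epow_mono) auto
  then show ?thesis using m by (simp add: epow_epow)
qed

section \<open>Estimates for the adjoint operator\<close>

text \<open>
  The dual form of the endpoint estimate, raised to the power \<open>P'\<close>: \<open>g\<close> is the test function in \<open>(x, r)\<close>, and the transposed
  operator maps it to \<open>\<integral> g(x, |x - y|) d\<mu>(x)\<close>.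
\<close>

definition adjoint_bound ::
  "real \<Rightarrow> real \<Rightarrow> 'a::euclidean_space measure \<Rightarrow> real \<Rightarrow> real \<Rightarrow> real \<Rightarrow> real \<Rightarrow> bool" where
  "adjoint_bound r0 R0 \<mu> P' Q' S' K \<longleftrightarrow>
    (\<forall>g. case_prod g \<in> borel_measurable (borel \<Otimes>\<^sub>M borel) \<longrightarrow>
      (\<forall>x r. 0 \<le> g x r) \<longrightarrow> (\<forall>x r. r \<notin> {r0..R0} \<longrightarrow> g x r = 0) \<longrightarrow>
      (LBN y. epow (\<integral>\<^sup>+x. ennreal (g x (dist x y)) \<partial>\<mu>) P')
        \<le> ennreal K * epow (\<integral>\<^sup>+x. epow (LBN r. ennreal (g x r powr S')) (Q' / S') \<partial>\<mu>) (P' / Q'))"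

text \<open>
  Layer cake: the superlevel set of the kernel at a level \<open>v > 1\<close> lies in the ball of radius \<open>v\<^sup>-\<^sup>1\<^sup>/\<^sup>\<gamma>\<close>, and the power
  \<open>v\<^sup>-\<^sup>\<beta>\<^sup>/\<^sup>\<gamma>\<close> that bounds its measure is integrable because \<open>\<gamma> < \<beta>\<close>.
\<close>

lemma Riesz_potential_le:
  fixes \<mu> :: "'a::euclidean_space measure"
  assumes \<mu>: "prob_space \<mu>" and [measurable_cong]: "sets \<mu> = sets borel"
    and growth: "\<And>x \<delta>. 0 < \<delta> \<Longrightarrow> measure \<mu> (ball x \<delta>) \<le> C * \<delta> powr \<beta>"
    and \<gamma>: "0 < \<gamma>" "\<gamma> < \<beta>"
  shows "(\<integral>\<^sup>+z. ennreal (dist x z powr - \<gamma>) \<partial>\<mu>) \<le> ennreal (1 + \<bar>C\<bar> / (\<beta> / \<gamma> - 1))"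
proof -
  interpret prob_space \<mu> by fact
  interpret pair: pair_sigma_finite \<mu> "lborel :: real measure" by standard
  let ?i = "\<lambda>z v. if v < dist x z powr - \<gamma> then indicator {1<..} v else 0 :: ennreal"
  have "(\<integral>\<^sup>+z. ennreal (dist x z powr - \<gamma>) \<partial>\<mu>)
      \<le> (\<integral>\<^sup>+z. (LBN v. indicator {0..1} v + ?i z v) \<partial>\<mu>)"
  proof (rule nn_integral_mono)
    fix z
    have "ennreal (dist x z powr - \<gamma>) = (LBN v. indicator {0..<dist x z powr - \<gamma>} v)"
      by simp
    also have "\<dots> \<le> (LBN v. indicator {0..1} v + ?i z v)"
      by (intro nn_integral_mono) (auto simp: indicator_def)
    finally show "ennreal (dist x z powr - \<gamma>) \<le> (LBN v. indicator {0..1} v + ?i z v)" .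
  qed
  also have "\<dots> = 1 + (\<integral>\<^sup>+z. (LBN v. ?i z v) \<partial>\<mu>)"
    by (simp add: nn_integral_add emeasure_space_1)
  also have "(\<integral>\<^sup>+z. (LBN v. ?i z v) \<partial>\<mu>) = (LBN v. (\<integral>\<^sup>+z. ?i z v \<partial>\<mu>))"
    by (rule pair.Fubini'[symmetric]) measurable
  also have "\<dots> \<le> (LBN v. ennreal \<bar>C\<bar> * (ennreal (v powr (- 1 - (\<beta> / \<gamma> - 1))) * indicator {1<..} v))"
  proof (rule nn_integral_mono)
    fix v :: real
    show "(\<integral>\<^sup>+z. ?i z v \<partial>\<mu>) \<le> ennreal \<bar>C\<bar> * (ennreal (v powr (- 1 - (\<beta> / \<gamma> - 1))) * indicator {1<..} v)"
    proof (cases "1 < v")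
      case True
      define \<rho> where "\<rho> = v powr (- (1 / \<gamma>))"
      have \<rho>: "0 < \<rho>" using True by (simp add: \<rho>_def)
      have "(\<integral>\<^sup>+z. ?i z v \<partial>\<mu>) \<le> (\<integral>\<^sup>+z. indicator (ball x \<rho>) z \<partial>\<mu>)"
      proof (rule nn_integral_mono)
        fix z
        have "dist x z < \<rho>" if v: "v < dist x z powr - \<gamma>"
        proof -
          have d: "0 < dist x z"
          proof (rule ccontr)
            assume "\<not> 0 < dist x z"
            then have "dist x z = 0" by simp
            with v True show False by simp
          qed
          have "(dist x z powr - \<gamma>) powr (- (1 / \<gamma>)) < v powr (- (1 / \<gamma>))"
            using v True \<gamma> by (intro powr_less_mono2_neg) auto
          then show ?thesis using \<gamma> d by (simp add: powr_powr \<rho>_def)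
        qed
        then show "?i z v \<le> indicator (ball x \<rho>) z" by (simp add: indicator_def)
      qed
      also have "\<dots> = ennreal (measure \<mu> (ball x \<rho>))"
        by (subst nn_integral_indicator) (simp_all add: emeasure_eq_measure)
      also have "measure \<mu> (ball x \<rho>) \<le> \<bar>C\<bar> * \<rho> powr \<beta>"
        by (rule order_trans[OF growth[OF \<rho>]]) (simp add: mult_right_mono)
      also have "\<rho> powr \<beta> = v powr (- 1 - (\<beta> / \<gamma> - 1))"
        by (simp add: \<rho>_def powr_powr)
      finally have "(\<integral>\<^sup>+z. ?i z v \<partial>\<mu>) \<le> ennreal (\<bar>C\<bar> * v powr (- 1 - (\<beta> / \<gamma> - 1)))"
        by (simp add: ennreal_leI)
      also have "\<dots> = ennreal \<bar>C\<bar> * (ennreal (v powr (- 1 - (\<beta> / \<gamma> - 1))) * indicator {1<..} v)"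
        using True by (simp add: ennreal_mult)
      finally show ?thesis .
    next
      case False
      then have z: "?i z v = 0" for z by simp
      show ?thesis unfolding z by simp
    qed
  qed
  also have "\<dots> = ennreal \<bar>C\<bar> * ennreal (1 powr - (\<beta> / \<gamma> - 1) / (\<beta> / \<gamma> - 1))"
    using \<gamma> by (subst nn_integral_cmult) (simp_all add: nn_integral_powr_atLeast[of 1 "\<beta> / \<gamma> - 1", simplified])
  also have "1 + ennreal \<bar>C\<bar> * ennreal (1 powr - (\<beta> / \<gamma> - 1) / (\<beta> / \<gamma> - 1)) = ennreal (1 + \<bar>C\<bar> / (\<beta> / \<gamma> - 1))"
    using \<gamma> by (simp add: ennreal_mult[symmetric])
  finally show ?thesis by (simp add: add_left_mono)
qed

text \<open>
  Apply \<open>power_of_mass_le\<close> for each \<open>y\<close> with the exponent \<open>M = 1 + \<kappa>/\<alpha>\<close>, integrate in \<open>y\<close> and use the pair estimate for the power \<open>M/2\<close> of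
  \<open>g\<close>. What remains is the kernel \<open>D\<^sup>-\<^sup>\<gamma>\<close> with \<open>\<gamma> = \<kappa> - \<beta> (M - 2)\<close>, and \<open>\<gamma> < \<beta>\<close> is equivalent to \<open>\<alpha> < \<beta>\<close>. The
  assumption that \<open>\<gamma>\<close> is positive holds as soon as \<open>\<beta>\<close> is close to \<open>\<alpha>\<close>.
\<close>

lemma adjoint_bound_ball_growth:
  fixes \<mu> :: "'a::euclidean_space measure"
  assumes \<mu>: "prob_space \<mu>" and sets [measurable_cong]: "sets \<mu> = sets borel"
    and growth: "\<And>x \<delta>. 0 < \<delta> \<Longrightarrow> measure \<mu> (ball x \<delta>) \<le> C * \<delta> powr \<beta>" and C: "0 < C"
    and \<alpha>: "0 < \<alpha>" "\<alpha> < \<kappa>" "\<alpha> < \<beta>" and small: "0 < \<kappa> - \<beta> * (\<kappa> / \<alpha> - 1)" and m: "0 < m"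
    and pair: "annular_pair_bound TYPE('a) r0 R0 \<kappa> m K" and K: "0 \<le> K"
  shows "adjoint_bound r0 R0 \<mu> (1 + \<kappa> / \<alpha>) (1 + \<kappa> / \<alpha>) ((1 + \<kappa> / \<alpha>) * m / 2)
    (4 * (8 * C) powr (\<kappa> / \<alpha> - 1) * K * (2 * (1 + \<bar>C\<bar> / (\<beta> / (\<kappa> - \<beta> * (\<kappa> / \<alpha> - 1)) - 1))))"
  unfolding adjoint_bound_def
proof (intro allI impI)
  fix g :: "'a \<Rightarrow> real \<Rightarrow> real"
  assume [measurable]: "case_prod g \<in> borel_measurable (borel \<Otimes>\<^sub>M borel)"
    and pos: "\<forall>x r. 0 \<le> g x r" and supp: "\<forall>x r. r \<notin> {r0..R0} \<longrightarrow> g x r = 0"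
  interpret prob_space \<mu> by fact
  interpret pair: pair_sigma_finite \<mu> \<mu> by standard
  interpret pair': pair_sigma_finite \<mu> "lborel :: 'a measure" by standard
  define M where "M = 1 + \<kappa> / \<alpha>"
  define \<gamma> where "\<gamma> = \<kappa> - \<beta> * (\<kappa> / \<alpha> - 1)"
  have M: "2 < M" "M - 2 = \<kappa> / \<alpha> - 1" using \<alpha> by (simp_all add: M_def)
  have \<beta>: "0 < \<beta>" using \<alpha> by simp
  have "\<kappa> < \<beta> * (\<kappa> / \<alpha>)"
    using \<alpha> by (simp add: field_simps)
  then have \<gamma>: "0 < \<gamma>" "\<gamma> < \<beta>"
    using small by (simp_all add: \<gamma>_def right_diff_distrib)
  define c where "c = 1 + \<bar>C\<bar> / (\<beta> / \<gamma> - 1)"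
  have "0 < \<beta> / \<gamma> - 1" using \<gamma> by simp
  then have c: "0 \<le> c" by (simp add: c_def)
  define G where "G x r = g x r powr (M / 2)" for x r
  have [measurable]: "case_prod G \<in> borel_measurable (borel \<Otimes>\<^sub>M borel)" unfolding G_def by measurable
  define \<Gamma> where "\<Gamma> x = epow (LBN r. ennreal (G x r powr m)) (1 / m)" for x
  have [measurable]: "\<Gamma> \<in> borel_measurable borel" unfolding \<Gamma>_def by measurable
  let ?e = "\<beta> * (M - 2)"
  let ?K1 = "ennreal (4 * (8 * C) powr (M - 2))"
  let ?h = "\<lambda>x z y. ennreal (dist x z powr ?e) * ennreal (G x (dist x y) * G z (dist z y))"
  let ?pot = "\<integral>\<^sup>+x. (\<integral>\<^sup>+z. ennreal (dist x z powr - \<gamma>) * (\<Gamma> x * \<Gamma> x) \<partial>\<mu>) \<partial>\<mu>"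
  let ?sq = "\<integral>\<^sup>+x. \<Gamma> x * \<Gamma> x \<partial>\<mu>"
  let ?rhs = "\<integral>\<^sup>+x. epow (LBN r. ennreal (g x r powr (M * m / 2))) (M / (M * m / 2)) \<partial>\<mu>"
  have "(LBN y. epow (\<integral>\<^sup>+x. ennreal (g x (dist x y)) \<partial>\<mu>) M)
      \<le> (LBN y. ?K1 * (\<integral>\<^sup>+x. (\<integral>\<^sup>+z. ?h x z y \<partial>\<mu>) \<partial>\<mu>))"
  proof (rule nn_integral_mono)
    fix y
    have "epow (\<integral>\<^sup>+x. ennreal (g x (dist x y)) \<partial>\<mu>) M
        \<le> ?K1 * (\<integral>\<^sup>+x. (\<integral>\<^sup>+z. ennreal (dist x z powr ?e * (g x (dist x y) * g z (dist z y)) powr (M / 2)) \<partial>\<mu>) \<partial>\<mu>)"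
      using M pos by (intro power_of_mass_le[OF _ sets growth C \<beta>]) (simp_all add: finite_measure_axioms)
    then show "epow (\<integral>\<^sup>+x. ennreal (g x (dist x y)) \<partial>\<mu>) M
        \<le> ?K1 * (\<integral>\<^sup>+x. (\<integral>\<^sup>+z. ?h x z y \<partial>\<mu>) \<partial>\<mu>)"
      by (simp add: G_def powr_mult ennreal_mult)
  qed
  also have "\<dots> = ?K1 * (LBN y. (\<integral>\<^sup>+x. (\<integral>\<^sup>+z. ?h x z y \<partial>\<mu>) \<partial>\<mu>))"
    by (rule nn_integral_cmult) measurable
  also have "(LBN y. (\<integral>\<^sup>+x. (\<integral>\<^sup>+z. ?h x z y \<partial>\<mu>) \<partial>\<mu>))
      = (\<integral>\<^sup>+x. (LBN y. (\<integral>\<^sup>+z. ?h x z y \<partial>\<mu>)) \<partial>\<mu>)"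
    by (rule pair'.Fubini') measurable
  also have "\<dots> = (\<integral>\<^sup>+x. (\<integral>\<^sup>+z. (LBN y. ?h x z y) \<partial>\<mu>) \<partial>\<mu>)"
    by (intro nn_integral_cong pair'.Fubini') measurable
  also have "\<dots> \<le> (\<integral>\<^sup>+x. (\<integral>\<^sup>+z. ennreal K * (ennreal (dist x z powr - \<gamma>) * (\<Gamma> x * \<Gamma> x + \<Gamma> z * \<Gamma> z)) \<partial>\<mu>) \<partial>\<mu>)"
  proof (intro nn_integral_mono)
    fix x z
    have "(LBN y. ?h x z y)
        = ennreal (dist x z powr ?e) * (LBN y. ennreal (G x (dist x y) * G z (dist z y)))"
      by (rule nn_integral_cmult) measurable
    also have "\<dots> \<le> ennreal K * (ennreal (dist x z powr - \<gamma>) * (\<Gamma> x * \<Gamma> z))"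
    \<comment> \<open>On the diagonal both sides vanish, since \<open>0 powr a = 0\<close> for every \<open>a\<close>.\<close>
    proof (cases "x = z")
      case False
      have "(LBN y. ennreal (G x (dist x y) * G z (dist z y)))
          \<le> ennreal (K * dist x z powr - \<kappa>) * (\<Gamma> x * \<Gamma> z)"
        unfolding \<Gamma>_def using pair[unfolded annular_pair_bound_def, rule_format, OF False, of "G x" "G z"] supp
        by (simp add: G_def)
      then have "ennreal (dist x z powr ?e) * (LBN y. ennreal (G x (dist x y) * G z (dist z y)))
          \<le> ennreal (dist x z powr ?e) * (ennreal (K * dist x z powr - \<kappa>) * (\<Gamma> x * \<Gamma> z))"
        by (rule mult_left_mono) simp
      also have "\<dots> = (ennreal (dist x z powr ?e) * ennreal (K * dist x z powr - \<kappa>)) * (\<Gamma> x * \<Gamma> z)"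
        by (simp only: mult.assoc)
      also have "ennreal (dist x z powr ?e) * ennreal (K * dist x z powr - \<kappa>) = ennreal (K * (dist x z powr ?e * dist x z powr - \<kappa>))"
        using K by (simp add: mult_ac flip: ennreal_mult)
      also have "dist x z powr ?e * dist x z powr - \<kappa> = dist x z powr - \<gamma>"
        by (simp add: \<gamma>_def M flip: powr_add)
      also have "ennreal (K * dist x z powr - \<gamma>) = ennreal K * ennreal (dist x z powr - \<gamma>)"
        using K by (rule ennreal_mult) simp
      finally show ?thesis by (simp only: mult.assoc)
    qed simp
    also have "\<dots> \<le> ennreal K * (ennreal (dist x z powr - \<gamma>) * (\<Gamma> x * \<Gamma> x + \<Gamma> z * \<Gamma> z))"
    proof (intro mult_left_mono)
      show "\<Gamma> x * \<Gamma> z \<le> \<Gamma> x * \<Gamma> x + \<Gamma> z * \<Gamma> z"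
      proof (cases "\<Gamma> x \<le> \<Gamma> z")
        case True
        then have "\<Gamma> x * \<Gamma> z \<le> \<Gamma> z * \<Gamma> z" by (rule mult_right_mono) simp
        then show ?thesis by (simp add: add_increasing)
      next
        case False
        then have "\<Gamma> x * \<Gamma> z \<le> \<Gamma> x * \<Gamma> x" by (intro mult_left_mono) auto
        then show ?thesis by (simp add: add_increasing2)
      qed
    qed simp_all
    finally show "(LBN y. ?h x z y)
        \<le> ennreal K * (ennreal (dist x z powr - \<gamma>) * (\<Gamma> x * \<Gamma> x + \<Gamma> z * \<Gamma> z))" .
  qed
  also have "\<dots> = ennreal K * (?pot
      + (\<integral>\<^sup>+x. (\<integral>\<^sup>+z. ennreal (dist x z powr - \<gamma>) * (\<Gamma> z * \<Gamma> z) \<partial>\<mu>) \<partial>\<mu>))"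
    by (simp add: nn_integral_cmult nn_integral_add distrib_left)
  also have "(\<integral>\<^sup>+x. (\<integral>\<^sup>+z. ennreal (dist x z powr - \<gamma>) * (\<Gamma> z * \<Gamma> z) \<partial>\<mu>) \<partial>\<mu>)
      = (\<integral>\<^sup>+x. (\<integral>\<^sup>+z. ennreal (dist z x powr - \<gamma>) * (\<Gamma> x * \<Gamma> x) \<partial>\<mu>) \<partial>\<mu>)"
    by (rule pair.Fubini') measurable
  also have "(\<lambda>x. \<integral>\<^sup>+z. ennreal (dist z x powr - \<gamma>) * (\<Gamma> x * \<Gamma> x) \<partial>\<mu>)
      = (\<lambda>x. \<integral>\<^sup>+z. ennreal (dist x z powr - \<gamma>) * (\<Gamma> x * \<Gamma> x) \<partial>\<mu>)"
    by (simp add: dist_commute)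
  also have "ennreal K * (?pot
      + ?pot)
      \<le> ennreal K * (ennreal (2 * c) * ?sq)"
  proof (intro mult_left_mono)
    have "?pot
        = (\<integral>\<^sup>+x. (\<integral>\<^sup>+z. ennreal (dist x z powr - \<gamma>) \<partial>\<mu>) * (\<Gamma> x * \<Gamma> x) \<partial>\<mu>)"
      by (simp add: nn_integral_multc)
    also have "\<dots> \<le> (\<integral>\<^sup>+x. ennreal c * (\<Gamma> x * \<Gamma> x) \<partial>\<mu>)"
      unfolding c_def using \<gamma> by (intro nn_integral_mono mult_right_mono Riesz_potential_le[OF \<mu> sets growth]) auto
    also have "\<dots> = ennreal c * ?sq"
      by (rule nn_integral_cmult) measurable
    finally have le: "?pot \<le> ennreal c * ?sq" .
    have "ennreal (2 * c) * ?sq = ennreal c * ?sq + ennreal c * ?sq"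
    proof -
      have "ennreal (2 * c) = ennreal c + ennreal c" using c by (simp flip: ennreal_plus)
      then show ?thesis by (simp only: distrib_right)
    qed
    then show "?pot
      + ?pot \<le> ennreal (2 * c) * ?sq"
      by (simp only: add_mono le)
  qed simp
  also have "?sq = ?rhs"
  proof -
    have "M \<noteq> 0" using M by linarith
    then show ?thesis by (simp add: \<Gamma>_def epow_add G_def powr_powr)
  qed
  also have "?K1 * (ennreal K * (ennreal (2 * c) * ?rhs))
      = (?K1 * ennreal K * ennreal (2 * c)) * ?rhs"
    by (simp only: mult.assoc)
  also have "?K1 * ennreal K * ennreal (2 * c) = ennreal (4 * (8 * C) powr (M - 2) * K * (2 * c))"
  proof -
    have triple: "ennreal a * ennreal b * ennreal d = ennreal (a * b * d)" if "0 \<le> a" "0 \<le> b" "0 \<le> d" for a b d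
      using that by (simp add: ennreal_mult)
    show ?thesis by (rule triple) (use K c in simp_all)
  qed
  finally show "(LBN y. epow (\<integral>\<^sup>+x. ennreal (g x (dist x y)) \<partial>\<mu>) (1 + \<kappa> / \<alpha>))
      \<le> ennreal (4 * (8 * C) powr (\<kappa> / \<alpha> - 1) * K * (2 * (1 + \<bar>C\<bar> / (\<beta> / (\<kappa> - \<beta> * (\<kappa> / \<alpha> - 1)) - 1)))) *
        epow (\<integral>\<^sup>+x. epow (LBN r. ennreal (g x r powr ((1 + \<kappa> / \<alpha>) * m / 2)))
          ((1 + \<kappa> / \<alpha>) / ((1 + \<kappa> / \<alpha>) * m / 2)) \<partial>\<mu>) ((1 + \<kappa> / \<alpha>) / (1 + \<kappa> / \<alpha>))"
    using M by (simp add: M(2) c_def \<gamma>_def mult_left_mono flip: M_def)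
qed

text \<open>
  Expand the square, use the pair estimate and split the kernel \<open>D\<^sup>-\<^sup>1\<^sup>/\<^sup>2\<close> off as the power
  \<open>1 / (2 \<alpha>)\<close> of the energy kernel. The complementary Hoelder exponent is \<open>Q = 2 \<alpha> / (2 \<alpha> - 1)\<close>. The pair estimate says nothing
  on the diagonal, which is a null set because the energy is finite.
\<close>

lemma adjoint_bound_energy:
  fixes \<mu> :: "'a::euclidean_space measure"
  assumes \<mu>: "prob_space \<mu>" and sets [measurable_cong]: "sets \<mu> = sets borel"
    and energy: "energy \<alpha> \<mu> \<le> ennreal C" and \<alpha>: "1/2 < \<alpha>"
    and pair: "annular_pair_bound TYPE('a) r0 R0 (1/2) (4/3) K" and K: "0 \<le> K"
  shows "adjoint_bound r0 R0 \<mu> 2 (2 * \<alpha> / (2 * \<alpha> - 1)) (4/3) (K * max 0 C powr (1 / (2 * \<alpha>)))"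
  unfolding adjoint_bound_def
proof (intro allI impI)
  fix g :: "'a \<Rightarrow> real \<Rightarrow> real"
  assume [measurable]: "case_prod g \<in> borel_measurable (borel \<Otimes>\<^sub>M borel)"
    and pos: "\<forall>x r. 0 \<le> g x r" and supp: "\<forall>x r. r \<notin> {r0..R0} \<longrightarrow> g x r = 0"
  interpret prob_space \<mu> by fact
  interpret pair: pair_sigma_finite \<mu> \<mu> by standard
  interpret pair': pair_sigma_finite \<mu> "lborel :: 'a measure" by standard
  define Q where "Q = 2 * \<alpha> / (2 * \<alpha> - 1)"
  define a where "a = 1 / (2 * \<alpha>)"
  have a: "0 < a" "a < 1" using \<alpha> by (simp_all add: a_def)
  have Q: "0 < Q" "1 - a = 1 / Q" using \<alpha> by (simp_all add: Q_def a_def field_simps)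
  define \<Gamma> where "\<Gamma> x = epow (LBN r. ennreal (g x r powr (4/3))) (3/4)" for x
  have [measurable]: "\<Gamma> \<in> borel_measurable borel" unfolding \<Gamma>_def by measurable
  define k where "k x z = 1 / ennreal (norm (x - z) powr \<alpha>)" for x z :: 'a
  have [measurable]: "case_prod k \<in> borel_measurable (borel \<Otimes>\<^sub>M borel)" unfolding k_def by measurable
  let ?E = "\<integral>\<^sup>+x. (\<integral>\<^sup>+z. k x z \<partial>\<mu>) \<partial>\<mu>"
  let ?\<Gamma>Q = "\<integral>\<^sup>+x. epow (\<Gamma> x) Q \<partial>\<mu>"
  let ?rhs = "\<integral>\<^sup>+x. epow (LBN r. ennreal (g x r powr (4/3))) (Q / (4/3)) \<partial>\<mu>"
  let ?gg = "\<lambda>x z y. ennreal (g x (dist x y) * g z (dist z y))"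
  have energy_k: "?E \<le> ennreal C"
    using energy by (simp add: energy_def k_def)
  then have "?E \<noteq> \<infinity>"
    using ennreal_less_top by (metis infinity_ennreal_def leD)
  then have "AE x in \<mu>. (\<integral>\<^sup>+z. k x z \<partial>\<mu>) \<noteq> \<infinity>"
    by (intro nn_integral_PInf_AE) auto
  then have diag: "AE x in \<mu>. AE z in \<mu>. x \<noteq> z"
  proof eventually_elim
    case (elim x)
    then have "AE z in \<mu>. k x z \<noteq> \<infinity>"
      by (intro nn_integral_PInf_AE) auto
    then show ?case
    proof eventually_elim
      case (elim z)
      then show ?case by (auto simp: k_def)
    qed
  qed
  let ?N = "\<lambda>y. \<integral>\<^sup>+x. ennreal (g x (dist x y)) \<partial>\<mu>"
  have "(LBN y. epow (?N y) 2)
      = (LBN y. (\<integral>\<^sup>+x. (\<integral>\<^sup>+z. ?gg x z y \<partial>\<mu>) \<partial>\<mu>))"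
  proof (rule nn_integral_cong)
    fix y
    have "epow (?N y) 2 = ?N y * ?N y"
      using epow_add[of "?N y" 1 1] by simp
    also have "\<dots> = (\<integral>\<^sup>+x. (\<integral>\<^sup>+z. ennreal (g x (dist x y)) * ennreal (g z (dist z y)) \<partial>\<mu>) \<partial>\<mu>)"
      by (simp add: nn_integral_cmult nn_integral_multc)
    finally show "epow (?N y) 2 = (\<integral>\<^sup>+x. (\<integral>\<^sup>+z. ?gg x z y \<partial>\<mu>) \<partial>\<mu>)"
      using pos by (simp add: ennreal_mult)
  qed
  also have "\<dots> = (\<integral>\<^sup>+x. (LBN y. (\<integral>\<^sup>+z. ?gg x z y \<partial>\<mu>)) \<partial>\<mu>)"
    by (rule pair'.Fubini') measurable
  also have "\<dots> = (\<integral>\<^sup>+x. (\<integral>\<^sup>+z. (LBN y. ?gg x z y) \<partial>\<mu>) \<partial>\<mu>)"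
    by (intro nn_integral_cong pair'.Fubini') measurable
  also have "\<dots> \<le> (\<integral>\<^sup>+x. (\<integral>\<^sup>+z. ennreal K * (epow (k x z) a * epow (epow (\<Gamma> x * \<Gamma> z) Q) (1 - a)) \<partial>\<mu>) \<partial>\<mu>)"
  proof (rule nn_integral_mono_AE)
    show "AE x in \<mu>. (\<integral>\<^sup>+z. (LBN y. ?gg x z y) \<partial>\<mu>)
      \<le> (\<integral>\<^sup>+z. ennreal K * (epow (k x z) a * epow (epow (\<Gamma> x * \<Gamma> z) Q) (1 - a)) \<partial>\<mu>)"
      using diag
    proof eventually_elim
      case (elim x)
      show ?case
      proof (rule nn_integral_mono_AE)
        show "AE z in \<mu>. (LBN y. ?gg x z y)
            \<le> ennreal K * (epow (k x z) a * epow (epow (\<Gamma> x * \<Gamma> z) Q) (1 - a))"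
          using elim
        proof eventually_elim
          case (elim z)
          have "(LBN y. ?gg x z y)
              \<le> ennreal (K * dist x z powr - (1/2)) * (\<Gamma> x * \<Gamma> z)"
            unfolding \<Gamma>_def using pair[unfolded annular_pair_bound_def, rule_format, OF elim, of "g x" "g z"] supp pos
            by simp
          also have "ennreal (K * dist x z powr - (1/2)) = ennreal K * epow (k x z) a"
          proof -
            have d: "0 < norm (x - z)" using elim by simp
            have "k x z = ennreal (1 / norm (x - z) powr \<alpha>)"
              using d by (simp add: k_def divide_ennreal flip: ennreal_1)
            then have "epow (k x z) a = ennreal ((1 / norm (x - z) powr \<alpha>) powr a)"
              by (simp add: epow_ennreal)
            also have "(1 / norm (x - z) powr \<alpha>) powr a = dist x z powr - (1/2)"
              using \<alpha> by (simp add: powr_divide powr_powr a_def dist_norm powr_minus_divide)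
            finally show ?thesis using K by (simp add: ennreal_mult)
          qed
          finally show ?case
            using Q by (simp add: epow_epow mult.assoc)
        qed
      qed
    qed
  qed
  also have "\<dots> = ennreal K * (\<integral>\<^sup>+x. (\<integral>\<^sup>+z. epow (k x z) a * epow (epow (\<Gamma> x * \<Gamma> z) Q) (1 - a) \<partial>\<mu>) \<partial>\<mu>)"
    by (simp add: nn_integral_cmult)
  also have "(\<integral>\<^sup>+x. (\<integral>\<^sup>+z. epow (k x z) a * epow (epow (\<Gamma> x * \<Gamma> z) Q) (1 - a) \<partial>\<mu>) \<partial>\<mu>)
      = (\<integral>\<^sup>+w. epow (k (fst w) (snd w)) a * epow (epow (\<Gamma> (fst w) * \<Gamma> (snd w)) Q) (1 - a) \<partial>(\<mu> \<Otimes>\<^sub>M \<mu>))"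
    by (subst nn_integral_fst[symmetric]) simp_all
  also have "\<dots> \<le> epow (\<integral>\<^sup>+w. k (fst w) (snd w) \<partial>(\<mu> \<Otimes>\<^sub>M \<mu>)) a
      * epow (\<integral>\<^sup>+w. epow (\<Gamma> (fst w) * \<Gamma> (snd w)) Q \<partial>(\<mu> \<Otimes>\<^sub>M \<mu>)) (1 - a)"
    by (rule nn_integral_Holder) (use a in measurable)
  also have "(\<integral>\<^sup>+w. k (fst w) (snd w) \<partial>(\<mu> \<Otimes>\<^sub>M \<mu>)) = ?E"
    by (subst nn_integral_fst[symmetric]) simp_all
  also have "(\<integral>\<^sup>+w. epow (\<Gamma> (fst w) * \<Gamma> (snd w)) Q \<partial>(\<mu> \<Otimes>\<^sub>M \<mu>)) = ?\<Gamma>Q * ?\<Gamma>Q"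
    by (subst nn_integral_fst[symmetric]) (simp_all add: epow_mult nn_integral_cmult nn_integral_multc)
  also have "epow (?\<Gamma>Q * ?\<Gamma>Q) (1 - a) = epow ?\<Gamma>Q (2 / Q)"
    by (simp add: epow_mult epow_add Q)
  also have "?\<Gamma>Q = ?rhs"
    by (simp add: \<Gamma>_def epow_epow mult.commute)
  also have "ennreal K * (epow ?E a
        * epow ?rhs (2 / Q))
      \<le> ennreal K * (ennreal (max 0 C powr a)
        * epow ?rhs (2 / Q))"
  proof (intro mult_left_mono mult_right_mono)
    have "epow ?E a \<le> epow (ennreal (max 0 C)) a"
      using a energy_k by (intro epow_mono) (auto simp: max_def ennreal_neg)
    then show "epow ?E a \<le> ennreal (max 0 C powr a)"
      by (simp add: epow_ennreal)
  qed simp_all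
  finally have "(LBN y. epow (?N y) 2) \<le> ennreal K * (ennreal (max 0 C powr a)
        * epow ?rhs (2 / Q))"
    by (simp add: mult_left_mono)
  then show "(LBN y. epow (?N y) 2)
      \<le> ennreal (K * max 0 C powr (1 / (2 * \<alpha>))) *
        epow (\<integral>\<^sup>+x. epow (LBN r. ennreal (g x r powr (4/3))) (2 * \<alpha> / (2 * \<alpha> - 1) / (4/3)) \<partial>\<mu>)
          (2 / (2 * \<alpha> / (2 * \<alpha> - 1)))"
    using K by (simp only: ennreal_mult powr_ge_zero mult.assoc Q_def[symmetric] a_def[symmetric])
qed

section \<open>Duality and interpolation for positive operators\<close>

lemma borel_measurable_restrict_lborel [measurable (raw)]:
  "f \<in> borel_measurable borel \<Longrightarrow> f \<in> borel_measurable (restrict_space lborel {a..b::real})"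
  by (rule measurable_restrict_space1) simp

text \<open>
  The constant \<open>K\<close> is the same for all bounds \<open>B\<close>. Boundedness of \<open>\<phi>\<close> makes the left-hand side finite, as required for the
  cancellation in the duality argument.
\<close>

definition mixed_bound ::
  "real \<Rightarrow> real \<Rightarrow> 'a::euclidean_space measure \<Rightarrow> real \<Rightarrow> real \<Rightarrow> real \<Rightarrow> real \<Rightarrow> bool" where
  "mixed_bound r0 R0 \<mu> p q s K \<longleftrightarrow>
    (\<forall>\<phi> B. \<phi> \<in> borel_measurable borel \<longrightarrow> (\<forall>y. \<phi> y \<le> ennreal B) \<longrightarrow>
      epow (\<integral>\<^sup>+x. epow (\<integral>\<^sup>+r. epow (sph_avg \<phi> x r) s \<partial>restrict_space lborel {r0..R0}) (q / s) \<partial>\<mu>) (1 / q)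
        \<le> ennreal K * epow (LBN y. epow (\<phi> y) p) (1 / p))"

lemma sph_avg_bounded:
  fixes \<phi> :: "'a::euclidean_space \<Rightarrow> ennreal"
  assumes "\<And>y. \<phi> y \<le> ennreal B"
  obtains b where "0 \<le> b" "\<And>x r. sph_avg \<phi> x r \<le> ennreal b"
proof -
  interpret sphere: finite_measure "sphere_measure :: 'a measure"
    by (rule finite_sphere_measure)
  let ?b = "\<bar>B\<bar> * measure (sphere_measure :: 'a measure) (sphere 0 1)"
  have "sph_avg \<phi> x r \<le> ennreal ?b" for x r
  proof -
    have "sph_avg \<phi> x r \<le> (\<integral>\<^sup>+\<sigma>. ennreal \<bar>B\<bar> \<partial>(sphere_measure :: 'a measure))"
      unfolding sph_avg_def
      by (intro nn_integral_mono order_trans[OF assms] ennreal_leI) simp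
    also have "\<dots> = ennreal ?b"
      by (simp add: sphere.emeasure_eq_measure ennreal_mult)
    finally show ?thesis .
  qed
  then show thesis by (intro that[of ?b]) simp_all
qed

text \<open>
  Test the adjoint estimate on the function \<open>g\<close> that is extremal for the mixed norm of \<open>A \<phi>\<close>: with \<open>V(x)\<close> the integral of
  \<open>(A \<phi>)\<^sup>S\<close> over \<open>r\<close>, it is \<open>(A \<phi>)\<^sup>S\<^sup>-\<^sup>1\<close> times the power \<open>Q/S - 1\<close> of \<open>V\<close>. Then the pairing of \<open>A \<phi>\<close> with \<open>g\<close> and the dual mixed
  norm of \<open>g\<close> are both powers of the same finite number \<open>W\<close>, which can be cancelled.
\<close>

lemma mixed_bound_from_adjoint:
  fixes \<mu> :: "'a::euclidean_space measure"
  assumes \<mu>: "prob_space \<mu>" and sets [measurable_cong]: "sets \<mu> = sets borel"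
    and r0: "0 < r0" and exps: "1 < P" "1 < Q" "1 < S"
    and conj: "1 / P' = 1 - 1 / P" "1 / Q' = 1 - 1 / Q" "1 / S' = 1 - 1 / S"
    and adj: "adjoint_bound r0 R0 \<mu> P' Q' S' K" and K: "0 \<le> K"
  shows "mixed_bound r0 R0 \<mu> P Q S (r0 powr (1 - real DIM('a)) * K powr (1 / P'))"
  unfolding mixed_bound_def
proof (intro allI impI)
  fix \<phi> :: "'a \<Rightarrow> ennreal" and B
  assume [measurable]: "\<phi> \<in> borel_measurable borel" and B: "\<forall>y. \<phi> y \<le> ennreal B"
  interpret prob_space \<mu> by fact
  interpret pair': pair_sigma_finite \<mu> "lborel :: 'a measure" by standard
  obtain b where b: "0 \<le> b" "\<And>x r. sph_avg \<phi> x r \<le> ennreal b"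
    using B sph_avg_bounded by metis
  have "1 / P' > 0" "1 / Q' > 0" "1 / S' > 0"
    using exps by (simp_all add: conj)
  then have pos: "0 < P'" "0 < Q'" "0 < S'" by simp_all
  let ?c = "r0 powr (1 - real DIM('a))"
  let ?I = "{r0..R0}"
  define F where "F x r = enn2real (sph_avg \<phi> x r) * indicator ?I r" for x r
  have [measurable]: "case_prod F \<in> borel_measurable (borel \<Otimes>\<^sub>M borel)" unfolding F_def by measurable
  have F0: "0 \<le> F x r" for x r by (simp add: F_def)
  have F_eq: "sph_avg \<phi> x r = ennreal (F x r)" if "r \<in> ?I" for x r
    using that le_less_trans[OF b(2)[of x r] ennreal_less_top] by (simp add: F_def)
  have Fb: "F x r \<le> b * indicator ?I r" for x r
    using b enn2real_mono[OF b(2), of x r] by (simp add: F_def mult_right_mono)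
  define V where "V x = (LBN r. ennreal (F x r powr S))" for x
  have [measurable]: "V \<in> borel_measurable borel" unfolding V_def by measurable
  define len where "len = \<bar>R0 - r0\<bar>"
  have V_le: "V x \<le> ennreal (b powr S * len)" for x
  proof -
    have "V x \<le> (LBN r. ennreal (b powr S) * indicator ?I r)"
      unfolding V_def
    proof (rule nn_integral_mono)
      fix r
      show "ennreal (F x r powr S) \<le> ennreal (b powr S) * indicator ?I r"
        using F0[of x r] Fb[of x r] exps b
        by (cases "r \<in> ?I") (auto intro!: ennreal_leI powr_mono2)
    qed
    also have "\<dots> = ennreal (b powr S) * emeasure lborel ?I"
      by (rule nn_integral_cmult_indicator) simp
    also have "\<dots> \<le> ennreal (b powr S) * ennreal len"
      by (intro mult_left_mono) (auto simp: emeasure_lborel_Icc_eq len_def intro!: ennreal_leI)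
    finally show ?thesis by (simp add: len_def ennreal_mult)
  qed
  define v where "v x = enn2real (V x)" for x
  have [measurable]: "v \<in> borel_measurable borel" unfolding v_def by measurable
  have v0: "0 \<le> v x" for x by (simp add: v_def)
  have V_eq: "V x = ennreal (v x)" for x
    using le_less_trans[OF V_le[of x] ennreal_less_top] by (simp add: v_def)
  define g where "g x r = F x r powr (S - 1) * v x powr (Q / S - 1)" for x r
  have [measurable]: "case_prod g \<in> borel_measurable (borel \<Otimes>\<^sub>M borel)" unfolding g_def by measurable
  have g0: "0 \<le> g x r" for x r by (simp add: g_def)
  have g_supp: "g x r = 0" if "r \<notin> ?I" for x r using that by (simp add: g_def F_def)
  define W where "W = (\<integral>\<^sup>+x. ennreal (v x powr (Q / S)) \<partial>\<mu>)"
  define \<Phi> where "\<Phi> = epow (LBN y. epow (\<phi> y) P) (1 / P)"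
  define N where "N y = (\<integral>\<^sup>+x. ennreal (g x (dist x y)) \<partial>\<mu>)" for y
  have [measurable]: "N \<in> borel_measurable borel" unfolding N_def by measurable
  let ?pairing = "\<lambda>x. \<integral>\<^sup>+r\<in>?I. sph_avg \<phi> x r * ennreal (g x r) \<partial>lborel"
  let ?slice = "\<lambda>x. \<integral>\<^sup>+r. epow (sph_avg \<phi> x r) S \<partial>restrict_space lborel ?I"
  let ?\<phi>g = "\<lambda>x. LBN y. \<phi> y * ennreal (g x (dist x y))"
  have "W \<le> (\<integral>\<^sup>+x. ennreal ((b powr S * len) powr (Q / S)) \<partial>\<mu>)"
  proof (unfold W_def, intro nn_integral_mono ennreal_leI powr_mono2)
    fix x
    show "v x \<le> b powr S * len"
      using V_le[of x] by (simp add: V_eq len_def)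
  qed (use exps v0 in auto)
  also have "\<dots> < \<infinity>" by (simp add: emeasure_space_1)
  finally have W_fin: "W < \<infinity>" .
  have W_eq: "(\<integral>\<^sup>+x. epow (?slice x) (Q / S) \<partial>\<mu>) = W"
    unfolding W_def
  proof (rule nn_integral_cong)
    fix x
    have "(?slice x) = V x"
      unfolding V_def
    proof (subst nn_integral_restrict_space)
      show "(LBN r. epow (sph_avg \<phi> x r) S * indicator ?I r) = (LBN r. ennreal (F x r powr S))"
      proof (rule nn_integral_cong)
        fix r
        show "epow (sph_avg \<phi> x r) S * indicator ?I r = ennreal (F x r powr S)"
        proof (cases "r \<in> ?I")
          case True
          then show ?thesis by (simp add: F_eq epow_ennreal F0)
        next
          case False
          then show ?thesis by (simp add: F_def)
        qed
      qed
    qed simp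
    then show "epow (?slice x) (Q / S) = ennreal (v x powr (Q / S))"
      by (simp add: V_eq epow_ennreal v0)
  qed
  \<comment> \<open>The three conjugacy relations make the exponents of \<open>v x\<close> collapse to \<open>Q / S\<close>.\<close>
  have dual_norm: "epow (LBN r. ennreal (g x r powr S')) (Q' / S') = ennreal (v x powr (Q / S))" for x
  proof -
    have S': "(S - 1) * S' = S"
      using exps pos conj(3) by (simp add: field_simps)
    have "(LBN r. ennreal (g x r powr S')) = (LBN r. ennreal (F x r powr S) * ennreal (v x powr ((Q / S - 1) * S')))"
      by (simp add: g_def powr_mult powr_powr S' ennreal_mult)
    also have "\<dots> = V x * ennreal (v x powr ((Q / S - 1) * S'))"
      unfolding V_def by (rule nn_integral_multc) measurable
    also have "\<dots> = ennreal (v x * v x powr ((Q / S - 1) * S'))"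
      using v0 by (simp add: V_eq ennreal_mult)
    also have "v x * v x powr ((Q / S - 1) * S') = v x powr (1 + (Q / S - 1) * S')"
      using v0 by (rule powr_mult_base)
    finally have "epow (LBN r. ennreal (g x r powr S')) (Q' / S') = ennreal (v x powr ((1 + (Q / S - 1) * S') * (Q' / S')))"
      by (simp add: epow_ennreal powr_powr)
    also have "(1 + (Q / S - 1) * S') * (Q' / S') = Q / S"
    proof -
      have "(1 + (Q / S - 1) * S') * (Q' / S') = Q' * (1 / S' + (Q / S - 1))"
        using pos by (simp add: field_simps)
      also have "\<dots> = Q' * ((Q - 1) / S)"
        using exps by (simp add: conj field_simps)
      also have "\<dots> = Q / S"
        using exps pos conj(2) by (simp add: field_simps)
      finally show ?thesis .
    qed
    finally show ?thesis .
  qed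
  have "W = (\<integral>\<^sup>+x. (?pairing x) \<partial>\<mu>)"
    unfolding W_def
  proof (rule nn_integral_cong)
    fix x
    have "(?pairing x)
        = (LBN r. ennreal (F x r powr S) * ennreal (v x powr (Q / S - 1)))"
    proof (rule nn_integral_cong)
      fix r
      show "sph_avg \<phi> x r * ennreal (g x r) * indicator ?I r = ennreal (F x r powr S) * ennreal (v x powr (Q / S - 1))"
      proof (cases "r \<in> ?I")
        case True
        have "F x r * F x r powr (S - 1) = F x r powr S"
          using powr_mult_base[OF F0, of x r "S - 1"] by simp
        then have "ennreal (F x r powr S) = ennreal (F x r) * ennreal (F x r powr (S - 1))"
          using F0 by (simp flip: ennreal_mult)
        moreover have "ennreal (g x r) = ennreal (F x r powr (S - 1)) * ennreal (v x powr (Q / S - 1))"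
          unfolding g_def by (rule ennreal_mult) simp_all
        ultimately show ?thesis using True by (simp add: F_eq mult.assoc)
      next
        case False
        then show ?thesis by (simp add: F_def)
      qed
    qed
    also have "\<dots> = V x * ennreal (v x powr (Q / S - 1))"
      unfolding V_def by (rule nn_integral_multc) measurable
    also have "\<dots> = ennreal (v x * v x powr (Q / S - 1))"
      using v0 by (simp add: V_eq ennreal_mult)
    also have "v x * v x powr (Q / S - 1) = v x powr (Q / S)"
      using powr_mult_base[OF v0, of x "Q / S - 1"] by simp
    finally show "ennreal (v x powr (Q / S)) = (?pairing x)" ..
  qed
  also have "\<dots> \<le> (\<integral>\<^sup>+x. ennreal ?c * (?\<phi>g x) \<partial>\<mu>)"
  proof (rule nn_integral_mono)
    fix x
    have "(?pairing x)
        \<le> ennreal ?c * (LBN y. \<phi> y * (ennreal (g x (dist x y)) * indicator ?I (dist x y)))"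
      using r0 by (intro nn_integral_sph_avg_le) measurable
    also have "(\<lambda>y. ennreal (g x (dist x y)) * indicator ?I (dist x y)) = (\<lambda>y. ennreal (g x (dist x y)))"
      using g_supp by (auto simp: fun_eq_iff indicator_def)
    finally show "(?pairing x)
        \<le> ennreal ?c * (?\<phi>g x)"
      by (simp add: fun_eq_iff)
  qed
  also have "\<dots> = ennreal ?c * (\<integral>\<^sup>+x. (?\<phi>g x) \<partial>\<mu>)"
    by (rule nn_integral_cmult) measurable
  also have "(\<integral>\<^sup>+x. (?\<phi>g x) \<partial>\<mu>)
      = (LBN y. (\<integral>\<^sup>+x. \<phi> y * ennreal (g x (dist x y)) \<partial>\<mu>))"
    by (rule pair'.Fubini'[symmetric]) measurable
  also have "\<dots> = (LBN y. epow (epow (\<phi> y) P) (1 / P) * epow (epow (N y) P') (1 - 1 / P))"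
    unfolding N_def conj(1)[symmetric] using exps pos by (simp add: nn_integral_cmult epow_epow)
  also have "\<dots> \<le> \<Phi> * epow (LBN y. epow (N y) P') (1 - 1 / P)"
    unfolding \<Phi>_def using exps by (intro nn_integral_Holder) simp_all
  also have "(LBN y. epow (N y) P') \<le> ennreal K * epow W (P' / Q')"
    using adj[unfolded adjoint_bound_def, rule_format, of g] g0 g_supp
    by (simp add: N_def dual_norm W_def)
  also have "epow (ennreal K * epow W (P' / Q')) (1 - 1 / P) = ennreal (K powr (1 / P')) * epow W (1 / Q')"
    using pos K by (simp add: epow_mult epow_epow epow_ennreal flip: conj(1))
  finally have "W \<le> ennreal ?c * (\<Phi> * (ennreal (K powr (1 / P')) * epow W (1 / Q')))"
    using exps by (simp add: epow_mono mult_left_mono)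
  also have "\<dots> = (ennreal (?c * K powr (1 / P')) * \<Phi>) * epow W (1 / Q')"
    by (simp add: ennreal_mult mult_ac)
  finally have W_le: "W \<le> (ennreal (?c * K powr (1 / P')) * \<Phi>) * epow W (1 / Q')" .
  \<comment> \<open>Cancel the finite factor \<open>epow W (1 / Q')\<close>.\<close>
  have "epow W (1 / Q) \<le> ennreal (?c * K powr (1 / P')) * \<Phi>"
  proof (cases "W = 0")
    case False
    have "epow W (1 / Q) * epow W (1 / Q') = W"
      by (simp add: epow_add conj(2))
    with W_le have "epow W (1 / Q') * epow W (1 / Q) \<le> epow W (1 / Q') * (ennreal (?c * K powr (1 / P')) * \<Phi>)"
      by (simp add: mult.commute)
    moreover have "epow W (1 / Q') \<noteq> 0" "epow W (1 / Q') \<noteq> top"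
      using False W_fin by auto
    ultimately show ?thesis
      by (subst (asm) ennreal_mult_le_mult_iff) auto
  qed simp
  then show "epow (\<integral>\<^sup>+x. epow (?slice x) (Q / S) \<partial>\<mu>) (1 / Q)
      \<le> ennreal (?c * K powr (1 / P')) * epow (LBN y. epow (\<phi> y) P) (1 / P)"
    by (simp only: W_eq \<Phi>_def)
qed

text \<open>
  Interpolation between the endpoint \<open>(P, Q, S)\<close> and the trivial estimate \<open>(1, \<infinity>, 1)\<close>, by the factorisation
  \<open>\<phi> = f1\<^sup>t f0\<^sup>1\<^sup>-\<^sup>t\<close> and Hoelder's inequality. The functions \<open>f1\<close> and \<open>f0\<close> are chosen such that the power \<open>P\<close> of \<open>f1\<close> and \<open>f0\<close> itself both
  equal the power \<open>p\<close> of \<open>\<phi>\<close>.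
\<close>

lemma mixed_bound_interpolation:
  fixes \<mu> :: "'a::euclidean_space measure"
  assumes sets [measurable_cong]: "sets \<mu> = sets borel"
    and r0: "0 < r0" and exps: "1 < P" "1 < Q" "1 < S" and t: "0 < t" "t < 1"
    and p: "1 / p = t / P + (1 - t)" and q: "1 / q = t / Q" and s: "1 / s = t / S + (1 - t)"
    and endpoint: "mixed_bound r0 R0 \<mu> P Q S K" and K: "0 \<le> K"
  shows "mixed_bound r0 R0 \<mu> p q s (K powr t * (r0 powr (1 - real DIM('a))) powr (1 - t))"
  unfolding mixed_bound_def
proof (intro allI impI)
  fix \<phi> :: "'a \<Rightarrow> ennreal" and B
  assume [measurable]: "\<phi> \<in> borel_measurable borel" and B: "\<forall>y. \<phi> y \<le> ennreal B"
  let ?L = "restrict_space lborel {r0..R0}"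
  let ?c = "r0 powr (1 - real DIM('a))"
  have "1 / p > 0" "1 / q > 0" "1 / s > 0"
    using exps t by (auto simp: p q s intro!: add_pos_pos)
  then have pos: "0 < p" "0 < q" "0 < s" by simp_all
  define f1 where "f1 y = epow (\<phi> y) (p / P)" for y
  define f0 where "f0 y = epow (\<phi> y) p" for y
  have [measurable]: "f1 \<in> borel_measurable borel" "f0 \<in> borel_measurable borel"
    unfolding f1_def f0_def by measurable
  define Y where "Y = (LBN y. epow (\<phi> y) p)"
  define Z where "Z = ennreal ?c * Y"
  define U where "U x = (\<integral>\<^sup>+r. epow (sph_avg f1 x r) S \<partial>?L)" for x
  have [measurable]: "U \<in> borel_measurable borel"
    unfolding U_def by (subst nn_integral_restrict_space) simp_all
  let ?slice = "\<lambda>x. \<integral>\<^sup>+r. epow (sph_avg \<phi> x r) s \<partial>?L"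
  let ?UQ = "\<integral>\<^sup>+x. epow (U x) (Q / S) \<partial>\<mu>"
  have pt: "p * t / P + p * (1 - t) = 1"
  proof -
    have "p * t / P + p * (1 - t) = p * (t / P + (1 - t))" by (simp add: algebra_simps)
    then show ?thesis using pos by (simp flip: p)
  qed
  have st: "t * s / S + (1 - t) * s = 1"
  proof -
    have "t * s / S + (1 - t) * s = s * (t / S + (1 - t))" by (simp add: algebra_simps)
    then show ?thesis using pos by (simp flip: s)
  qed
  have avg: "sph_avg \<phi> x r \<le> epow (sph_avg f1 x r) t * epow (sph_avg f0 x r) (1 - t)" for x r
  proof -
    have "sph_avg \<phi> x r = (\<integral>\<^sup>+\<sigma>. epow (f1 (x - r *\<^sub>R \<sigma>)) t * epow (f0 (x - r *\<^sub>R \<sigma>)) (1 - t) \<partial>sphere_measure)"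
      unfolding sph_avg_def f1_def f0_def by (simp add: epow_epow epow_add pt)
    also have "\<dots> \<le> epow (sph_avg f1 x r) t * epow (sph_avg f0 x r) (1 - t)"
      unfolding sph_avg_def by (rule nn_integral_Holder) (use t in simp_all)
    finally show ?thesis .
  qed
  have f0_int: "(\<integral>\<^sup>+r. sph_avg f0 x r \<partial>?L) \<le> Z" for x
  proof -
    have "(\<integral>\<^sup>+r. sph_avg f0 x r \<partial>?L) = (\<integral>\<^sup>+r\<in>{r0..R0}. sph_avg f0 x r * 1 \<partial>lborel)"
      by (subst nn_integral_restrict_space) simp_all
    also have "\<dots> \<le> ennreal ?c * (LBN y. f0 y * (1 * indicator {r0..R0} (dist x y)))"
      using r0 by (intro nn_integral_sph_avg_le) simp_all
    also have "\<dots> \<le> ennreal ?c * (LBN y. f0 y)"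
      by (intro mult_left_mono nn_integral_mono) (auto split: split_indicator)
    finally show ?thesis by (simp add: Z_def Y_def f0_def)
  qed
  have slice: "epow (?slice x) (q / s) \<le> epow Z ((1 - t) * q) * epow (U x) (Q / S)" for x
  proof -
    let ?a = "t * s / S"
    have a: "0 < ?a" "?a < 1" "1 - ?a = (1 - t) * s"
    proof -
      have "0 < (1 - t) * s" using t pos by simp
      then show "?a < 1" "1 - ?a = (1 - t) * s" using st by linarith+
    qed (use t pos exps in simp)
    have "(?slice x)
        \<le> (\<integral>\<^sup>+r. epow (epow (sph_avg f1 x r) S) ?a * epow (sph_avg f0 x r) (1 - ?a) \<partial>?L)"
    proof (rule nn_integral_mono)
      fix r
      have "epow (sph_avg \<phi> x r) s \<le> epow (epow (sph_avg f1 x r) t * epow (sph_avg f0 x r) (1 - t)) s"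
        using pos by (intro epow_mono avg) simp
      then show "epow (sph_avg \<phi> x r) s \<le> epow (epow (sph_avg f1 x r) S) ?a * epow (sph_avg f0 x r) (1 - ?a)"
        using exps by (simp add: epow_mult epow_epow a(3))
    qed
    also have "\<dots> \<le> epow (U x) ?a * epow (\<integral>\<^sup>+r. sph_avg f0 x r \<partial>?L) (1 - ?a)"
      unfolding U_def using a by (intro nn_integral_Holder) simp_all
    also have "\<dots> \<le> epow (U x) ?a * epow Z (1 - ?a)"
      using a f0_int by (intro mult_left_mono epow_mono) simp_all
    finally have "epow (?slice x) (q / s) \<le> epow (epow (U x) ?a * epow Z (1 - ?a)) (q / s)"
      using pos by (intro epow_mono) simp_all
    also have "\<dots> = epow (U x) (?a * (q / s)) * epow Z ((1 - ?a) * (q / s))"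
      by (simp add: epow_mult epow_epow)
    also have "?a * (q / s) = Q / S"
      using q pos exps t by (simp add: field_simps)
    also have "(1 - ?a) * (q / s) = (1 - t) * q"
      using pos by (simp add: a(3))
    finally show ?thesis by (simp only: mult.commute)
  qed
  have "(\<integral>\<^sup>+x. epow (?slice x) (q / s) \<partial>\<mu>)
      \<le> (\<integral>\<^sup>+x. epow Z ((1 - t) * q) * epow (U x) (Q / S) \<partial>\<mu>)"
    by (intro nn_integral_mono slice)
  also have "\<dots> = epow Z ((1 - t) * q) * ?UQ"
    by (rule nn_integral_cmult) measurable
  finally have "epow (\<integral>\<^sup>+x. epow (?slice x) (q / s) \<partial>\<mu>) (1 / q)
      \<le> epow (epow Z ((1 - t) * q) * ?UQ) (1 / q)"
    using pos by (intro epow_mono) simp_all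
  also have "\<dots> = epow Z (1 - t) * epow (epow ?UQ (1 / Q)) t"
  proof -
    have "(1 - t) * q * (1 / q) = 1 - t" using pos by simp
    moreover have "1 / Q * t = 1 / q" by (simp add: q)
    ultimately show ?thesis by (simp only: epow_mult epow_epow)
  qed
  also have "\<dots> \<le> epow Z (1 - t) * epow (ennreal K * epow Y (1 / P)) t"
  proof (intro mult_left_mono epow_mono)
    have "f1 y \<le> ennreal (max 0 B powr (p / P))" for y
    proof -
      have "\<phi> y \<le> ennreal (max 0 B)"
        using B by (auto intro: order_trans ennreal_leI)
      then have "f1 y \<le> epow (ennreal (max 0 B)) (p / P)"
        unfolding f1_def using pos exps by (intro epow_mono) simp_all
      then show ?thesis by (simp add: epow_ennreal)
    qed
    then have "epow ?UQ (1 / Q) \<le> ennreal K * epow (LBN y. epow (f1 y) P) (1 / P)"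
      unfolding U_def by (intro endpoint[unfolded mixed_bound_def, rule_format]) simp_all
    then show "epow ?UQ (1 / Q) \<le> ennreal K * epow Y (1 / P)"
      using exps by (simp add: f1_def epow_epow Y_def)
  qed (use t in simp_all)
  also have "\<dots> = (epow (ennreal K) t * epow (ennreal ?c) (1 - t)) * epow Y (t / P + (1 - t))"
  proof -
    have "epow Y (t / P + (1 - t)) = epow Y (t / P) * epow Y (1 - t)"
      by (rule epow_add[symmetric])
    then show ?thesis by (simp add: Z_def epow_mult epow_epow mult_ac)
  qed
  also have "epow (ennreal K) t * epow (ennreal ?c) (1 - t) = ennreal (K powr t * ?c powr (1 - t))"
    using K by (simp add: epow_ennreal ennreal_mult)
  finally show "epow (\<integral>\<^sup>+x. epow (?slice x) (q / s) \<partial>\<mu>) (1 / q)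
      \<le> ennreal (K powr t * ?c powr (1 - t)) * epow (LBN y. epow (\<phi> y) p) (1 / p)"
    by (simp only: p Y_def)
qed

section \<open>Schwartz functions and the three families of exponents\<close>

lemma Lp_norm_ennreal:
  "0 < p \<Longrightarrow> Lp_norm M (ennreal p) f = epow (\<integral>\<^sup>+x. epow (f x) p \<partial>M) (1 / p)"
  by (simp add: Lp_norm_def)

lemma schwartz_borel_measurable:
  assumes "schwartz f" shows "f \<in> borel_measurable borel"
proof -
  have "f differentiable (at x)" for x
    using assms[unfolded schwartz_def, rule_format, of "[]"] by simp
  then have "continuous_on UNIV f"
    by (simp add: continuous_on_eq_continuous_at differentiable_imp_continuous_within)
  then show ?thesis by (rule borel_measurable_continuous_onI)
qed

lemma schwartz_bounded:
  assumes "schwartz f" obtains B where "\<And>x. norm (f x) \<le> B"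
proof -
  have "\<exists>B. \<forall>x. (1 + norm x) ^ 0 * norm (iter_deriv [] f x) \<le> B"
    using assms unfolding schwartz_def by (metis empty_set empty_subsetI)
  then show thesis using that by auto
qed

lemma spherical_avg_le_sph_avg:
  "ennreal (norm (spherical_avg f x r)) \<le> sph_avg (\<lambda>y. ennreal (norm (f y))) x r"
proof (cases "integrable sphere_measure (\<lambda>\<sigma>. f (x - r *\<^sub>R \<sigma>))")
  case True
  then show ?thesis
    unfolding spherical_avg_def sph_avg_def by (rule integral_norm_bound_ennreal)
next
  case False
  then show ?thesis
    by (simp add: spherical_avg_def not_integrable_integral_eq)
qed

lemma measurable_spherical_avg:
  fixes f :: "'a::euclidean_space \<Rightarrow> complex"
  assumes [measurable]: "f \<in> borel_measurable borel"
  shows "case_prod (spherical_avg f) \<in> borel_measurable (borel \<Otimes>\<^sub>M borel)"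
proof -
  interpret sphere: finite_measure "sphere_measure :: 'a measure"
    by (rule finite_sphere_measure)
  note [measurable] = measurable_snd_sphere_measure
  have "(\<lambda>p :: 'a \<times> real. LINT \<sigma>|sphere_measure. f (fst p - snd p *\<^sub>R \<sigma>)) \<in> borel_measurable (borel \<Otimes>\<^sub>M borel)"
    by (rule sphere.borel_measurable_lebesgue_integral) (simp add: split_beta')
  then show ?thesis
    by (simp add: spherical_avg_def split_beta')
qed

lemma spherical_estimate_from_mixed_bound:
  fixes \<mu> :: "'a::euclidean_space measure"
  assumes bound: "mixed_bound r0 R0 \<mu> p q s K" and pos: "0 < p" "0 < q" "0 < s"
  shows "spherical_estimate r0 R0 \<mu> (ennreal p) (ennreal q) (ennreal s) K"
  unfolding spherical_estimate_def
proof (intro allI impI)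
  fix f :: "'a \<Rightarrow> complex" assume f: "schwartz f"
  note [measurable] = schwartz_borel_measurable[OF f]
  obtain B where B: "\<And>x. norm (f x) \<le> B" using schwartz_bounded[OF f] by blast
  let ?L = "restrict_space lborel {r0..R0}"
  let ?\<phi> = "\<lambda>y. ennreal (norm (f y))"
  have "epow (\<integral>\<^sup>+x. epow (epow (\<integral>\<^sup>+r. epow (ennreal (norm (spherical_avg f x r))) s \<partial>?L) (1 / s)) q \<partial>\<mu>) (1 / q)
      \<le> epow (\<integral>\<^sup>+x. epow (epow (\<integral>\<^sup>+r. epow (sph_avg ?\<phi> x r) s \<partial>?L) (1 / s)) q \<partial>\<mu>) (1 / q)"
    using pos by (intro epow_mono nn_integral_mono spherical_avg_le_sph_avg) simp_all
  also have "\<dots> = epow (\<integral>\<^sup>+x. epow (\<integral>\<^sup>+r. epow (sph_avg ?\<phi> x r) s \<partial>?L) (q / s) \<partial>\<mu>) (1 / q)"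
    by (simp add: epow_epow)
  also have "\<dots> \<le> ennreal K * epow (LBN y. epow (?\<phi> y) p) (1 / p)"
    using B by (intro bound[unfolded mixed_bound_def, rule_format, of _ B]) (auto intro: ennreal_leI)
  finally show "Lp_norm \<mu> (ennreal q) (\<lambda>x. Lp_norm ?L (ennreal s) (\<lambda>r. ennreal (norm (spherical_avg f x r))))
      \<le> ennreal K * Lp_norm lborel (ennreal p) ?\<phi>"
    using pos by (simp add: Lp_norm_ennreal)
qed

text \<open>
  The case \<open>t = 0\<close>, kept apart because the outer norm is an essential supremum.
\<close>

lemma spherical_estimate_1_top_1:
  fixes \<mu> :: "'a::euclidean_space measure"
  assumes sets [measurable_cong]: "sets \<mu> = sets borel" and r0: "0 < r0"
  shows "spherical_estimate r0 R0 \<mu> 1 top 1 (r0 powr (1 - real DIM('a)))"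
  unfolding spherical_estimate_def
proof (intro allI impI)
  fix f :: "'a \<Rightarrow> complex" assume f: "schwartz f"
  note [measurable] = schwartz_borel_measurable[OF f]
  note [measurable] = measurable_spherical_avg[OF schwartz_borel_measurable[OF f]]
  let ?L = "restrict_space lborel {r0..R0}"
  let ?\<phi> = "\<lambda>y. ennreal (norm (f y))"
  have norm_1: "Lp_norm M 1 h = (\<integral>\<^sup>+x. h x \<partial>M)" for M :: "'z measure" and h
    using Lp_norm_ennreal[of 1 M h] by simp
  have slice: "Lp_norm ?L 1 (\<lambda>r. ennreal (norm (spherical_avg f x r)))
      = (\<integral>\<^sup>+r\<in>{r0..R0}. ennreal (norm (spherical_avg f x r)) \<partial>lborel)" for x
    using Lp_norm_ennreal[of 1 ?L "\<lambda>r. ennreal (norm (spherical_avg f x r))"]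
    by (simp add: nn_integral_restrict_space)
  have "Lp_norm ?L 1 (\<lambda>r. ennreal (norm (spherical_avg f x r)))
      \<le> ennreal (r0 powr (1 - real DIM('a))) * (LBN y. ?\<phi> y)" for x
  proof -
    have "Lp_norm ?L 1 (\<lambda>r. ennreal (norm (spherical_avg f x r)))
        \<le> (\<integral>\<^sup>+r\<in>{r0..R0}. sph_avg ?\<phi> x r * 1 \<partial>lborel)"
      unfolding slice by (intro nn_integral_mono mult_right_mono) (simp_all add: spherical_avg_le_sph_avg)
    also have "\<dots> \<le> ennreal (r0 powr (1 - real DIM('a))) *
        (LBN y. ?\<phi> y * (1 * indicator {r0..R0} (dist x y)))"
      using r0 by (intro nn_integral_sph_avg_le) simp_all
    also have "\<dots> \<le> ennreal (r0 powr (1 - real DIM('a))) * (LBN y. ?\<phi> y)"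
      by (intro mult_left_mono nn_integral_mono) (auto split: split_indicator)
    finally show ?thesis .
  qed
  moreover have "(\<lambda>x. Lp_norm ?L 1 (\<lambda>r. ennreal (norm (spherical_avg f x r)))) \<in> borel_measurable \<mu>"
    unfolding slice by measurable
  ultimately show "Lp_norm \<mu> top (\<lambda>x. Lp_norm ?L 1 (\<lambda>r. ennreal (norm (spherical_avg f x r))))
      \<le> ennreal (r0 powr (1 - real DIM('a))) * Lp_norm lborel 1 ?\<phi>"
    using Lp_norm_ennreal[of 1 lborel ?\<phi>] by (simp add: Lp_norm_def esssup_I)
qed

lemma exponent_of_inverse:
  fixes p :: ennreal
  assumes "1 / p = ennreal v" "0 < v" shows "p = ennreal (1 / v)"
proof (cases p)
  case (real x)
  have "x \<noteq> 0" using assms real by (auto simp: ennreal_divide_self)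
  then have "1 / p = ennreal (1 / x)"
    using real by (simp add: divide_ennreal flip: ennreal_1)
  then have "1 / x = v" using assms real by simp
  then show ?thesis using real by (auto simp: field_simps)
next
  case top
  then show ?thesis using assms by simp
qed

lemma exponent_of_inverse_0:
  fixes p :: ennreal
  assumes "1 / p = 0" shows "p = top"
proof (cases p)
  case (real x)
  then show ?thesis
    using assms by (cases "x = 0") (simp_all add: divide_ennreal flip: ennreal_1)
qed simp

text \<open>
  An endpoint bound that is uniform over a class \<open>H\<close> of measures yields the estimates on the half-open segment from
  \<open>(1, 0, 1)\<close> towards that endpoint, uniformly over \<open>H\<close>.
\<close>

lemma spherical_estimate_segment:
  fixes H :: "'a::euclidean_space measure \<Rightarrow> bool"
  assumes r0: "0 < r0" and exps: "1 < P" "1 < Q" "1 < S"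
    and H: "\<And>\<mu>. H \<mu> \<Longrightarrow> prob_space \<mu> \<and> sets \<mu> = sets borel \<and> mixed_bound r0 R0 \<mu> P Q S K" and K: "0 \<le> K"
    and t: "0 \<le> t" "t < 1"
    and p: "1 / p = ennreal (t * (1 / P) + (1 - t) * 1)" and q: "1 / q = ennreal (t * (1 / Q) + (1 - t) * 0)"
    and s: "1 / s = ennreal (t * (1 / S) + (1 - t) * 1)"
  shows "\<exists>K. \<forall>\<mu>. H \<mu> \<longrightarrow> spherical_estimate r0 R0 \<mu> p q s K"
proof (cases "t = 0")
  case True
  then have "p = 1" "q = top" "s = 1"
    using exponent_of_inverse[OF p] exponent_of_inverse_0[of q] q exponent_of_inverse[OF s] by simp_all
  then have "spherical_estimate r0 R0 \<mu> p q s (r0 powr (1 - real DIM('a)))" if "H \<mu>" for \<mu>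
    using H[OF that] r0 by (simp add: spherical_estimate_1_top_1)
  then show ?thesis by blast
next
  case False
  then have t': "0 < t" using t by simp
  define p' where "p' = 1 / (t / P + (1 - t))"
  define q' where "q' = 1 / (t / Q)"
  define s' where "s' = 1 / (t / S + (1 - t))"
  have v: "0 < t / P + (1 - t)" "0 < t / Q" "0 < t / S + (1 - t)"
    using t t' exps by (auto intro!: add_pos_pos)
  then have pos: "0 < p'" "0 < q'" "0 < s'"
    by (simp_all only: p'_def q'_def s'_def zero_less_divide_1_iff)
  have eqs: "p = ennreal p'" "q = ennreal q'" "s = ennreal s'"
    using exponent_of_inverse[OF p] exponent_of_inverse[OF q] exponent_of_inverse[OF s] v
    by (simp_all add: p'_def q'_def s'_def)
  have "spherical_estimate r0 R0 \<mu> p q s (K powr t * (r0 powr (1 - real DIM('a))) powr (1 - t))" if "H \<mu>" for \<mu>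
    unfolding eqs
  proof (rule spherical_estimate_from_mixed_bound[OF _ pos])
    show "mixed_bound r0 R0 \<mu> p' q' s' (K powr t * (r0 powr (1 - real DIM('a))) powr (1 - t))"
      using H[OF that] r0 exps t t' K
      by (intro mixed_bound_interpolation[where P = P and Q = Q and S = S]) (simp_all add: p'_def q'_def s'_def)
  qed
  then show ?thesis by blast
qed

text \<open>
  On radii above 1 the total mass 1 takes over, so a growth exponent can be lowered at the expense of the constant.
\<close>

lemma ball_growth_weaken:
  assumes "prob_space \<mu>" and growth: "ball_growth C \<alpha>' \<mu>" and \<beta>: "\<beta> \<le> \<alpha>'" "0 < \<beta>" and \<delta>: "0 < \<delta>"
  shows "measure \<mu> (ball x \<delta>) \<le> max 1 C * \<delta> powr \<beta>"
proof -
  interpret prob_space \<mu> by fact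
  show ?thesis
  proof (cases "\<delta> \<le> 1")
    case True
    have "measure \<mu> (ball x \<delta>) \<le> C * \<delta> powr \<alpha>'"
      using growth \<delta> by (simp add: ball_growth_def)
    also have "\<dots> \<le> max 1 C * \<delta> powr \<alpha>'" by (intro mult_right_mono) auto
    also have "\<dots> \<le> max 1 C * \<delta> powr \<beta>"
      using True \<beta> \<delta> by (intro mult_left_mono powr_mono') auto
    finally show ?thesis .
  next
    case False
    have "measure \<mu> (ball x \<delta>) \<le> 1" by simp
    also have "1 \<le> \<delta> powr \<beta>" using False \<beta> by (intro ge_one_powr_ge_zero) auto
    also have "\<dots> \<le> max 1 C * \<delta> powr \<beta>" using mult_right_mono[of 1 "max 1 C" "\<delta> powr \<beta>"] by simp
    finally show ?thesis .
  qed
qed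

lemma adjoint_bound_mono:
  assumes adj: "adjoint_bound r0 R0 \<mu> P' Q' S' K" and "K \<le> K'"
  shows "adjoint_bound r0 R0 \<mu> P' Q' S' K'"
  unfolding adjoint_bound_def
proof (intro allI impI)
  fix g :: "'a \<Rightarrow> real \<Rightarrow> real"
  let ?X = "epow (\<integral>\<^sup>+x. epow (LBN r. ennreal (g x r powr S')) (Q' / S') \<partial>\<mu>) (P' / Q')"
  assume g: "case_prod g \<in> borel_measurable (borel \<Otimes>\<^sub>M borel)"
    "\<forall>x r. 0 \<le> g x r" "\<forall>x r. r \<notin> {r0..R0} \<longrightarrow> g x r = 0"
  have "(LBN y. epow (\<integral>\<^sup>+x. ennreal (g x (dist x y)) \<partial>\<mu>) P') \<le> ennreal K * ?X"
    using adj g unfolding adjoint_bound_def by simp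
  also have "\<dots> \<le> ennreal K' * ?X"
    using assms(2) by (intro mult_right_mono ennreal_leI) simp_all
  finally show "(LBN y. epow (\<integral>\<^sup>+x. ennreal (g x (dist x y)) \<partial>\<mu>) P') \<le> ennreal K' * ?X" .
qed

text \<open>
  Lowering the growth exponent from \<open>\<alpha>'\<close> to some \<open>\<beta>\<close> slightly above \<open>\<alpha>\<close> keeps the exponent of the remaining kernel positive.
\<close>

lemma mixed_bound_ball_growth:
  fixes C :: real
  assumes r0: "0 < r0" and pair: "annular_pair_bound TYPE('a::euclidean_space) r0 R0 \<kappa> m K" and K: "0 \<le> K"
    and \<alpha>: "0 < \<alpha>" "\<alpha> < \<kappa>" "\<alpha> < \<alpha>'" and m: "0 < m"
    and P: "P = 1 + \<alpha> / \<kappa>" and S: "1 < S" "1 / S = 1 - 2 / ((1 + \<kappa> / \<alpha>) * m)"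
  obtains K' where "0 \<le> K'" "\<And>\<mu> :: 'a measure. prob_space \<mu> \<Longrightarrow> sets \<mu> = sets borel \<Longrightarrow> ball_growth C \<alpha>' \<mu>
    \<Longrightarrow> mixed_bound r0 R0 \<mu> P P S K'"
proof -
  have "0 < \<kappa> / \<alpha> - 1" using \<alpha> by simp
  have "\<alpha> * (\<kappa> / \<alpha> - 1) < \<kappa>" using \<alpha> by (simp add: right_diff_distrib)
  then have "\<alpha> < \<kappa> / (\<kappa> / \<alpha> - 1)" using \<open>0 < \<kappa> / \<alpha> - 1\<close> by (simp add: pos_less_divide_eq)
  \<comment> \<open>The second upper bound on \<open>\<beta>\<close> is where \<open>\<kappa> - \<beta> (\<kappa>/\<alpha> - 1)\<close> changes sign.\<close>
  then obtain \<beta> where \<beta>: "\<alpha> < \<beta>" "\<beta> < min \<alpha>' (\<kappa> / (\<kappa> / \<alpha> - 1))"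
    using \<alpha> dense[of \<alpha> "min \<alpha>' (\<kappa> / (\<kappa> / \<alpha> - 1))"] by auto
  then have small: "0 < \<kappa> - \<beta> * (\<kappa> / \<alpha> - 1)"
    using \<open>0 < \<kappa> / \<alpha> - 1\<close> by (simp add: pos_less_divide_eq)
  define A where "A = 4 * (8 * max 1 C) powr (\<kappa> / \<alpha> - 1) * K * (2 * (1 + \<bar>max 1 C\<bar> / (\<beta> / (\<kappa> - \<beta> * (\<kappa> / \<alpha> - 1)) - 1)))"
  have "mixed_bound r0 R0 \<mu> P P S (r0 powr (1 - real DIM('a)) * \<bar>A\<bar> powr (1 / (1 + \<kappa> / \<alpha>)))"
    if \<mu>: "prob_space \<mu>" "sets \<mu> = sets borel" "ball_growth C \<alpha>' \<mu>" for \<mu> :: "'a measure"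
  proof (rule mixed_bound_from_adjoint[where S' = "(1 + \<kappa> / \<alpha>) * m / 2" and Q' = "1 + \<kappa> / \<alpha>"])
    have "adjoint_bound r0 R0 \<mu> (1 + \<kappa> / \<alpha>) (1 + \<kappa> / \<alpha>) ((1 + \<kappa> / \<alpha>) * m / 2) A"
      unfolding A_def
    proof (rule adjoint_bound_ball_growth)
      show "measure \<mu> (ball x \<delta>) \<le> max 1 C * \<delta> powr \<beta>" if "0 < \<delta>" for x \<delta>
        using ball_growth_weaken[OF \<mu>(1,3) _ _ that] \<alpha> \<beta> by simp
    qed (use \<mu> \<alpha> \<beta> small m pair K in auto)
    then show "adjoint_bound r0 R0 \<mu> (1 + \<kappa> / \<alpha>) (1 + \<kappa> / \<alpha>) ((1 + \<kappa> / \<alpha>) * m / 2) \<bar>A\<bar>"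
      by (rule adjoint_bound_mono) simp
    show "1 / (1 + \<kappa> / \<alpha>) = 1 - 1 / P" "1 / (1 + \<kappa> / \<alpha>) = 1 - 1 / P"
      using \<alpha> by (simp_all add: P field_simps)
    show "1 / ((1 + \<kappa> / \<alpha>) * m / 2) = 1 - 1 / S"
      using S by simp
    show "1 < P" "1 < P" using \<alpha> by (simp_all add: P)
  qed (use \<mu> r0 S in simp_all)
  then show thesis by (intro that[of "r0 powr (1 - real DIM('a)) * \<bar>A\<bar> powr (1 / (1 + \<kappa> / \<alpha>))"]) simp_all
qed

theorem theorem2p3:
  fixes r0 R0 :: real
  assumes "0 < r0" "r0 < R0"
  shows
    "(\<forall>(\<alpha>::real) (M::real) (C::real) (t::real) (p::ennreal) (q::ennreal) (s::ennreal).
        \<alpha> > 1/2 \<longrightarrow> 0 \<le> t \<longrightarrow> t < 1 \<longrightarrow>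
        1 / p = ennreal (t * (1/2) + (1 - t) * 1) \<longrightarrow>
        1 / q = ennreal (t * (1 / (2 * \<alpha>)) + (1 - t) * 0) \<longrightarrow>
        1 / s = ennreal (t * (1/4) + (1 - t) * 1) \<longrightarrow>
        (\<exists>K. \<forall>\<mu> :: (real^2) measure.
           borel_prob_supported_in \<mu> M \<longrightarrow> energy \<alpha> \<mu> \<le> ennreal C \<longrightarrow>
           spherical_estimate r0 R0 \<mu> p q s K))
     \<and>
     (\<forall>(\<alpha>::real) (\<alpha>'::real) (M::real) (C::real) (t::real) (p::ennreal) (q::ennreal) (s::ennreal).
        0 < \<alpha> \<longrightarrow> \<alpha> < \<alpha>' \<longrightarrow> \<alpha>' < 1/2 \<longrightarrow> 0 \<le> t \<longrightarrow> t < 1 \<longrightarrow>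
        1 / p = ennreal (t * (1 / (1 + 2 * \<alpha>)) + (1 - t) * 1) \<longrightarrow>
        1 / q = ennreal (t * (1 / (1 + 2 * \<alpha>)) + (1 - t) * 0) \<longrightarrow>
        1 / s = ennreal (t * ((1 - \<alpha>) / (1 + 2 * \<alpha>)) + (1 - t) * 1) \<longrightarrow>
        (\<exists>K. \<forall>\<mu> :: (real^2) measure.
           borel_prob_supported_in \<mu> M \<longrightarrow> ball_growth C \<alpha>' \<mu> \<longrightarrow>
           spherical_estimate r0 R0 \<mu> p q s K))
     \<and>
     (CARD('n::finite) > 2 \<longrightarrow>
      (\<forall>(\<alpha>::real) (\<alpha>'::real) (M::real) (C::real) (t::real) (p::ennreal) (q::ennreal) (s::ennreal).
        0 < \<alpha> \<longrightarrow> \<alpha> < \<alpha>' \<longrightarrow> \<alpha>' < 1 \<longrightarrow> 0 \<le> t \<longrightarrow> t < 1 \<longrightarrow>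
        1 / p = ennreal (t * (1 / (1 + \<alpha>)) + (1 - t) * 1) \<longrightarrow>
        1 / q = ennreal (t * (1 / (1 + \<alpha>)) + (1 - t) * 0) \<longrightarrow>
        1 / s = ennreal (t * ((1 - \<alpha>) / (1 + \<alpha>)) + (1 - t) * 1) \<longrightarrow>
        (\<exists>K. \<forall>\<mu> :: (real^'n) measure.
           borel_prob_supported_in \<mu> M \<longrightarrow> ball_growth C \<alpha>' \<mu> \<longrightarrow>
           spherical_estimate r0 R0 \<mu> p q s K)))"
proof (intro conjI allI impI)
  fix \<alpha> M C t :: real and p q s :: ennreal
  assume \<alpha>: "1/2 < \<alpha>" and t: "0 \<le> t" "t < 1" and e:
    "1 / p = ennreal (t * (1/2) + (1 - t) * 1)" "1 / q = ennreal (t * (1 / (2 * \<alpha>)) + (1 - t) * 0)"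
    "1 / s = ennreal (t * (1/4) + (1 - t) * 1)"
  obtain K where K: "0 \<le> K" "annular_pair_bound TYPE(real^2) r0 R0 (1/2) (4/3) K"
    using annular_pair_bound_plane[OF assms(1)] by blast
  define A where "A = K * max 0 C powr (1 / (2 * \<alpha>))"
  have A: "0 \<le> A" using K by (simp add: A_def)
  let ?K = "r0 powr (1 - real DIM(real^2)) * A powr (1 / 2)"
  have "\<exists>K. \<forall>\<mu> :: (real^2) measure. borel_prob_supported_in \<mu> M \<and> energy \<alpha> \<mu> \<le> ennreal C
      \<longrightarrow> spherical_estimate r0 R0 \<mu> p q s K"
  proof (rule spherical_estimate_segment[where P = 2 and Q = "2 * \<alpha>" and S = 4 and K = ?K])
    fix \<mu> :: "(real^2) measure"
    assume \<mu>: "borel_prob_supported_in \<mu> M \<and> energy \<alpha> \<mu> \<le> ennreal C"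
    have "adjoint_bound r0 R0 \<mu> 2 (2 * \<alpha> / (2 * \<alpha> - 1)) (4/3) A"
      unfolding A_def using \<mu> \<alpha> K by (intro adjoint_bound_energy) (auto simp: borel_prob_supported_in_def)
    then have "mixed_bound r0 R0 \<mu> 2 (2 * \<alpha>) 4 ?K"
      using \<mu> \<alpha> A assms by (intro mixed_bound_from_adjoint) (auto simp: borel_prob_supported_in_def field_simps)
    then show "prob_space \<mu> \<and> sets \<mu> = sets borel \<and> mixed_bound r0 R0 \<mu> 2 (2 * \<alpha>) 4 ?K"
      using \<mu> by (simp add: borel_prob_supported_in_def)
  qed (use assms \<alpha> t e in simp_all)
  then show "\<exists>K. \<forall>\<mu> :: (real^2) measure. borel_prob_supported_in \<mu> M \<longrightarrow> energy \<alpha> \<mu> \<le> ennreal C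
      \<longrightarrow> spherical_estimate r0 R0 \<mu> p q s K"
    by blast
next
  fix \<alpha> \<alpha>' M C t :: real and p q s :: ennreal
  assume \<alpha>: "0 < \<alpha>" "\<alpha> < \<alpha>'" "\<alpha>' < 1/2" and t: "0 \<le> t" "t < 1" and e:
    "1 / p = ennreal (t * (1 / (1 + 2 * \<alpha>)) + (1 - t) * 1)" "1 / q = ennreal (t * (1 / (1 + 2 * \<alpha>)) + (1 - t) * 0)"
    "1 / s = ennreal (t * ((1 - \<alpha>) / (1 + 2 * \<alpha>)) + (1 - t) * 1)"
  define S where "S = (1 + 2 * \<alpha>) / (1 - \<alpha>)"
  have S: "1 < S" "1 / S = (1 - \<alpha>) / (1 + 2 * \<alpha>)" "1 / S = 1 - 2 / ((1 + (1/2) / \<alpha>) * (4/3))"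
    using \<alpha> by (simp_all add: S_def field_simps)
  obtain K where K: "0 \<le> K" "annular_pair_bound TYPE(real^2) r0 R0 (1/2) (4/3) K"
    using annular_pair_bound_plane[OF assms(1)] by blast
  obtain K' where K': "0 \<le> K'" "\<And>\<mu> :: (real^2) measure. prob_space \<mu> \<Longrightarrow> sets \<mu> = sets borel \<Longrightarrow> ball_growth C \<alpha>' \<mu>
    \<Longrightarrow> mixed_bound r0 R0 \<mu> (1 + 2 * \<alpha>) (1 + 2 * \<alpha>) S K'"
    using mixed_bound_ball_growth[OF assms(1) K(2,1) \<alpha>(1) _ \<alpha>(2) _ _ S(1,3), of "1 + 2 * \<alpha>" C] \<alpha> by auto
  have "\<exists>K. \<forall>\<mu> :: (real^2) measure. borel_prob_supported_in \<mu> M \<and> ball_growth C \<alpha>' \<mu>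
      \<longrightarrow> spherical_estimate r0 R0 \<mu> p q s K"
    by (rule spherical_estimate_segment[where P = "1 + 2 * \<alpha>" and Q = "1 + 2 * \<alpha>" and S = S and K = K'])
       (use assms \<alpha> t e S K' in \<open>auto simp: borel_prob_supported_in_def\<close>)
  then show "\<exists>K. \<forall>\<mu> :: (real^2) measure. borel_prob_supported_in \<mu> M \<longrightarrow> ball_growth C \<alpha>' \<mu>
      \<longrightarrow> spherical_estimate r0 R0 \<mu> p q s K"
    by blast
next
  fix \<alpha> \<alpha>' M C t :: real and p q s :: ennreal
  assume n: "CARD('n) > 2" and \<alpha>: "0 < \<alpha>" "\<alpha> < \<alpha>'" "\<alpha>' < 1" and t: "0 \<le> t" "t < 1" and e:
    "1 / p = ennreal (t * (1 / (1 + \<alpha>)) + (1 - t) * 1)" "1 / q = ennreal (t * (1 / (1 + \<alpha>)) + (1 - t) * 0)"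
    "1 / s = ennreal (t * ((1 - \<alpha>) / (1 + \<alpha>)) + (1 - t) * 1)"
  define S where "S = (1 + \<alpha>) / (1 - \<alpha>)"
  have S: "1 < S" "1 / S = (1 - \<alpha>) / (1 + \<alpha>)" "1 / S = 1 - 2 / ((1 + 1 / \<alpha>) * 1)"
    using \<alpha> by (simp_all add: S_def field_simps)
  have "3 \<le> CARD('n)" using n by simp
  then obtain K where K: "0 \<le> K" "annular_pair_bound TYPE(real^'n) r0 R0 1 1 K"
    using annular_pair_bound_space[OF _ assms(1)] by blast
  obtain K' where K': "0 \<le> K'" "\<And>\<mu> :: (real^'n) measure. prob_space \<mu> \<Longrightarrow> sets \<mu> = sets borel \<Longrightarrow> ball_growth C \<alpha>' \<mu>
    \<Longrightarrow> mixed_bound r0 R0 \<mu> (1 + \<alpha>) (1 + \<alpha>) S K'"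
    using mixed_bound_ball_growth[OF assms(1) K(2,1) \<alpha>(1) _ \<alpha>(2) _ _ S(1,3), of "1 + \<alpha>" C] \<alpha> by auto
  have "\<exists>K. \<forall>\<mu> :: (real^'n) measure. borel_prob_supported_in \<mu> M \<and> ball_growth C \<alpha>' \<mu>
      \<longrightarrow> spherical_estimate r0 R0 \<mu> p q s K"
    by (rule spherical_estimate_segment[where P = "1 + \<alpha>" and Q = "1 + \<alpha>" and S = S and K = K'])
       (use assms \<alpha> t e S K' in \<open>auto simp: borel_prob_supported_in_def\<close>)
  then show "\<exists>K. \<forall>\<mu> :: (real^'n) measure. borel_prob_supported_in \<mu> M \<longrightarrow> ball_growth C \<alpha>' \<mu>
      \<longrightarrow> spherical_estimate r0 R0 \<mu> p q s K"
    by blast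
qed

end
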